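(* Let $M^6$ be connected and let $(J,[\eta])$ be a quasi-integrable $\mathbb{R}^+\!\cdot\mathrm{U}(3)$-structure on $M$. Then either $J$ is integrable (i.e., $\lambda$ vanishes identically) or else the structure satisfies the second-order equations $$\lambda_{\bar\ell}=-\tfrac13\,\overline{\varepsilon_{ij\ell}}\,B_{ij\bar k k}$$ (summed over $i,j,k$), where $\lambda_{\bar\ell}$ and $B_{ij\bar k\ell}$ are the covariant derivative components, defined in the context, of the torsion functions $\lambda$ and $B_{ij\bar k}$.
   Context: For an almost complex structure $J$ on $M^6$, $1$-forms $\alpha$ with $\alpha(Jv)=i\,\alpha(v)$ are of type $(1,0)$; the exterior derivative decomposes by type as $d=d^{2,-1}+\partial+\bar\partial+d^{-1,2}$. For a local $J$-linear coframing $\alpha=(\alpha^1,\alpha^2,\alpha^3)$ (a column of pointwise linearly independent $(1,0)$-forms), $N(\alpha)$ is the matrix function with $$d^{-1,2}\alpha=N(\alpha)\begin{pmatrix}\overline{\alpha^2\wedge\alpha^3}\\ \overline{\alpha^3\wedge\alpha^1}\\ \overline{\alpha^1\wedge\alpha^2}\end{pmatrix}.$$ An $\mathbb{R}^+\!\cdot\mathrm{U}(3)$-structure is a pair $(J,[\eta])$ with $[\eta]$ a positive real $(1,1)$-form up to multiplication by positive functions. A coframing $\alpha$ is conformally unitary if it is $J$-linear and $\eta=\mu\,\tfrac{i}{2}\sum_i\alpha^i\wedge\overline{\alpha^i}$ for some positive function $\mu$. The structure is quasi-integrable if $N(\alpha)$ is a (complex function) multiple of $I_3$ for every local conformally unitary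 coframing. Let $\pi:\mathsf{F}\to M$ be the $\mathbb{R}^+\!\cdot\mathrm{U}(3)$-bundle of conformally unitary coframes and $\zeta=(\zeta_i)$ its tautological $\mathbb{C}^3$-valued $1$-form. On $\mathsf{F}$ there are unique forms and functions with $$d\zeta_i=-\rho\wedge\zeta_i-\kappa_{i\bar\jmath}\wedge\zeta_j-B_{ij\bar k}\,\overline{\zeta_j}\wedge\zeta_k+\tfrac12\varepsilon_{ijk}\,\lambda\,\overline{\zeta_j\wedge\zeta_k},$$ where $\rho=\bar\rho$, $\kappa_{i\bar\jmath}=-\overline{\kappa_{j\bar\imath}}$, $B_{ij\bar k}=-B_{ji\bar k}$, $B_{ij\bar\jmath}=0$ (summed), and $B_{ij\bar k},\lambda$ are complex functions. Repeated indices are summed (a repeated index appears once barred and once unbarred, conjugation counting as a bar), and $\varepsilon_{ijk}=\overline{\varepsilon_{ijk}}$ is the totally antisymmetric symbol with $\varepsilon_{123}=1$. Set $$D\lambda=d\lambda-\lambda(\rho-\kappa_{i\bar\imath}),\qquad DB_{ij\bar k}=dB_{ij\bar k}+B_{pj\bar k}\kappa_{i\bar p}+B_{ip\bar k}\kappa_{j\bar p}-B_{ij\bar p}\kappa_{p\bar k}-B_{ij\bar k}\,\rho.$$ These are $\pi$-semibasic, and one defines $\lambda_{\bar\ell},\lambda_\ell,B_{ij\bar k\bar\ell},B_{ij\bar k\ell}$ by $$D\lambda=\lambda_{\bar\ell}\,\zeta_\ell+\lambda_\ell\,\overline{\zeta_\ell},\qquad DB_{ij\bar k}=B_{ij\bar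 k\bar\ell}\,\zeta_\ell+B_{ij\bar k\ell}\,\overline{\zeta_\ell}.$$ *)

theory Defs
  imports "HOL-Analysis.Analysis"
begin

section \<open>Smooth functions on open subsets of normed spaces\<close>

text \<open>Only used for open \<open>S\<close> in finite-dimensional spaces, where it is the usual notion.\<close>

primrec Ck_on :: "nat \<Rightarrow> 'a::real_normed_vector set \<Rightarrow> ('a \<Rightarrow> 'b::real_normed_vector) \<Rightarrow> bool" where
  "Ck_on 0 S f \<longleftrightarrow> continuous_on S f"
| "Ck_on (Suc k) S f \<longleftrightarrow> (\<forall>x\<in>S. f differentiable (at x)) \<and>
     (\<forall>h. Ck_on k S (\<lambda>x. frechet_derivative f (at x) h))"

definition smooth_on :: "'a::real_normed_vector set \<Rightarrow> ('a \<Rightarrow> 'b::real_normed_vector) \<Rightarrow> bool" where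
  "smooth_on S f \<longleftrightarrow> (\<forall>k. Ck_on k S f)"


section \<open>Coordinate systems, tangent vectors and differential forms\<close>

text \<open>
  A smooth space is given by a set \<open>\<Phi>\<close> of coordinate systems \<open>(D, k)\<close>, where \<open>k\<close> maps the domain
  \<open>D\<close> injectively into a Euclidean space. The image \<open>k ` D\<close> is an open set when \<open>\<Phi>\<close> is an
  atlas of the base manifold, and an embedded submanifold for the coframe bundle below. As usual for
  embedded submanifolds, functions and forms are smooth if, in coordinates, they locally extend to
  smooth ones on an open set of the Euclidean space; if \<open>k ` D\<close> is open, these are the usual notions.
\<close>

type_synonym ('x, 'e) atlas = "('x set \<times> ('x \<Rightarrow> 'e)) set"
type_synonym 'x tvec = "('x \<Rightarrow> real) \<Rightarrow> real"
type_synonym 'x form1 = "'x \<Rightarrow> 'x tvec \<Rightarrow> complex"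

definition smooth_at ::
  "('x, 'e::euclidean_space) atlas \<Rightarrow> 'x \<Rightarrow> ('x \<Rightarrow> 'b::real_normed_vector) \<Rightarrow> bool" where
  "smooth_at \<Phi> p f \<longleftrightarrow> (\<exists>(D, k)\<in>\<Phi>. p \<in> D \<and>
     (\<exists>S g. open S \<and> k p \<in> S \<and> smooth_on S g \<and> (\<forall>q\<in>D. k q \<in> S \<longrightarrow> f q = g (k q))))"

text \<open>Smoothness of a curve near the parameter value \<open>0\<close>.\<close>

definition smooth_curve :: "('x, 'e::euclidean_space) atlas \<Rightarrow> (real \<Rightarrow> 'x) \<Rightarrow> bool" where
  "smooth_curve \<Phi> \<gamma> \<longleftrightarrow> (\<exists>(D, k)\<in>\<Phi>. \<exists>\<delta>>0.
     (\<forall>t. \<bar>t\<bar> < \<delta> \<longrightarrow> \<gamma> t \<in> D) \<and> smooth_on {-\<delta><..<\<delta>} (k \<circ> \<gamma>))"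

text \<open>
  Tangent vectors at \<open>p\<close> are velocities of smooth curves through \<open>p\<close>, regarded as derivations on
  the functions that are smooth near \<open>p\<close> (extended by \<open>0\<close> to all other functions).
\<close>

definition velocity :: "('x, 'e::euclidean_space) atlas \<Rightarrow> (real \<Rightarrow> 'x) \<Rightarrow> 'x tvec" where
  "velocity \<Phi> \<gamma> = (\<lambda>f. if smooth_at \<Phi> (\<gamma> 0) f then deriv (f \<circ> \<gamma>) 0 else 0)"

definition tangent_space :: "('x, 'e::euclidean_space) atlas \<Rightarrow> 'x \<Rightarrow> 'x tvec set" where
  "tangent_space \<Phi> p = {velocity \<Phi> \<gamma> |\<gamma>. smooth_curve \<Phi> \<gamma> \<and> \<gamma> 0 = p}"

text \<open>The coordinates of a tangent vector, i.e. the differential of \<open>k\<close>.\<close>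

definition dcoord :: "('x \<Rightarrow> 'e::euclidean_space) \<Rightarrow> 'x tvec \<Rightarrow> 'e" where
  "dcoord k v = (\<Sum>b\<in>Basis. v (\<lambda>q. k q \<bullet> b) *\<^sub>R b)"

definition d0 :: "('x \<Rightarrow> complex) \<Rightarrow> 'x tvec \<Rightarrow> complex" where
  "d0 f v = Complex (v (\<lambda>q. Re (f q))) (v (\<lambda>q. Im (f q)))"

text \<open>\<open>W\<close> is a smooth coordinate expression, in the coordinates \<open>k\<close>, of the 1-form \<open>\<omega>\<close> near \<open>p\<close>.\<close>

definition form1_rep ::
  "('x, 'e::euclidean_space) atlas \<Rightarrow> 'x form1 \<Rightarrow> 'x \<Rightarrow> ('x \<Rightarrow> 'e) \<Rightarrow> ('e \<Rightarrow> 'e \<Rightarrow> complex) \<Rightarrow> bool" where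
  "form1_rep \<Phi> \<omega> p k W \<longleftrightarrow> (\<exists>D S. (D, k) \<in> \<Phi> \<and> p \<in> D \<and> open S \<and> k p \<in> S \<and>
     (\<forall>h. smooth_on S (\<lambda>x. W x h)) \<and> (\<forall>x\<in>S. linear (W x)) \<and>
     (\<forall>q\<in>D. k q \<in> S \<longrightarrow> (\<forall>v\<in>tangent_space \<Phi> q. \<omega> q v = W (k q) (dcoord k v))))"

definition smooth_form1 :: "('x, 'e::euclidean_space) atlas \<Rightarrow> 'x set \<Rightarrow> 'x form1 \<Rightarrow> bool" where
  "smooth_form1 \<Phi> U \<omega> \<longleftrightarrow> (\<forall>p\<in>U. \<exists>k W. form1_rep \<Phi> \<omega> p k W)"

text \<open>
  The exterior derivative of a smooth 1-form, computed from a coordinate expression \<open>W\<close>; on vectors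
  tangent to the space it does not depend on the choice of \<open>k\<close> and \<open>W\<close>. The normalisation is
  \<open>d\<omega>(X,Y) = X(\<omega>(Y)) - Y(\<omega>(X)) - \<omega>([X,Y])\<close>, matching that of \<open>wedge\<close>.
\<close>

definition d1 ::
  "('x, 'e::euclidean_space) atlas \<Rightarrow> 'x form1 \<Rightarrow> 'x \<Rightarrow> 'x tvec \<Rightarrow> 'x tvec \<Rightarrow> complex" where
  "d1 \<Phi> \<omega> p v w = (let (k, W) = (SOME (k, W). form1_rep \<Phi> \<omega> p k W) in
     frechet_derivative (\<lambda>x. W x (dcoord k w)) (at (k p)) (dcoord k v)
     - frechet_derivative (\<lambda>x. W x (dcoord k v)) (at (k p)) (dcoord k w))"

definition wedge :: "('v \<Rightarrow> complex) \<Rightarrow> ('v \<Rightarrow> complex) \<Rightarrow> 'v \<Rightarrow> 'v \<Rightarrow> complex" where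
  "wedge a b v w = a v * b w - a w * b v"


section \<open>Almost complex 6-manifolds with a conformal class of positive (1,1)-forms\<close>

definition smooth_atlas6 ::
  "('m::{t2_space,second_countable_topology}, real^6) atlas \<Rightarrow> bool" where
  "smooth_atlas6 A \<longleftrightarrow> (\<Union>(fst ` A) = UNIV) \<and>
     (\<forall>(U, \<phi>)\<in>A. open U \<and> open (\<phi> ` U) \<and> homeomorphism U (\<phi> ` U) \<phi> (inv_into U \<phi>)) \<and>
     (\<forall>(U, \<phi>)\<in>A. \<forall>(V, \<psi>)\<in>A. smooth_on (\<phi> ` (U \<inter> V)) (\<psi> \<circ> inv_into U \<phi>))"

definition almost_complex_structure ::
  "('m, 'e::euclidean_space) atlas \<Rightarrow> ('m \<Rightarrow> 'm tvec \<Rightarrow> 'm tvec) \<Rightarrow> bool" where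
  "almost_complex_structure A J \<longleftrightarrow>
     (\<forall>p. \<forall>v\<in>tangent_space A p. J p v \<in> tangent_space A p \<and> J p (J p v) = (\<lambda>f. - v f)) \<and>
     (\<forall>p. \<exists>(U, \<phi>)\<in>A. p \<in> U \<and> (\<exists>S K. open S \<and> \<phi> p \<in> S \<and>
        (\<forall>h. smooth_on S (\<lambda>x. K x h)) \<and> (\<forall>x\<in>S. linear (K x)) \<and>
        (\<forall>q\<in>U. \<phi> q \<in> S \<longrightarrow> (\<forall>v\<in>tangent_space A q. dcoord \<phi> (J q v) = K (\<phi> q) (dcoord \<phi> v)))))"

definition smooth_form2 ::
  "('m, 'e::euclidean_space) atlas \<Rightarrow> ('m \<Rightarrow> 'm tvec \<Rightarrow> 'm tvec \<Rightarrow> real) \<Rightarrow> bool" where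
  "smooth_form2 A \<eta> \<longleftrightarrow> (\<forall>p. \<exists>(U, \<phi>)\<in>A. p \<in> U \<and> (\<exists>S H. open S \<and> \<phi> p \<in> S \<and>
     (\<forall>h h'. smooth_on S (\<lambda>x. H x h h')) \<and>
     (\<forall>x\<in>S. bilinear (H x) \<and> (\<forall>h h'. H x h h' = - H x h' h)) \<and>
     (\<forall>q\<in>U. \<phi> q \<in> S \<longrightarrow> (\<forall>v\<in>tangent_space A q. \<forall>w\<in>tangent_space A q.
        \<eta> q v w = H (\<phi> q) (dcoord \<phi> v) (dcoord \<phi> w)))))"

definition positive_form11 ::
  "('m, 'e::euclidean_space) atlas \<Rightarrow> ('m \<Rightarrow> 'm tvec \<Rightarrow> 'm tvec) \<Rightarrow>
   ('m \<Rightarrow> 'm tvec \<Rightarrow> 'm tvec \<Rightarrow> real) \<Rightarrow> bool" where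
  "positive_form11 A J \<eta> \<longleftrightarrow> smooth_form2 A \<eta> \<and>
     (\<forall>p. \<forall>v\<in>tangent_space A p. \<forall>w\<in>tangent_space A p. \<eta> p (J p v) (J p w) = \<eta> p v w) \<and>
     (\<forall>p. \<forall>v\<in>tangent_space A p. v \<noteq> (\<lambda>f. 0) \<longrightarrow> \<eta> p v (J p v) > 0)"

text \<open>
  A structure \<open>(J, [\<eta>])\<close> is given by \<open>J\<close> and a representative \<open>\<eta>\<close> of the conformal class. Everything
  below depends on \<open>\<eta>\<close> only through \<open>conformally_unitary\<close>, hence only on its class.
\<close>

definition R_U3_structure ::
  "('m, 'e::euclidean_space) atlas \<Rightarrow> ('m \<Rightarrow> 'm tvec \<Rightarrow> 'm tvec) \<Rightarrow>
   ('m \<Rightarrow> 'm tvec \<Rightarrow> 'm tvec \<Rightarrow> real) \<Rightarrow> bool" where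
  "R_U3_structure A J \<eta> \<longleftrightarrow> almost_complex_structure A J \<and> positive_form11 A J \<eta>"

definition J_linear_coframe ::
  "('m, 'e::euclidean_space) atlas \<Rightarrow> ('m \<Rightarrow> 'm tvec \<Rightarrow> 'm tvec) \<Rightarrow> 'm \<Rightarrow>
   ('m tvec \<Rightarrow> complex^3) \<Rightarrow> bool" where
  "J_linear_coframe A J p u \<longleftrightarrow>
     (\<forall>v\<in>tangent_space A p. \<forall>w\<in>tangent_space A p. \<forall>a b.
        u (\<lambda>f. a * v f + b * w f) = a *\<^sub>R u v + b *\<^sub>R u w) \<and>
     (\<forall>v\<in>tangent_space A p. u (J p v) = \<i> *s u v) \<and>
     (\<forall>c. (\<forall>v\<in>tangent_space A p. (\<Sum>i\<in>UNIV. c i * u v $ i) = 0) \<longrightarrow> (\<forall>i. c i = 0))"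

definition conformally_unitary ::
  "('m, 'e::euclidean_space) atlas \<Rightarrow> ('m \<Rightarrow> 'm tvec \<Rightarrow> 'm tvec) \<Rightarrow>
   ('m \<Rightarrow> 'm tvec \<Rightarrow> 'm tvec \<Rightarrow> real) \<Rightarrow> 'm \<Rightarrow> ('m tvec \<Rightarrow> complex^3) \<Rightarrow> bool" where
  "conformally_unitary A J \<eta> p u \<longleftrightarrow> J_linear_coframe A J p u \<and>
     (\<exists>\<mu>::real. \<mu> > 0 \<and> (\<forall>v\<in>tangent_space A p. \<forall>w\<in>tangent_space A p.
        complex_of_real (\<eta> p v w) =
          of_real \<mu> * (\<i> / 2) * (\<Sum>i\<in>UNIV. wedge (\<lambda>x. u x $ i) (\<lambda>x. cnj (u x $ i)) v w)))"

definition local_conformally_unitary_coframing ::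
  "('m::topological_space, 'e::euclidean_space) atlas \<Rightarrow> ('m \<Rightarrow> 'm tvec \<Rightarrow> 'm tvec) \<Rightarrow>
   ('m \<Rightarrow> 'm tvec \<Rightarrow> 'm tvec \<Rightarrow> real) \<Rightarrow> 'm set \<Rightarrow> ('m \<Rightarrow> 'm tvec \<Rightarrow> complex^3) \<Rightarrow> bool" where
  "local_conformally_unitary_coframing A J \<eta> U \<alpha> \<longleftrightarrow> open U \<and>
     (\<forall>i. smooth_form1 A U (\<lambda>p v. \<alpha> p v $ i)) \<and> (\<forall>p\<in>U. conformally_unitary A J \<eta> p (\<alpha> p))"

text \<open>
  The (0,2)-part of a 2-form \<open>\<beta>\<close> at a point with complex structure \<open>j\<close>. The projection kills
  \<open>\<beta>\<close> with \<open>\<beta>(jv, w) = \<i> \<beta>(v, w)\<close> and with \<open>\<beta>(jv, jw) = \<beta>(v, w)\<close>, and fixes \<open>\<beta>\<close> with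
  \<open>\<beta>(jv, w) = -\<i> \<beta>(v, w)\<close>.
\<close>

definition part02 :: "('v \<Rightarrow> 'v) \<Rightarrow> ('v \<Rightarrow> 'v \<Rightarrow> complex) \<Rightarrow> 'v \<Rightarrow> 'v \<Rightarrow> complex" where
  "part02 j \<beta> v w = (\<beta> v w + \<i> * \<beta> (j v) w + \<i> * \<beta> v (j w) - \<beta> (j v) (j w)) / 4"

text \<open>On (1,0)-forms, \<open>d\<^sup>-\<^sup>1\<^sup>,\<^sup>2\<close> is the (0,2)-part of \<open>d\<close>.\<close>

definition N_matrix ::
  "('m, 'e::euclidean_space) atlas \<Rightarrow> ('m \<Rightarrow> 'm tvec \<Rightarrow> 'm tvec) \<Rightarrow>
   ('m \<Rightarrow> 'm tvec \<Rightarrow> complex^3) \<Rightarrow> 'm \<Rightarrow> complex^3^3" where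
  "N_matrix A J \<alpha> p = (THE N. \<forall>v\<in>tangent_space A p. \<forall>w\<in>tangent_space A p. \<forall>i.
     part02 (J p) (d1 A (\<lambda>q x. \<alpha> q x $ i) p) v w =
       (N *v vector [cnj (wedge (\<lambda>x. \<alpha> p x $ 2) (\<lambda>x. \<alpha> p x $ 3) v w),
                     cnj (wedge (\<lambda>x. \<alpha> p x $ 3) (\<lambda>x. \<alpha> p x $ 1) v w),
                     cnj (wedge (\<lambda>x. \<alpha> p x $ 1) (\<lambda>x. \<alpha> p x $ 2) v w)]) $ i)"

definition quasi_integrable ::
  "('m::topological_space, 'e::euclidean_space) atlas \<Rightarrow> ('m \<Rightarrow> 'm tvec \<Rightarrow> 'm tvec) \<Rightarrow>
   ('m \<Rightarrow> 'm tvec \<Rightarrow> 'm tvec \<Rightarrow> real) \<Rightarrow> bool" where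
  "quasi_integrable A J \<eta> \<longleftrightarrow>
     (\<forall>U \<alpha>. local_conformally_unitary_coframing A J \<eta> U \<alpha> \<longrightarrow>
        (\<forall>p\<in>U. \<exists>c. N_matrix A J \<alpha> p = mat c))"


section \<open>The bundle of conformally unitary coframes\<close>

text \<open>A coframe is a function on \<open>tangent_space A p\<close>, extended by \<open>0\<close> outside.\<close>

type_synonym 'm coframe = "'m \<times> ('m tvec \<Rightarrow> complex^3)"

definition coframe_bundle ::
  "('m, 'e::euclidean_space) atlas \<Rightarrow> ('m \<Rightarrow> 'm tvec \<Rightarrow> 'm tvec) \<Rightarrow>
   ('m \<Rightarrow> 'm tvec \<Rightarrow> 'm tvec \<Rightarrow> real) \<Rightarrow> 'm coframe set" where
  "coframe_bundle A J \<eta> =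
     {(p, u). conformally_unitary A J \<eta> p u \<and> (\<forall>v. v \<notin> tangent_space A p \<longrightarrow> u v = 0)}"

definition coord_vec ::
  "('m, real^6) atlas \<Rightarrow> 'm set \<times> ('m \<Rightarrow> real^6) \<Rightarrow> 'm \<Rightarrow> 6 \<Rightarrow> 'm tvec" where
  "coord_vec A c p j =
     velocity A (\<lambda>t. inv_into (fst c) (snd c) (snd c p + t *\<^sub>R axis j 1))"

text \<open>
  Over a chart of \<open>M\<close>, a coframe \<open>(p, u)\<close> has as coordinates those of \<open>p\<close> and the values of \<open>u\<close> on
  the six coordinate vector fields. This embeds the part of the bundle over the chart domain as a
  16-dimensional submanifold.
\<close>

definition coframe_atlas ::
  "('m, real^6) atlas \<Rightarrow> ('m \<Rightarrow> 'm tvec \<Rightarrow> 'm tvec) \<Rightarrow>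
   ('m \<Rightarrow> 'm tvec \<Rightarrow> 'm tvec \<Rightarrow> real) \<Rightarrow> ('m coframe, (real^6) \<times> ((complex^3)^6)) atlas" where
  "coframe_atlas A J \<eta> =
     (\<lambda>c. ({x \<in> coframe_bundle A J \<eta>. fst x \<in> fst c},
           \<lambda>(p, u). (snd c p, \<chi> j. u (coord_vec A c p j)))) ` A"

text \<open>The differential at a coframe over \<open>p\<close> of the bundle projection \<open>fst\<close>.\<close>

definition dproj :: "('m, 'e::euclidean_space) atlas \<Rightarrow> 'm \<Rightarrow> 'm coframe tvec \<Rightarrow> 'm tvec" where
  "dproj A p V = (\<lambda>f. if smooth_at A p f then V (f \<circ> fst) else 0)"

definition tautological_form ::
  "('m, 'e::euclidean_space) atlas \<Rightarrow> 3 \<Rightarrow> 'm coframe form1" where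
  "tautological_form A i x V = snd x (dproj A (fst x) V) $ i"

definition eps :: "3 \<Rightarrow> 3 \<Rightarrow> 3 \<Rightarrow> complex" where
  "eps i j k =
     (if (i, j, k) \<in> {(1, 2, 3), (2, 3, 1), (3, 1, 2)} then 1
      else if (i, j, k) \<in> {(1, 3, 2), (3, 2, 1), (2, 1, 3)} then - 1 else 0)"

text \<open>
  Index conventions: \<open>\<kappa> i j\<close> carries a bar on \<open>j\<close> and \<open>B i j k\<close> a bar on \<open>k\<close>.
\<close>

definition structure_equations ::
  "('m, real^6) atlas \<Rightarrow> ('m \<Rightarrow> 'm tvec \<Rightarrow> 'm tvec) \<Rightarrow>
   ('m \<Rightarrow> 'm tvec \<Rightarrow> 'm tvec \<Rightarrow> real) \<Rightarrow>
   'm coframe form1 \<Rightarrow> (3 \<Rightarrow> 3 \<Rightarrow> 'm coframe form1) \<Rightarrow>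
   (3 \<Rightarrow> 3 \<Rightarrow> 3 \<Rightarrow> 'm coframe \<Rightarrow> complex) \<Rightarrow> ('m coframe \<Rightarrow> complex) \<Rightarrow> bool" where
  "structure_equations A J \<eta> \<rho> \<kappa> B lam \<longleftrightarrow>
     (let F = coframe_bundle A J \<eta>; \<Phi> = coframe_atlas A J \<eta>; T = tangent_space \<Phi>;
          \<zeta> = tautological_form A
      in
        smooth_form1 \<Phi> F \<rho> \<and> (\<forall>i j. smooth_form1 \<Phi> F (\<kappa> i j)) \<and>
        (\<forall>x\<in>F. smooth_at \<Phi> x lam \<and> (\<forall>i j k. smooth_at \<Phi> x (B i j k))) \<and>
        (\<forall>x\<in>F. \<forall>V\<in>T x. \<rho> x V = cnj (\<rho> x V)) \<and>
        (\<forall>x\<in>F. \<forall>V\<in>T x. \<forall>i j. \<kappa> i j x V = - cnj (\<kappa> j i x V)) \<and>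
        (\<forall>x\<in>F. \<forall>i j k. B i j k x = - B j i k x) \<and>
        (\<forall>x\<in>F. \<forall>i. (\<Sum>j\<in>UNIV. B i j j x) = 0) \<and>
        (\<forall>x\<in>F. \<forall>V\<in>T x. \<forall>W\<in>T x. \<forall>i.
           d1 \<Phi> (\<zeta> i) x V W =
             - wedge (\<rho> x) (\<zeta> i x) V W
             - (\<Sum>j\<in>UNIV. wedge (\<kappa> i j x) (\<zeta> j x) V W)
             - (\<Sum>j\<in>UNIV. \<Sum>k\<in>UNIV. B i j k x * wedge (\<lambda>X. cnj (\<zeta> j x X)) (\<zeta> k x) V W)
             + 1/2 * (\<Sum>j\<in>UNIV. \<Sum>k\<in>UNIV.
                 eps i j k * lam x * cnj (wedge (\<zeta> j x) (\<zeta> k x) V W))))"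

definition D_lam ::
  "'x form1 \<Rightarrow> (3 \<Rightarrow> 3 \<Rightarrow> 'x form1) \<Rightarrow> ('x \<Rightarrow> complex) \<Rightarrow> 'x form1" where
  "D_lam \<rho> \<kappa> lam x V = d0 lam V - lam x * (\<rho> x V - (\<Sum>i\<in>UNIV. \<kappa> i i x V))"

definition D_B ::
  "'x form1 \<Rightarrow> (3 \<Rightarrow> 3 \<Rightarrow> 'x form1) \<Rightarrow> (3 \<Rightarrow> 3 \<Rightarrow> 3 \<Rightarrow> 'x \<Rightarrow> complex) \<Rightarrow>
   3 \<Rightarrow> 3 \<Rightarrow> 3 \<Rightarrow> 'x form1" where
  "D_B \<rho> \<kappa> B i j k x V = d0 (B i j k) V
     + (\<Sum>p\<in>UNIV. B p j k x * \<kappa> i p x V)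
     + (\<Sum>p\<in>UNIV. B i p k x * \<kappa> j p x V)
     - (\<Sum>p\<in>UNIV. B i j p x * \<kappa> p k x V)
     - B i j k x * \<rho> x V"

text \<open>
  \<open>\<theta> = b\<^sub>l \<zeta>\<^sub>l + a\<^sub>l cnj \<zeta>\<^sub>l\<close>, where the first coefficients \<open>b\<close> are those written with a barred
  derivative index and the second ones \<open>a\<close> those with an unbarred one.
\<close>

definition semibasic_expansion ::
  "('m, real^6) atlas \<Rightarrow> ('m \<Rightarrow> 'm tvec \<Rightarrow> 'm tvec) \<Rightarrow>
   ('m \<Rightarrow> 'm tvec \<Rightarrow> 'm tvec \<Rightarrow> real) \<Rightarrow> 'm coframe form1 \<Rightarrow>
   (3 \<Rightarrow> 'm coframe \<Rightarrow> complex) \<Rightarrow> (3 \<Rightarrow> 'm coframe \<Rightarrow> complex) \<Rightarrow> bool" where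
  "semibasic_expansion A J \<eta> \<theta> b a \<longleftrightarrow>
     (\<forall>x\<in>coframe_bundle A J \<eta>. \<forall>V\<in>tangent_space (coframe_atlas A J \<eta>) x.
        \<theta> x V = (\<Sum>l\<in>UNIV. b l x * tautological_form A l x V)
               + (\<Sum>l\<in>UNIV. a l x * cnj (tautological_form A l x V)))"

end

theory Submission
  imports Defs
begin

text \<open>
  Pull all data back along a local unitary section of the coframe bundle. The (0,3)-part of
  \<open>d\<^sup>2\<alpha>\<^sub>i = 0\<close> gives \<open>\<lambda>\<^sub>l = 0\<close>, and the (1,2)- and (3,0)-parts express the traces of the (0,2)-parts
  of the curvature by the first covariant derivatives of \<open>\<lambda>\<close> and \<open>B\<close>. With \<open>d\<^sup>2\<lambda> = 0\<close> this yields the asserted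
  equation multiplied by \<open>\<lambda>\<close>.

  It remains to see that \<open>\<lambda>\<close> cannot vanish on a nonempty open set unless it vanishes identically.
  Since \<open>\<lambda>\<^sub>l = 0\<close>, \<open>\<lambda>\<close> solves a Cauchy-Riemann system, so that \<open>log |\<lambda>|\<close> satisfies a linear
  elliptic inequality wherever \<open>\<lambda> \<noteq> 0\<close>. Because \<open>log |\<lambda>|\<close> is minus infinity on the zero set,
  comparison with arbitrarily large multiples of a barrier function propagates zeros from a ball to
  a larger concentric one, by the maximum principle alone.
\<close>

section \<open>Smooth functions\<close>

text \<open>On two (0,1)-vectors every term of \<open>d\<^sup>2\<lambda> = 0\<close> carries a
  factor \<lambda>: the connection terms visibly, the others because the (0,2)-part of
  \<open>d\<alpha>\<^sub>l\<close> is a multiple of \<lambda>. So the equation is first obtained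
  where \<lambda> is nonzero; it extends by continuity once the zero set has empty interior. The
  identity theorem for holomorphic functions does not settle that: J is not integrable where
  \<lambda> is nonzero, so holomorphic coordinates are missing, and the coefficients are merely
  smooth. But the Cauchy-Riemann system prescribes the (0,1)-derivatives of log \<lambda>.
  Differentiating them along the conjugate frame vectors and taking real parts gives a second-order
  equation whose principal part, the trace of the complex Hessian in the frame, is elliptic. That
  the frame varies only costs first-order terms. Restriction to sections loses nothing: the equation
  concerns semibasic components, and a unitary section passes through every coframe. Along it all
  bundle data become smooth functions on an open subset of \<open>real^6\<close>.\<close>

lemma Ck_on_cong_imp:
  assumes "open S" "Ck_on k S f" "\<And>x. x \<in> S \<Longrightarrow> f x = g x"
  shows "Ck_on k S g"
  using assms(2,3)
proof (induction k arbitrary: f g)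
  case 0
  then show ?case using continuous_on_cong by (metis Ck_on.simps(1))
next
  case (Suc k)
  have d: "f differentiable (at x)" if "x \<in> S" for x using Suc.prems that by simp
  have fg: "frechet_derivative f (at x) = frechet_derivative g (at x)" if "x \<in> S" for x
    by (rule frechet_derivative_transform_within_open[OF d[OF that] assms(1) that]) (rule Suc.prems)
  have "g differentiable (at x)" if "x \<in> S" for x
    using d[OF that] has_derivative_transform_within_open[OF _ assms(1) that] Suc.prems(2)
    unfolding differentiable_def by blast
  moreover have "Ck_on k S (\<lambda>x. frechet_derivative g (at x) h)" for h
    by (rule Suc.IH[of "\<lambda>x. frechet_derivative f (at x) h"]) (use Suc.prems fg in auto)
  ultimately show ?case by simp
qed

lemma Ck_on_subset: "Ck_on k S f \<Longrightarrow> T \<subseteq> S \<Longrightarrow> Ck_on k T f"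
proof (induction k arbitrary: f)
  case 0
  then show ?case using continuous_on_subset by auto
next
  case (Suc k)
  have "Ck_on k T (\<lambda>x. frechet_derivative f (at x) h)" for h
    by (rule Suc.IH) (use Suc.prems in simp_all)
  moreover have "f differentiable (at x)" if "x \<in> T" for x
    using Suc.prems that by auto
  ultimately show ?case by simp
qed

lemma Ck_on_SucD: "Ck_on (Suc k) S f \<Longrightarrow> Ck_on k S f"
proof (induction k arbitrary: f)
  case 0
  then show ?case
    by (simp add: continuous_at_imp_continuous_on differentiable_imp_continuous_within)
next
  case (Suc k)
  have "Ck_on k S (\<lambda>x. frechet_derivative f (at x) h)" for h
    by (rule Suc.IH) (use Suc.prems in simp)
  moreover have "f differentiable (at x)" if "x \<in> S" for x
    using Suc.prems that by simp
  ultimately show ?case by simp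
qed

lemma Ck_on_local:
  assumes "\<And>x. x \<in> S \<Longrightarrow> \<exists>T. open T \<and> x \<in> T \<and> Ck_on k T f"
  shows "Ck_on k S f"
  using assms
proof (induction k arbitrary: f)
  case 0
  show ?case unfolding Ck_on.simps
  proof (rule continuous_at_imp_continuous_on, rule ballI)
    fix x assume "x \<in> S"
    then obtain T where "open T" "x \<in> T" "Ck_on 0 T f" using 0 by blast
    then show "isCont f x" using continuous_on_eq_continuous_at by auto
  qed
next
  case (Suc k)
  have "Ck_on k S (\<lambda>x. frechet_derivative f (at x) h)" for h
  proof (rule Suc.IH)
    fix x assume "x \<in> S"
    then obtain T where "open T" "x \<in> T" "Ck_on (Suc k) T f" using Suc.prems by blast
    then show "\<exists>T. open T \<and> x \<in> T \<and> Ck_on k T (\<lambda>x. frechet_derivative f (at x) h)" by auto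
  qed
  moreover have "f differentiable (at x)" if "x \<in> S" for x
    using Suc.prems[OF that] by auto
  ultimately show ?case by simp
qed

lemma Ck_on_const: "Ck_on k S (\<lambda>x. c)"
  by (induction k arbitrary: c) auto

lemma Ck_on_add:
  assumes "open S" "Ck_on k S f" "Ck_on k S g"
  shows "Ck_on k S (\<lambda>x. f x + g x)"
  using assms(2,3)
proof (induction k arbitrary: f g)
  case 0
  then show ?case by (auto intro: continuous_intros)
next
  case (Suc k)
  note w = frechet_derivative_works[THEN iffD1]
  have fd: "frechet_derivative (\<lambda>x. f x + g x) (at x)
      = (\<lambda>h. frechet_derivative f (at x) h + frechet_derivative g (at x) h)"
    if "x \<in> S" for x
    by (rule frechet_derivative_at[symmetric], rule has_derivative_add; rule w) (use Suc.prems that in auto)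
  show ?case unfolding Ck_on.simps
  proof (intro conjI allI ballI)
    show "(\<lambda>x. f x + g x) differentiable (at x)" if "x \<in> S" for x
      using Suc.prems that by auto
    show "Ck_on k S (\<lambda>x. frechet_derivative (\<lambda>x. f x + g x) (at x) h)" for h
      by (rule Ck_on_cong_imp[OF assms(1) Suc.IH[of "\<lambda>x. frechet_derivative f (at x) h"
            "\<lambda>x. frechet_derivative g (at x) h"]]) (use Suc.prems fd in auto)
  qed
qed

lemma Ck_on_bounded_linear:
  assumes "bounded_linear L" "open S" "Ck_on k S f"
  shows "Ck_on k S (\<lambda>x. L (f x))"
  using assms(3)
proof (induction k arbitrary: f)
  case 0
  then show ?case using assms(1) by (auto intro: bounded_linear.continuous_on)
next
  case (Suc k)
  have d: "((\<lambda>x. L (f x)) has_derivative (\<lambda>h. L (frechet_derivative f (at x) h))) (at x)"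
    if "x \<in> S" for x
    by (rule bounded_linear.has_derivative[OF assms(1)], rule frechet_derivative_works[THEN iffD1])
       (use Suc.prems that in auto)
  show ?case unfolding Ck_on.simps
  proof (intro conjI allI ballI)
    show "(\<lambda>x. L (f x)) differentiable (at x)" if "x \<in> S" for x
      using d[OF that] by (rule differentiableI)
    show "Ck_on k S (\<lambda>x. frechet_derivative (\<lambda>x. L (f x)) (at x) h)" for h
    proof (rule Ck_on_cong_imp[OF assms(2) Suc.IH[of "\<lambda>x. frechet_derivative f (at x) h"]])
      show "Ck_on k S (\<lambda>x. frechet_derivative f (at x) h)" using Suc.prems by simp
      show "L (frechet_derivative f (at x) h) = frechet_derivative (\<lambda>x. L (f x)) (at x) h" if "x \<in> S" for x
        using frechet_derivative_at[OF d[OF that]] by metis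
    qed
  qed
qed

lemma Ck_on_bilinear:
  assumes "bounded_bilinear b" "open S" "Ck_on k S f" "Ck_on k S g"
  shows "Ck_on k S (\<lambda>x. b (f x) (g x))"
  using assms(3,4)
proof (induction k arbitrary: f g)
  case 0
  then show ?case using assms(1) by (auto intro: bounded_bilinear.continuous_on)
next
  case (Suc k)
  have d: "((\<lambda>x. b (f x) (g x)) has_derivative
      (\<lambda>h. b (f x) (frechet_derivative g (at x) h) + b (frechet_derivative f (at x) h) (g x))) (at x)"
    if "x \<in> S" for x
    by (rule bounded_bilinear.FDERIV[OF assms(1)]; rule frechet_derivative_works[THEN iffD1])
       (use Suc.prems that in auto)
  have fg: "Ck_on k S f" "Ck_on k S g" using Suc.prems Ck_on_SucD by blast+
  show ?case unfolding Ck_on.simps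
  proof (intro conjI allI ballI)
    show "(\<lambda>x. b (f x) (g x)) differentiable (at x)" if "x \<in> S" for x
      using d[OF that] by (rule differentiableI)
    show "Ck_on k S (\<lambda>x. frechet_derivative (\<lambda>x. b (f x) (g x)) (at x) h)" for h
    proof (rule Ck_on_cong_imp[OF assms(2)])
      show "Ck_on k S (\<lambda>x. b (f x) (frechet_derivative g (at x) h) + b (frechet_derivative f (at x) h) (g x))"
        using Suc.prems fg by (intro Ck_on_add assms(2) Suc.IH) auto
      show "b (f x) (frechet_derivative g (at x) h) + b (frechet_derivative f (at x) h) (g x)
          = frechet_derivative (\<lambda>x. b (f x) (g x)) (at x) h" if "x \<in> S" for x
        using frechet_derivative_at[OF d[OF that]] by metis
    qed
  qed
qed

lemma Ck_on_sum:
  assumes "open S" "\<And>i. i \<in> I \<Longrightarrow> Ck_on k S (f i)"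
  shows "Ck_on k S (\<lambda>x. \<Sum>i\<in>I. f i x)"
  using assms(2)
  by (induction I rule: infinite_finite_induct) (auto intro: Ck_on_const Ck_on_add[OF assms(1)])

lemma linear_basis_sum:
  fixes v :: "'e::euclidean_space"
  assumes "linear L"
  shows "L v = (\<Sum>b\<in>Basis. (v \<bullet> b) *\<^sub>R L b)"
proof -
  have "L v = L (\<Sum>b\<in>Basis. (v \<bullet> b) *\<^sub>R b)" by (simp add: euclidean_representation)
  then show ?thesis by (simp add: linear_sum[OF assms] linear_cmul[OF assms])
qed

lemma linear_axis_sum:
  fixes L :: "real^'n \<Rightarrow> 'b::real_vector"
  assumes "linear L"
  shows "L h = (\<Sum>i\<in>UNIV. h $ i *\<^sub>R L (axis i 1))"
proof -
  have "h = (\<Sum>i\<in>UNIV. h $ i *\<^sub>R axis i 1)"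
    using basis_expansion[of h] by (simp add: scalar_mult_eq_scaleR)
  then have "L h = L (\<Sum>i\<in>UNIV. h $ i *\<^sub>R axis i 1)" by simp
  then show ?thesis by (simp add: linear_sum[OF assms] linear_cmul[OF assms])
qed

lemma frechet_derivative_basis:
  fixes v :: "'a::euclidean_space"
  assumes "g differentiable (at y)"
  shows "frechet_derivative g (at y) v = (\<Sum>b\<in>Basis. (v \<bullet> b) *\<^sub>R frechet_derivative g (at y) b)"
  by (rule linear_basis_sum[OF linear_frechet_derivative[OF assms]])

lemma frechet_derivative_chain:
  assumes "f differentiable (at x)" "g differentiable (at (f x))"
  shows "frechet_derivative (\<lambda>x. g (f x)) (at x) h
    = frechet_derivative g (at (f x)) (frechet_derivative f (at x) h)"
  using frechet_derivative_compose[OF assms] by (simp add: o_def)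

text \<open>\<open>Ck_on\<close> speaks of derivatives in a fixed direction, whereas the chain rule
  differentiates \<open>g\<close> in the varying direction given by the derivative of
  \<open>f\<close>. Expanding that direction in a basis leaves a finite sum of products, to which
  the induction hypothesis for the derivatives of \<open>g\<close> applies.\<close>

lemma Ck_on_compose:
  fixes f :: "'a::real_normed_vector \<Rightarrow> 'b::euclidean_space"
  assumes "open S" "open T" "Ck_on k S f" "Ck_on k T g" "f ` S \<subseteq> T"
  shows "Ck_on k S (\<lambda>x. g (f x))"
  using assms(3,4)
proof (induction k arbitrary: g)
  case 0
  then show ?case using assms(5) by (auto intro: continuous_on_compose2)
next
  case (Suc k)
  have fk: "Ck_on k S f" using Suc.prems(1) Ck_on_SucD by blast
  have df: "f differentiable (at x)" if "x \<in> S" for x using that Suc.prems by auto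
  have dg: "g differentiable (at (f x))" if "x \<in> S" for x using that Suc.prems assms(5) by auto
  show ?case unfolding Ck_on.simps
  proof (intro conjI allI ballI)
    show "(\<lambda>x. g (f x)) differentiable (at x)" if "x \<in> S" for x
      using differentiable_chain_at[OF df[OF that] dg[OF that]] by (simp add: o_def)
    show "Ck_on k S (\<lambda>x. frechet_derivative (\<lambda>x. g (f x)) (at x) h)" for h
    proof (rule Ck_on_cong_imp[OF assms(1)])
      have "Ck_on k S (\<lambda>x. (frechet_derivative f (at x) h \<bullet> b) *\<^sub>R frechet_derivative g (at (f x)) b)" for b
        using Suc.prems
        by (intro Ck_on_bilinear[OF bounded_bilinear_scaleR assms(1)]
            Ck_on_bounded_linear[OF bounded_linear_inner_left assms(1)] Suc.IH fk) auto
      then show "Ck_on k S (\<lambda>x. \<Sum>b\<in>Basis. (frechet_derivative f (at x) h \<bullet> b) *\<^sub>R frechet_derivative g (at (f x)) b)"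
        by (intro Ck_on_sum assms(1))
      show "(\<Sum>b\<in>Basis. (frechet_derivative f (at x) h \<bullet> b) *\<^sub>R frechet_derivative g (at (f x)) b)
        = frechet_derivative (\<lambda>x. g (f x)) (at x) h" if "x \<in> S" for x
        unfolding frechet_derivative_chain[OF df[OF that] dg[OF that]]
        using frechet_derivative_basis[OF dg[OF that]] by metis
    qed
  qed
qed

lemma smooth_on_cong:
  "open S \<Longrightarrow> smooth_on S f \<Longrightarrow> (\<And>x. x \<in> S \<Longrightarrow> f x = g x) \<Longrightarrow> smooth_on S g"
  unfolding smooth_on_def using Ck_on_cong_imp[of S _ f g] by simp

lemma smooth_on_subset: "smooth_on S f \<Longrightarrow> T \<subseteq> S \<Longrightarrow> smooth_on T f"
  unfolding smooth_on_def using Ck_on_subset[of _ S f T] by simp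

lemma smooth_on_local:
  assumes "\<And>x. x \<in> S \<Longrightarrow> \<exists>T. open T \<and> x \<in> T \<and> smooth_on T f"
  shows "smooth_on S f"
  unfolding smooth_on_def
proof (intro allI Ck_on_local)
  fix k x assume "x \<in> S"
  then obtain T where "open T" "x \<in> T" "smooth_on T f" using assms by blast
  then show "\<exists>T. open T \<and> x \<in> T \<and> Ck_on k T f" unfolding smooth_on_def by blast
qed

lemma smooth_on_const [simp, intro]: "smooth_on S (\<lambda>x. c)"
  unfolding smooth_on_def by (simp add: Ck_on_const)

lemma smooth_on_add:
  "open S \<Longrightarrow> smooth_on S f \<Longrightarrow> smooth_on S g \<Longrightarrow> smooth_on S (\<lambda>x. f x + g x)"
  unfolding smooth_on_def by (simp add: Ck_on_add)

lemma smooth_on_bounded_linear: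
  "bounded_linear L \<Longrightarrow> open S \<Longrightarrow> smooth_on S f \<Longrightarrow> smooth_on S (\<lambda>x. L (f x))"
  unfolding smooth_on_def by (simp add: Ck_on_bounded_linear)

lemma smooth_on_bilinear:
  "bounded_bilinear b \<Longrightarrow> open S \<Longrightarrow> smooth_on S f \<Longrightarrow> smooth_on S g
   \<Longrightarrow> smooth_on S (\<lambda>x. b (f x) (g x))"
  unfolding smooth_on_def by (simp add: Ck_on_bilinear)

lemma smooth_on_sum:
  "open S \<Longrightarrow> (\<And>i. i \<in> I \<Longrightarrow> smooth_on S (f i)) \<Longrightarrow> smooth_on S (\<lambda>x. \<Sum>i\<in>I. f i x)"
  unfolding smooth_on_def by (simp add: Ck_on_sum)

lemma smooth_on_compose:
  fixes f :: "'a::real_normed_vector \<Rightarrow> 'b::euclidean_space"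
  shows "open S \<Longrightarrow> open T \<Longrightarrow> smooth_on S f \<Longrightarrow> smooth_on T g \<Longrightarrow> f ` S \<subseteq> T
    \<Longrightarrow> smooth_on S (\<lambda>x. g (f x))"
  unfolding smooth_on_def by (rule allI, rule Ck_on_compose[of S T]) auto

lemma smooth_on_minus: "open S \<Longrightarrow> smooth_on S f \<Longrightarrow> smooth_on S (\<lambda>x. - f x)"
  using smooth_on_bounded_linear[OF bounded_linear_minus[OF bounded_linear_ident]] .

lemma smooth_on_diff:
  "open S \<Longrightarrow> smooth_on S f \<Longrightarrow> smooth_on S g \<Longrightarrow> smooth_on S (\<lambda>x. f x - g x)"
  using smooth_on_add[of S f "\<lambda>x. - g x"] smooth_on_minus[of S g] by simp

lemma smooth_on_mult:
  fixes f :: "'a::real_normed_vector \<Rightarrow> 'b::real_normed_algebra"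
  shows "open S \<Longrightarrow> smooth_on S f \<Longrightarrow> smooth_on S g \<Longrightarrow> smooth_on S (\<lambda>x. f x * g x)"
  using smooth_on_bilinear[OF bounded_bilinear_mult] .

lemma smooth_on_scaleR:
  "open S \<Longrightarrow> smooth_on S f \<Longrightarrow> smooth_on S g \<Longrightarrow> smooth_on S (\<lambda>x. f x *\<^sub>R g x)"
  using smooth_on_bilinear[OF bounded_bilinear_scaleR] .

lemma smooth_on_inner:
  "open S \<Longrightarrow> smooth_on S f \<Longrightarrow> smooth_on S g \<Longrightarrow> smooth_on S (\<lambda>x. f x \<bullet> g x)"
  using smooth_on_bilinear[OF bounded_bilinear_inner] .

lemma smooth_on_cnj: "open S \<Longrightarrow> smooth_on S f \<Longrightarrow> smooth_on S (\<lambda>x. cnj (f x))"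
  using smooth_on_bounded_linear[OF bounded_linear_cnj] .

lemma smooth_on_Re: "open S \<Longrightarrow> smooth_on S f \<Longrightarrow> smooth_on S (\<lambda>x. Re (f x))"
  using smooth_on_bounded_linear[OF bounded_linear_Re] .

lemma smooth_on_Im: "open S \<Longrightarrow> smooth_on S f \<Longrightarrow> smooth_on S (\<lambda>x. Im (f x))"
  using smooth_on_bounded_linear[OF bounded_linear_Im] .

lemma smooth_on_of_real:
  "open S \<Longrightarrow> smooth_on S f \<Longrightarrow> smooth_on S (\<lambda>x. complex_of_real (f x))"
  using smooth_on_bounded_linear[OF bounded_linear_of_real] .

lemma smooth_on_vec_nth:
  fixes f :: "'a::real_normed_vector \<Rightarrow> ('b::real_normed_vector)^'n"
  shows "open S \<Longrightarrow> smooth_on S f \<Longrightarrow> smooth_on S (\<lambda>x. f x $ i)"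
  using smooth_on_bounded_linear[OF bounded_linear_vec_nth] .

lemma smooth_on_fst: "open S \<Longrightarrow> smooth_on S f \<Longrightarrow> smooth_on S (\<lambda>x. fst (f x))"
  using smooth_on_bounded_linear[OF bounded_linear_fst] .

lemma smooth_on_snd: "open S \<Longrightarrow> smooth_on S f \<Longrightarrow> smooth_on S (\<lambda>x. snd (f x))"
  using smooth_on_bounded_linear[OF bounded_linear_snd] .

lemma smooth_on_id [simp, intro]: "smooth_on S (\<lambda>x. x)"
proof -
  have "Ck_on k S (\<lambda>x. x)" for k by (cases k) (auto intro: Ck_on_const)
  then show ?thesis unfolding smooth_on_def by blast
qed

lemma smooth_on_euclidean_components:
  fixes f :: "'a::real_normed_vector \<Rightarrow> 'b::euclidean_space"
  assumes "open S" "\<And>b. b \<in> Basis \<Longrightarrow> smooth_on S (\<lambda>x. f x \<bullet> b)"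
  shows "smooth_on S f"
proof (rule smooth_on_cong[OF assms(1)])
  show "smooth_on S (\<lambda>x. \<Sum>b\<in>Basis. (f x \<bullet> b) *\<^sub>R b)"
    by (intro smooth_on_sum smooth_on_scaleR assms smooth_on_const)
qed (simp add: euclidean_representation)

text \<open>Smooth dependence of the family is only known for fixed arguments; the basis expansion
  extends it to arguments that vary smoothly.\<close>

lemma smooth_on_linear_family:
  fixes K :: "'a::real_normed_vector \<Rightarrow> 'e::euclidean_space \<Rightarrow> 'b::real_normed_vector"
  assumes "open W" "\<And>h. smooth_on W (\<lambda>y. K y h)" "\<And>y. y \<in> W \<Longrightarrow> linear (K y)" "smooth_on W v"
  shows "smooth_on W (\<lambda>y. K y (v y))"
proof (rule smooth_on_cong[OF assms(1)])
  show "smooth_on W (\<lambda>y. \<Sum>b\<in>Basis. (v y \<bullet> b) *\<^sub>R K y b)"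
    by (intro smooth_on_sum smooth_on_scaleR smooth_on_inner assms smooth_on_const)
  show "(\<Sum>b\<in>Basis. (v y \<bullet> b) *\<^sub>R K y b) = K y (v y)" if "y \<in> W" for y
    by (rule linear_basis_sum[OF assms(3)[OF that], symmetric])
qed

lemma smooth_on_bilinear_family:
  fixes H :: "'a::real_normed_vector \<Rightarrow> 'e::euclidean_space \<Rightarrow> 'e \<Rightarrow> 'b::real_normed_vector"
  assumes "open W" "\<And>h h'. smooth_on W (\<lambda>y. H y h h')" "\<And>y. y \<in> W \<Longrightarrow> bilinear (H y)"
    "smooth_on W v" "smooth_on W w"
  shows "smooth_on W (\<lambda>y. H y (v y) (w y))"
proof (rule smooth_on_cong[OF assms(1)])
  show "smooth_on W (\<lambda>y. \<Sum>b\<in>Basis. (v y \<bullet> b) *\<^sub>R (\<Sum>c\<in>Basis. (w y \<bullet> c) *\<^sub>R H y b c))"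
    by (intro smooth_on_sum smooth_on_scaleR smooth_on_inner assms smooth_on_const)
  fix y assume y: "y \<in> W"
  have 1: "linear (\<lambda>v. H y v (w y))" and 2: "\<And>b. linear (H y b)"
    using assms(3)[OF y] unfolding bilinear_def by auto
  show "(\<Sum>b\<in>Basis. (v y \<bullet> b) *\<^sub>R (\<Sum>c\<in>Basis. (w y \<bullet> c) *\<^sub>R H y b c)) = H y (v y) (w y)"
    unfolding linear_basis_sum[OF 2, symmetric] by (rule linear_basis_sum[OF 1, symmetric])
qed

lemma smooth_on_vec:
  fixes f :: "'a::real_normed_vector \<Rightarrow> ('b::euclidean_space)^'n"
  assumes "open S" "\<And>i. smooth_on S (\<lambda>x. f x $ i)"
  shows "smooth_on S f"
proof (rule smooth_on_euclidean_components[OF assms(1)])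
  fix b :: "'b^'n" assume "b \<in> Basis"
  then obtain i u where "b = axis i u" by (auto simp: Basis_vec_def)
  then have "(\<lambda>x. f x \<bullet> b) = (\<lambda>x. f x $ i \<bullet> u)" by (simp add: inner_axis)
  then show "smooth_on S (\<lambda>x. f x \<bullet> b)"
    using assms by (auto intro: smooth_on_inner)
qed

lemma smooth_on_Pair:
  fixes f :: "'a::real_normed_vector \<Rightarrow> 'b::euclidean_space" and g :: "'a \<Rightarrow> 'c::euclidean_space"
  assumes "open S" "smooth_on S f" "smooth_on S g"
  shows "smooth_on S (\<lambda>x. (f x, g x))"
proof -
  have l: "bounded_linear (\<lambda>x::'b. (x, 0::'c))" "bounded_linear (\<lambda>x::'c. (0::'b, x))"
    by (auto intro!: bounded_linear_Pair bounded_linear_ident bounded_linear_zero)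
  have "smooth_on S (\<lambda>x. (f x, 0::'c) + (0::'b, g x))"
    using smooth_on_bounded_linear[OF l(1) assms(1,2)] smooth_on_bounded_linear[OF l(2) assms(1,3)]
    by (intro smooth_on_add assms(1))
  then show ?thesis by simp
qed

lemma smooth_on_differentiable: "smooth_on S f \<Longrightarrow> x \<in> S \<Longrightarrow> f differentiable (at x)"
  unfolding smooth_on_def by (metis Ck_on.simps(2))

lemma smooth_on_frechet:
  "smooth_on S f \<Longrightarrow> smooth_on S (\<lambda>x. frechet_derivative f (at x) h)"
  unfolding smooth_on_def by (metis Ck_on.simps(2))

lemma smooth_on_continuous: "smooth_on S f \<Longrightarrow> continuous_on S f"
  unfolding smooth_on_def by (metis Ck_on.simps(1))

lemma smooth_on_powr: "smooth_on {0<..} (\<lambda>x::real. x powr a)"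
proof -
  \<comment> \<open>With factor and exponent both arbitrary, the family is closed under
    differentiation, as the induction requires.\<close>
  have "Ck_on k {0<..} (\<lambda>x::real. c * x powr a)" for k c
  proof (induction k arbitrary: c a)
    case 0
    then show ?case by (auto intro!: continuous_intros)
  next
    case (Suc k)
    have d: "((\<lambda>x. c * x powr a) has_derivative (*) (c * (a * x powr (a - 1)))) (at x)"
      if "x > 0" for x :: real
      by (rule has_field_derivative_imp_has_derivative)
         (rule DERIV_cmult[OF has_real_derivative_powr[OF that]])
    show ?case unfolding Ck_on.simps
    proof (intro conjI allI ballI)
      show "(\<lambda>x. c * x powr a) differentiable (at x)" if "x \<in> {0<..}" for x :: real
        using that by (intro differentiableI[OF d]) simp
      fix h :: real
      have "(h * c * a) * x powr (a - 1) = frechet_derivative (\<lambda>x. c * x powr a) (at x) h"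
        if "x \<in> {0<..}" for x :: real
      proof -
        have "x > 0" using that by simp
        show ?thesis unfolding frechet_derivative_at[OF d[OF \<open>x > 0\<close>], symmetric] by simp
      qed
      then show "Ck_on k {0<..} (\<lambda>x. frechet_derivative (\<lambda>x. c * x powr a) (at x) h)"
        by (rule Ck_on_cong_imp[OF open_greaterThan Suc.IH])
    qed
  qed
  from this[of _ 1] show ?thesis unfolding smooth_on_def by simp
qed

lemma smooth_on_exp: "smooth_on UNIV (exp :: real \<Rightarrow> real)"
proof -
  have "Ck_on k UNIV (\<lambda>x::real. c * exp x)" for k c
  proof (induction k arbitrary: c)
    case 0
    then show ?case by (auto intro!: continuous_intros)
  next
    case (Suc k)
    have d: "((\<lambda>x. c * exp x) has_derivative (*) (c * exp x)) (at x)" for x :: real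
      by (rule has_field_derivative_imp_has_derivative) (rule DERIV_cmult[OF DERIV_exp])
    have fd: "frechet_derivative (\<lambda>x. c * exp x) (at x) h = (h * c) * exp x" for x h :: real
      unfolding frechet_derivative_at[OF d, symmetric] by simp
    show ?case unfolding Ck_on.simps fd using Suc.IH differentiableI[OF d] by blast
  qed
  from this[of _ 1] show ?thesis unfolding smooth_on_def by simp
qed

section \<open>Complex partial derivatives and coefficient forms\<close>

lemma line_derivative:
  fixes f :: "'a::real_normed_vector \<Rightarrow> real"
  assumes "f differentiable (at (y + u *\<^sub>R h))"
  shows "((\<lambda>t. f (y + t *\<^sub>R h)) has_real_derivative frechet_derivative f (at (y + u *\<^sub>R h)) h) (at u)"
proof -
  let ?D = "frechet_derivative f (at (y + u *\<^sub>R h))"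
  have "((\<lambda>t. y + t *\<^sub>R h) has_derivative (\<lambda>t. 0 + t *\<^sub>R h)) (at u)"
    by (intro has_derivative_add has_derivative_const has_derivative_scaleR_left has_derivative_ident)
  from diff_chain_at[OF this frechet_derivative_works[THEN iffD1, OF assms]]
  have "((\<lambda>t. f (y + t *\<^sub>R h)) has_derivative (\<lambda>t. ?D (t *\<^sub>R h))) (at u)"
    by (simp add: o_def)
  moreover have "(\<lambda>t. ?D (t *\<^sub>R h)) = (*) (?D h)"
    using linear_cmul[OF linear_frechet_derivative[OF assms]] by (simp add: fun_eq_iff)
  ultimately show ?thesis unfolding has_field_derivative_def by simp
qed

lemma add_right_swap: "(x::'a::ab_group_add) + a + b = x + b + a"
  by simp

text \<open>The mean value theorem, applied once in each direction, expresses the second difference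
  over a parallelogram by a mixed derivative at one of its points. The difference itself does not
  change when \<open>h\<close> and \<open>k\<close> are exchanged.\<close>

lemma second_difference:
  fixes f :: "'a::euclidean_space \<Rightarrow> real"
  assumes f: "smooth_on S f" and s: "s > 0"
    and inS: "\<And>u v. 0 \<le> u \<Longrightarrow> u \<le> s \<Longrightarrow> 0 \<le> v \<Longrightarrow> v \<le> s \<Longrightarrow> x + u *\<^sub>R h + v *\<^sub>R k \<in> S"
  shows "\<exists>u v. 0 < u \<and> u < s \<and> 0 < v \<and> v < s \<and>
    f (x + s *\<^sub>R h + s *\<^sub>R k) - f (x + s *\<^sub>R h) - f (x + s *\<^sub>R k) + f x
      = s\<^sup>2 * frechet_derivative (\<lambda>y. frechet_derivative f (at y) h) (at (x + u *\<^sub>R h + v *\<^sub>R k)) k"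
proof -
  let ?g = "\<lambda>y. frechet_derivative f (at y) h"
  note dif = smooth_on_differentiable[OF f]
  have "\<exists>z>0. z < s \<and> (f ((x + s *\<^sub>R k) + s *\<^sub>R h) - f (x + s *\<^sub>R h)) - (f ((x + s *\<^sub>R k) + 0 *\<^sub>R h) - f (x + 0 *\<^sub>R h))
      = (s - 0) * (?g ((x + s *\<^sub>R k) + z *\<^sub>R h) - ?g (x + z *\<^sub>R h))"
  proof (rule MVT2[OF s])
    fix u assume u: "0 \<le> u" "u \<le> s"
    have "x + s *\<^sub>R k + u *\<^sub>R h \<in> S" using inS[OF u, of s] s by (simp add: ac_simps)
    moreover have "x + u *\<^sub>R h \<in> S" using inS[OF u, of 0] s by simp
    ultimately show "((\<lambda>u. f ((x + s *\<^sub>R k) + u *\<^sub>R h) - f (x + u *\<^sub>R h)) has_real_derivative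
        ?g ((x + s *\<^sub>R k) + u *\<^sub>R h) - ?g (x + u *\<^sub>R h)) (at u)"
      by (intro DERIV_diff line_derivative dif)
  qed
  then obtain u where u: "0 < u" "u < s"
    and e1: "(f ((x + s *\<^sub>R k) + s *\<^sub>R h) - f (x + s *\<^sub>R h)) - (f (x + s *\<^sub>R k) - f x)
      = s * (?g ((x + s *\<^sub>R k) + u *\<^sub>R h) - ?g (x + u *\<^sub>R h))" by auto
  have "\<exists>z>0. z < s \<and> ?g ((x + u *\<^sub>R h) + s *\<^sub>R k) - ?g ((x + u *\<^sub>R h) + 0 *\<^sub>R k)
      = (s - 0) * frechet_derivative ?g (at ((x + u *\<^sub>R h) + z *\<^sub>R k)) k"
  proof (rule MVT2[OF s])
    fix v assume v: "0 \<le> v" "v \<le> s"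
    have "x + u *\<^sub>R h + v *\<^sub>R k \<in> S" using inS[OF _ _ v, of u] u by simp
    then show "((\<lambda>v. ?g ((x + u *\<^sub>R h) + v *\<^sub>R k)) has_real_derivative
        frechet_derivative ?g (at ((x + u *\<^sub>R h) + v *\<^sub>R k)) k) (at v)"
      by (intro line_derivative smooth_on_differentiable[OF smooth_on_frechet[OF f]])
  qed
  then obtain v where v: "0 < v" "v < s"
    and e2: "?g ((x + u *\<^sub>R h) + s *\<^sub>R k) - ?g (x + u *\<^sub>R h)
      = s * frechet_derivative ?g (at (x + u *\<^sub>R h + v *\<^sub>R k)) k" by auto
  have "f (x + s *\<^sub>R h + s *\<^sub>R k) - f (x + s *\<^sub>R h) - f (x + s *\<^sub>R k) + f x
      = s * (?g ((x + u *\<^sub>R h) + s *\<^sub>R k) - ?g (x + u *\<^sub>R h))"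
    using e1 by (simp add: ac_simps)
  also have "\<dots> = s\<^sup>2 * frechet_derivative ?g (at (x + u *\<^sub>R h + v *\<^sub>R k)) k"
    unfolding e2 by (simp add: power2_eq_square)
  finally show ?thesis using u v by blast
qed

text \<open>Both orders of differentiation arise from the same second difference over a small
  parallelogram, so a value of one near \<open>x\<close> equals a value of the other near
  \<open>x\<close>. Continuity then excludes distinct values at \<open>x\<close>.\<close>

lemma frechet_derivative_symmetric_real:
  fixes f :: "'a::euclidean_space \<Rightarrow> real"
  assumes "open S" and f: "smooth_on S f" and x: "x \<in> S"
  shows "frechet_derivative (\<lambda>y. frechet_derivative f (at y) h) (at x) k
    = frechet_derivative (\<lambda>y. frechet_derivative f (at y) k) (at x) h"
proof (rule ccontr)
  define P where "P = (\<lambda>y. frechet_derivative (\<lambda>y. frechet_derivative f (at y) h) (at y) k)"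
  define Q where "Q = (\<lambda>y. frechet_derivative (\<lambda>y. frechet_derivative f (at y) k) (at y) h)"
  assume "\<not> ?thesis"
  then have "P x \<noteq> Q x" by (simp add: P_def Q_def)
  then have e: "\<bar>P x - Q x\<bar> / 2 > 0" by simp
  have cP: "isCont P x" and cQ: "isCont Q x"
    using smooth_on_continuous[OF smooth_on_frechet[OF smooth_on_frechet[OF f]]]
      continuous_on_eq_continuous_at[OF assms(1)] x unfolding P_def Q_def by blast+
  obtain d1 where d1: "d1 > 0" "\<And>y. dist y x < d1 \<Longrightarrow> dist (P y) (P x) < \<bar>P x - Q x\<bar> / 2"
    using cP e unfolding continuous_at_eps_delta by blast
  obtain d2 where d2: "d2 > 0" "\<And>y. dist y x < d2 \<Longrightarrow> dist (Q y) (Q x) < \<bar>P x - Q x\<bar> / 2"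
    using cQ e unfolding continuous_at_eps_delta by blast
  obtain d3 where d3: "d3 > 0" "ball x d3 \<subseteq> S" using assms(1) x openE by blast
  define d where "d = min d1 (min d2 d3)"
  have d: "d > 0" using d1 d2 d3 by (simp add: d_def)
  \<comment> \<open>The summand 1 keeps \<open>c\<close> positive even if both directions are zero.
    With step \<open>s\<close>, the parallelogram stays within distance \<open>d / 2\<close> of
    \<open>x\<close>.\<close>
  define c where "c = norm h + norm k + 1"
  define s where "s = d / (2 * c)"
  have nn: "c > 0" using norm_ge_zero[of h] norm_ge_zero[of k] unfolding c_def by linarith
  have s: "s > 0" using d nn by (simp add: s_def)
  have near: "dist (x + u *\<^sub>R h + v *\<^sub>R k) x < d" if "0 \<le> u" "u \<le> s" "0 \<le> v" "v \<le> s" for u v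
  proof -
    have "norm (u *\<^sub>R h + v *\<^sub>R k) \<le> u * norm h + v * norm k"
      using norm_triangle_ineq[of "u *\<^sub>R h" "v *\<^sub>R k"] that by simp
    also have "\<dots> \<le> s * norm h + s * norm k" using that by (intro add_mono mult_right_mono) auto
    also have "\<dots> \<le> s * c" using s by (simp add: c_def algebra_simps)
    also have "\<dots> = d / 2" using nn by (simp add: s_def)
    finally show ?thesis using d by (simp add: dist_norm add.assoc)
  qed
  have inS: "x + u *\<^sub>R h + v *\<^sub>R k \<in> S" if "0 \<le> u" "u \<le> s" "0 \<le> v" "v \<le> s" for u v
    using near[OF that] d3 by (auto simp: d_def dist_commute subset_iff)
  obtain u v where uv: "0 < u" "u < s" "0 < v" "v < s"
    and e1: "f (x + s *\<^sub>R h + s *\<^sub>R k) - f (x + s *\<^sub>R h) - f (x + s *\<^sub>R k) + f x = s\<^sup>2 * P (x + u *\<^sub>R h + v *\<^sub>R k)"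
    using second_difference[OF f s inS] unfolding P_def by blast
  have inS': "x + v *\<^sub>R k + u *\<^sub>R h \<in> S" if "0 \<le> v" "v \<le> s" "0 \<le> u" "u \<le> s" for u v
    using inS[of u v] that by (simp add: ac_simps)
  obtain v' u' where uv': "0 < u'" "u' < s" "0 < v'" "v' < s"
    and e2: "f (x + s *\<^sub>R k + s *\<^sub>R h) - f (x + s *\<^sub>R k) - f (x + s *\<^sub>R h) + f x = s\<^sup>2 * Q (x + v' *\<^sub>R k + u' *\<^sub>R h)"
    using second_difference[OF f s inS'] unfolding Q_def by blast
  have "s\<^sup>2 * P (x + u *\<^sub>R h + v *\<^sub>R k) = s\<^sup>2 * Q (x + u' *\<^sub>R h + v' *\<^sub>R k)"
    using e1 e2 unfolding add_right_swap[of x "s *\<^sub>R k"] add_right_swap[of x "v' *\<^sub>R k"] by linarith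
  then have "P (x + u *\<^sub>R h + v *\<^sub>R k) = Q (x + u' *\<^sub>R h + v' *\<^sub>R k)" using s by simp
  moreover have "dist (P (x + u *\<^sub>R h + v *\<^sub>R k)) (P x) < \<bar>P x - Q x\<bar> / 2"
    using near[of u v] uv by (intro d1) (auto simp: d_def)
  moreover have "dist (Q (x + u' *\<^sub>R h + v' *\<^sub>R k)) (Q x) < \<bar>P x - Q x\<bar> / 2"
    using near[of u' v'] uv' by (intro d2) (auto simp: d_def)
  ultimately show False by (auto simp: dist_real_def abs_if split: if_splits)
qed

lemma frechet_derivative_bounded_linear:
  assumes "bounded_linear L" "f differentiable (at x)"
  shows "frechet_derivative (\<lambda>x. L (f x)) (at x) h = L (frechet_derivative f (at x) h)"
  using frechet_derivative_at[OF bounded_linear.has_derivative[OF assms(1)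
        frechet_derivative_works[THEN iffD1, OF assms(2)]]] by metis

lemma frechet_derivative_symmetric:
  fixes f :: "'a::euclidean_space \<Rightarrow> 'b::euclidean_space"
  assumes S: "open S" and f: "smooth_on S f" and x: "x \<in> S"
  shows "frechet_derivative (\<lambda>y. frechet_derivative f (at y) h) (at x) k
    = frechet_derivative (\<lambda>y. frechet_derivative f (at y) k) (at x) h"
proof (rule euclidean_eqI)
  fix b :: 'b assume "b \<in> Basis"
  have l: "bounded_linear (\<lambda>z::'b. z \<bullet> b)" by (rule bounded_linear_inner_left)
  have 1: "frechet_derivative (\<lambda>y. f y \<bullet> b) (at y) h = frechet_derivative f (at y) h \<bullet> b" if "y \<in> S" for y h
    by (rule frechet_derivative_bounded_linear[OF l smooth_on_differentiable[OF f that]])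
  have 2: "frechet_derivative (\<lambda>y. frechet_derivative f (at y) h) (at x) k \<bullet> b
    = frechet_derivative (\<lambda>y. frechet_derivative (\<lambda>y. f y \<bullet> b) (at y) h) (at x) k" for h k
  proof -
    have d: "(\<lambda>y. frechet_derivative f (at y) h) differentiable (at x)"
      by (rule smooth_on_differentiable[OF smooth_on_frechet[OF f] x])
    have d': "(\<lambda>y. frechet_derivative f (at y) h \<bullet> b) differentiable (at x)"
      by (rule smooth_on_differentiable[OF smooth_on_bounded_linear[OF l S smooth_on_frechet[OF f]] x])
    show ?thesis
      unfolding frechet_derivative_bounded_linear[OF l d, symmetric]
      by (subst frechet_derivative_transform_within_open[OF d' S x]) (auto simp: 1)
  qed
  show "frechet_derivative (\<lambda>y. frechet_derivative f (at y) h) (at x) k \<bullet> b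
    = frechet_derivative (\<lambda>y. frechet_derivative f (at y) k) (at x) h \<bullet> b"
    unfolding 2 by (rule frechet_derivative_symmetric_real[OF S smooth_on_bounded_linear[OF l S f] x])
qed

lemma frechet_derivative_bilinear:
  assumes "bounded_bilinear b" "f differentiable (at x)" "g differentiable (at x)"
  shows "frechet_derivative (\<lambda>x. b (f x) (g x)) (at x) h
    = b (f x) (frechet_derivative g (at x) h) + b (frechet_derivative f (at x) h) (g x)"
  using frechet_derivative_at[OF bounded_bilinear.FDERIV[OF assms(1)
        frechet_derivative_works[THEN iffD1, OF assms(2)] frechet_derivative_works[THEN iffD1, OF assms(3)]]]
  by metis

lemma frechet_derivative_add:
  assumes "f differentiable (at x)" "g differentiable (at x)"
  shows "frechet_derivative (\<lambda>x. f x + g x) (at x) h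
    = frechet_derivative f (at x) h + frechet_derivative g (at x) h"
  using frechet_derivative_at[OF has_derivative_add[OF
        frechet_derivative_works[THEN iffD1, OF assms(1)] frechet_derivative_works[THEN iffD1, OF assms(2)]]]
  by metis

section \<open>Complexified derivatives and 1-forms given by coefficients\<close>

definition pd :: "6 \<Rightarrow> (real^6 \<Rightarrow> complex) \<Rightarrow> real^6 \<Rightarrow> complex" where
  "pd j f y = frechet_derivative f (at y) (axis j 1)"

text \<open>Directions are complexified tangent vectors with constant coordinates. This admits
  (1,0)- and (0,1)-directions, and since constant fields commute, no Lie brackets appear in the
  exterior derivative \<open>dform\<close>.\<close>

definition dd :: "complex^6 \<Rightarrow> (real^6 \<Rightarrow> complex) \<Rightarrow> real^6 \<Rightarrow> complex" where
  "dd z f y = (\<Sum>j\<in>UNIV. z $ j * pd j f y)"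

definition cnjv :: "complex^6 \<Rightarrow> complex^6" where
  "cnjv z = (\<chi> j. cnj (z $ j))"

type_synonym coeff_form = "6 \<Rightarrow> real^6 \<Rightarrow> complex"

definition ev :: "coeff_form \<Rightarrow> complex^6 \<Rightarrow> real^6 \<Rightarrow> complex" where
  "ev \<omega> z y = (\<Sum>j\<in>UNIV. z $ j * \<omega> j y)"

definition dform :: "coeff_form \<Rightarrow> complex^6 \<Rightarrow> complex^6 \<Rightarrow> real^6 \<Rightarrow> complex" where
  "dform \<omega> z w y = dd z (ev \<omega> w) y - dd w (ev \<omega> z) y"

lemma cnjv_nth [simp]: "cnjv z $ j = cnj (z $ j)"
  by (simp add: cnjv_def)

lemma cnjv_cnjv [simp]: "cnjv (cnjv z) = z"
  by (simp add: vec_eq_iff)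

lemma smooth_on_pd: "smooth_on V f \<Longrightarrow> smooth_on V (pd j f)"
  unfolding pd_def[abs_def] by (rule smooth_on_frechet)

lemma pd_cong:
  assumes "open V" "smooth_on V f" "y \<in> V" "\<And>x. x \<in> V \<Longrightarrow> f x = g x"
  shows "pd j f y = pd j g y"
  unfolding pd_def
  using frechet_derivative_transform_within_open[OF smooth_on_differentiable[OF assms(2,3)] assms(1,3,4)]
  by simp

lemma pd_const [simp]: "pd j (\<lambda>y. c) y = 0"
  by (simp add: pd_def)

lemma pd_add:
  assumes "smooth_on V f" "smooth_on V g" "y \<in> V"
  shows "pd j (\<lambda>x. f x + g x) y = pd j f y + pd j g y"
  unfolding pd_def using assms by (intro frechet_derivative_add smooth_on_differentiable)

lemma pd_mult:
  assumes "smooth_on V f" "smooth_on V g" "y \<in> V"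
  shows "pd j (\<lambda>x. f x * g x) y = f y * pd j g y + pd j f y * g y"
  unfolding pd_def using assms
  by (intro frechet_derivative_bilinear[OF bounded_bilinear_mult] smooth_on_differentiable)

lemma pd_cnj:
  assumes "smooth_on V f" "y \<in> V"
  shows "pd j (\<lambda>x. cnj (f x)) y = cnj (pd j f y)"
  unfolding pd_def using assms
  by (intro frechet_derivative_bounded_linear[OF bounded_linear_cnj] smooth_on_differentiable)

lemma pd_pd_commute:
  assumes "open V" "smooth_on V f" "y \<in> V"
  shows "pd j (pd k f) y = pd k (pd j f) y"
  unfolding pd_def[abs_def] by (rule frechet_derivative_symmetric[OF assms])

lemma smooth_on_dd:
  assumes "open V" "smooth_on V f" "\<And>j. smooth_on V (\<lambda>y. z y $ j)"
  shows "smooth_on V (\<lambda>y. dd (z y) f y)"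
  unfolding dd_def using assms by (intro smooth_on_sum smooth_on_mult smooth_on_pd)

lemma smooth_on_dd_const: "open V \<Longrightarrow> smooth_on V f \<Longrightarrow> smooth_on V (dd z f)"
  using smooth_on_dd[of V f "\<lambda>_. z"] by simp

lemma smooth_on_ev:
  assumes "open V" "\<And>j. smooth_on V (\<omega> j)" "\<And>j. smooth_on V (\<lambda>y. z y $ j)"
  shows "smooth_on V (\<lambda>y. ev \<omega> (z y) y)"
  unfolding ev_def using assms by (intro smooth_on_sum smooth_on_mult)

lemma smooth_on_ev_const:
  "open V \<Longrightarrow> (\<And>j. smooth_on V (\<omega> j)) \<Longrightarrow> smooth_on V (ev \<omega> z)"
  using smooth_on_ev[of V \<omega> "\<lambda>_. z"] by simp

lemma dd_cong:
  assumes "open V" "smooth_on V f" "y \<in> V" "\<And>x. x \<in> V \<Longrightarrow> f x = g x"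
  shows "dd z f y = dd z g y"
  unfolding dd_def using pd_cong[OF assms] by simp

lemma dd_const [simp]: "dd z (\<lambda>y. c) y = 0"
  by (simp add: dd_def)

lemma dd_add:
  assumes "smooth_on V f" "smooth_on V g" "y \<in> V"
  shows "dd z (\<lambda>x. f x + g x) y = dd z f y + dd z g y"
  by (simp add: dd_def pd_add[OF assms] distrib_left sum.distrib)

lemma dd_mult:
  assumes "smooth_on V f" "smooth_on V g" "y \<in> V"
  shows "dd z (\<lambda>x. f x * g x) y = f y * dd z g y + dd z f y * g y"
  by (simp add: dd_def pd_mult[OF assms] distrib_left sum.distrib sum_distrib_left
      sum_distrib_right ac_simps)

lemma dd_cmult:
  assumes "smooth_on V f" "y \<in> V"
  shows "dd z (\<lambda>x. c * f x) y = c * dd z f y"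
  using dd_mult[OF _ assms, of "\<lambda>_. c" z] by simp

lemma dd_minus:
  assumes "smooth_on V f" "y \<in> V"
  shows "dd z (\<lambda>x. - f x) y = - dd z f y"
  using dd_cmult[OF assms, of z "-1"] by simp

lemma dd_diff:
  assumes "open V" "smooth_on V f" "smooth_on V g" "y \<in> V"
  shows "dd z (\<lambda>x. f x - g x) y = dd z f y - dd z g y"
  using dd_add[OF assms(2) smooth_on_minus[OF assms(1,3)] assms(4), of z] dd_minus[OF assms(3,4), of z]
  by simp

lemma dd_sum:
  assumes "open V" "\<And>i. i \<in> I \<Longrightarrow> smooth_on V (f i)" "y \<in> V"
  shows "dd z (\<lambda>x. \<Sum>i\<in>I. f i x) y = (\<Sum>i\<in>I. dd z (f i) y)"
  using assms(2)
proof (induction I rule: infinite_finite_induct)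
  case (insert a I)
  have "dd z (\<lambda>x. f a x + (\<Sum>i\<in>I. f i x)) y = dd z (f a) y + dd z (\<lambda>x. \<Sum>i\<in>I. f i x) y"
    using insert.prems by (intro dd_add[OF _ _ assms(3)] smooth_on_sum assms(1)) auto
  then show ?case using insert by simp
qed auto

lemma dd_cnj:
  assumes "smooth_on V f" "y \<in> V"
  shows "dd z (\<lambda>x. cnj (f x)) y = cnj (dd (cnjv z) f y)"
  by (simp add: dd_def pd_cnj[OF assms])

lemma dd_commute:
  assumes "open V" "smooth_on V f" "y \<in> V"
  shows "dd z (dd w f) y = dd w (dd z f) y"
proof -
  have 1: "dd z (dd w f) y = (\<Sum>k\<in>UNIV. \<Sum>j\<in>UNIV. z $ k * (w $ j * pd k (pd j f) y))" for z w
  proof -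
    have "dd z (dd w f) y = (\<Sum>j\<in>UNIV. w $ j * dd z (pd j f) y)"
      unfolding dd_def[of w] using assms
      by (simp add: dd_sum[OF assms(1)] smooth_on_pd smooth_on_mult dd_cmult[OF smooth_on_pd[OF assms(2)]])
    also have "\<dots> = (\<Sum>j\<in>UNIV. \<Sum>k\<in>UNIV. z $ k * (w $ j * pd k (pd j f) y))"
      by (simp add: dd_def sum_distrib_left ac_simps)
    finally show ?thesis by (subst sum.swap)
  qed
  show ?thesis unfolding 1 by (subst sum.swap) (simp add: pd_pd_commute[OF assms] ac_simps)
qed

lemma dd_linear:
  "dd (z + w) f y = dd z f y + dd w f y" "dd (z - w) f y = dd z f y - dd w f y"
  "dd (c *s z) f y = c * dd z f y" "dd 0 f y = 0" "dd (\<Sum>i\<in>I. Z i) f y = (\<Sum>i\<in>I. dd (Z i) f y)"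
proof -
  show "dd (\<Sum>i\<in>I. Z i) f y = (\<Sum>i\<in>I. dd (Z i) f y)"
    unfolding dd_def by (simp add: sum_distrib_right, subst sum.swap, simp)
qed (simp_all add: dd_def algebra_simps sum.distrib sum_subtractf sum_distrib_left)

lemma ev_linear:
  "ev \<omega> (z + w) y = ev \<omega> z y + ev \<omega> w y" "ev \<omega> (z - w) y = ev \<omega> z y - ev \<omega> w y"
  "ev \<omega> (c *s z) y = c * ev \<omega> z y" "ev \<omega> 0 y = 0" "ev \<omega> (\<Sum>i\<in>I. Z i) y = (\<Sum>i\<in>I. ev \<omega> (Z i) y)"
proof -
  show "ev \<omega> (\<Sum>i\<in>I. Z i) y = (\<Sum>i\<in>I. ev \<omega> (Z i) y)"
    unfolding ev_def by (simp add: sum_distrib_right, subst sum.swap, simp)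
qed (simp_all add: ev_def algebra_simps sum.distrib sum_subtractf sum_distrib_left)

text \<open>The product rule separates the derivative with the field frozen at \<open>y\<close> from
  the contribution of the varying components of the field.\<close>

lemma dd_ev_field:
  assumes "open V" "\<And>j. smooth_on V (\<omega> j)" "\<And>j. smooth_on V (\<lambda>y. Z y $ j)" "y \<in> V"
  shows "dd w (\<lambda>y. ev \<omega> (Z y) y) y = dd w (ev \<omega> (Z y)) y + ev \<omega> (\<chi> j. dd w (\<lambda>y. Z y $ j) y) y"
proof -
  have "dd w (\<lambda>y. ev \<omega> (Z y) y) y
      = (\<Sum>j\<in>UNIV. Z y $ j * dd w (\<omega> j) y + dd w (\<lambda>y. Z y $ j) y * \<omega> j y)"
    unfolding ev_def using assms by (simp add: dd_sum[OF assms(1)] smooth_on_mult dd_mult[OF assms(3,2)])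
  moreover have "dd w (ev \<omega> (Z y)) y = (\<Sum>j\<in>UNIV. Z y $ j * dd w (\<omega> j) y)"
    unfolding ev_def[abs_def] using assms
    by (simp add: dd_sum[OF assms(1)] smooth_on_mult dd_cmult[OF assms(2)])
  ultimately show ?thesis by (simp add: ev_def sum.distrib)
qed

lemma dd_dd_field:
  assumes "open V" "smooth_on V f" "\<And>j. smooth_on V (\<lambda>y. Z y $ j)" "y \<in> V"
  shows "dd w (\<lambda>y. dd (Z y) f y) y = dd w (dd (Z y) f) y + dd (\<chi> j. dd w (\<lambda>y. Z y $ j) y) f y"
proof -
  have e: "dd z f = ev (\<lambda>j. pd j f) z" for z
    by (simp add: fun_eq_iff dd_def ev_def)
  show ?thesis unfolding e using assms by (intro dd_ev_field smooth_on_pd)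
qed

lemma dform_coeffs:
  assumes "open V" "\<And>j. smooth_on V (\<omega> j)" "y \<in> V"
  shows "dform \<omega> z w y = (\<Sum>j\<in>UNIV. \<Sum>k\<in>UNIV. z $ j * w $ k * (pd j (\<omega> k) y - pd k (\<omega> j) y))"
proof -
  have 1: "dd z (ev \<omega> w) y = (\<Sum>k\<in>UNIV. \<Sum>j\<in>UNIV. z $ j * w $ k * pd j (\<omega> k) y)" for z w
    unfolding ev_def[abs_def] using assms
    by (simp add: dd_sum[OF assms(1)] smooth_on_mult dd_cmult[OF assms(2)])
       (simp add: dd_def sum_distrib_left ac_simps)
  have "dd z (ev \<omega> w) y = (\<Sum>j\<in>UNIV. \<Sum>k\<in>UNIV. z $ j * w $ k * pd j (\<omega> k) y)"
    unfolding 1 by (rule sum.swap)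
  moreover have "dd w (ev \<omega> z) y = (\<Sum>j\<in>UNIV. \<Sum>k\<in>UNIV. z $ j * w $ k * pd k (\<omega> j) y)"
    unfolding 1 by (simp add: ac_simps)
  ultimately show ?thesis by (simp add: dform_def right_diff_distrib sum_subtractf)
qed

text \<open>For constant vectors, the cyclic sum of the derivatives of a 2-form is the value of its
  exterior derivative, and the cyclic sum of products of a 2-form with a 1-form is their wedge
  product.\<close>

definition cyc3 :: "('z \<Rightarrow> 'z \<Rightarrow> 'z \<Rightarrow> complex) \<Rightarrow> 'z \<Rightarrow> 'z \<Rightarrow> 'z \<Rightarrow> complex" where
  "cyc3 P X Y Z = P X Y Z + P Y Z X + P Z X Y"

text \<open>This is \<open>d\<^sup>2 = 0\<close>: the six second derivatives cancel in pairs by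
  symmetry.\<close>

lemma d_squared:
  assumes "open V" "\<And>j. smooth_on V (\<omega> j)" "y \<in> V"
  shows "cyc3 (\<lambda>X Y Z. dd X (dform \<omega> Y Z) y) X Y Z = 0"
proof -
  have s: "smooth_on V (dd w (ev \<omega> z))" for z w
    using assms by (intro smooth_on_dd_const smooth_on_ev_const)
  have "dd X (dform \<omega> Y Z) y = dd X (dd Y (ev \<omega> Z)) y - dd X (dd Z (ev \<omega> Y)) y" for X Y Z
    unfolding dform_def[abs_def] by (rule dd_diff[OF assms(1) s s assms(3)])
  moreover have c: "dd X (dd Y (ev \<omega> Z)) y = dd Y (dd X (ev \<omega> Z)) y" for X Y Z
    by (rule dd_commute[OF assms(1) smooth_on_ev_const[OF assms(1,2)] assms(3)])
  ultimately show ?thesis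
    unfolding cyc3_def c[of X Y Z] c[of X Z Y] c[of Y Z X] by (simp only:) simp
qed

lemma dd_wedge:
  assumes "open V" "\<And>j. smooth_on V (a j)" "\<And>j. smooth_on V (b j)" "y \<in> V"
  shows "dd X (\<lambda>y. ev a Y y * ev b Z y - ev a Z y * ev b Y y) y
    = ev a Y y * dd X (ev b Z) y + dd X (ev a Y) y * ev b Z y
      - (ev a Z y * dd X (ev b Y) y + dd X (ev a Z) y * ev b Y y)"
  using assms
  by (simp add: dd_diff[OF assms(1)] smooth_on_mult smooth_on_ev_const
      dd_mult[OF smooth_on_ev_const[OF assms(1,2)] smooth_on_ev_const[OF assms(1,3)]])

text \<open>The graded Leibniz rule \<open>d(a \<and> b) = da \<and> b - a \<and> db\<close>, with
  both sides written as cyclic sums over constant vectors.\<close>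

lemma d_wedge:
  assumes "open V" "\<And>j. smooth_on V (a j)" "\<And>j. smooth_on V (b j)" "y \<in> V"
  shows "cyc3 (\<lambda>X Y Z. dd X (\<lambda>y. ev a Y y * ev b Z y - ev a Z y * ev b Y y) y) X Y Z
    = cyc3 (\<lambda>X Y Z. dform a X Y y * ev b Z y - ev a X y * dform b Y Z y) X Y Z"
  unfolding cyc3_def dd_wedge[OF assms] dform_def by (simp add: algebra_simps)

section \<open>Consequences of the structure equations in a local coframing\<close>

definition cw :: "coeff_form \<Rightarrow> coeff_form \<Rightarrow> 6 \<Rightarrow> 6 \<Rightarrow> real^6 \<Rightarrow> complex" where
  "cw a b j k y = a j y * b k y - a k y * b j y"

definition wv :: "coeff_form \<Rightarrow> coeff_form \<Rightarrow> complex^6 \<Rightarrow> complex^6 \<Rightarrow> real^6 \<Rightarrow> complex" where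
  "wv a b Y Z y = ev a Y y * ev b Z y - ev a Z y * ev b Y y"

definition cnjf :: "coeff_form \<Rightarrow> coeff_form" where
  "cnjf a j y = cnj (a j y)"

text \<open>Carries identities between coefficients, the form in which the structure equations are
  pulled back, over to values on arbitrary complex vectors.\<close>

definition contract2 :: "complex^6 \<Rightarrow> complex^6 \<Rightarrow> (6 \<Rightarrow> 6 \<Rightarrow> complex) \<Rightarrow> complex" where
  "contract2 Y Z c = (\<Sum>j\<in>UNIV. \<Sum>k\<in>UNIV. Y $ j * Z $ k * c j k)"

lemma contract2_simps:
  "contract2 Y Z (\<lambda>j k. c j k + d j k) = contract2 Y Z c + contract2 Y Z d"
  "contract2 Y Z (\<lambda>j k. c j k - d j k) = contract2 Y Z c - contract2 Y Z d"
  "contract2 Y Z (\<lambda>j k. - c j k) = - contract2 Y Z c"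
  "contract2 Y Z (\<lambda>j k. s * c j k) = s * contract2 Y Z c"
  unfolding contract2_def
  by (simp_all add: algebra_simps sum.distrib sum_subtractf sum_negf sum_distrib_left)

lemma contract2_sum:
  "contract2 Y Z (\<lambda>j k. \<Sum>i\<in>I. C i j k) = (\<Sum>i\<in>I. contract2 Y Z (C i))"
  by (induction I rule: infinite_finite_induct) (simp_all add: contract2_simps, simp_all add: contract2_def)

lemma contract2_cw: "contract2 Y Z (\<lambda>j k. cw a b j k y) = wv a b Y Z y"
proof -
  have "wv a b Y Z y = (\<Sum>j\<in>UNIV. \<Sum>k\<in>UNIV. (Y $ j * a j y) * (Z $ k * b k y))
      - (\<Sum>k\<in>UNIV. \<Sum>j\<in>UNIV. (Z $ k * a k y) * (Y $ j * b j y))"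
    unfolding wv_def ev_def by (simp only: sum_product)
  also have "\<dots> = (\<Sum>j\<in>UNIV. \<Sum>k\<in>UNIV. (Y $ j * a j y) * (Z $ k * b k y))
      - (\<Sum>j\<in>UNIV. \<Sum>k\<in>UNIV. (Z $ k * a k y) * (Y $ j * b j y))"
    by (subst (3) sum.swap) simp
  finally show ?thesis
    unfolding contract2_def cw_def
    by (simp add: right_diff_distrib sum_subtractf ac_simps)
qed

lemma cnj_cw: "cnj (cw a b j k y) = cw (cnjf a) (cnjf b) j k y"
  by (simp add: cw_def cnjf_def)

lemma cnjf_cnjf [simp]: "cnjf (cnjf a) = a"
  by (simp add: cnjf_def fun_eq_iff)

lemma cnj_ev: "cnj (ev a z y) = ev (cnjf a) (cnjv z) y"
  by (simp add: ev_def cnjf_def)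

lemma cnj_eps [simp]: "cnj (eps i j k) = eps i j k"
  by (simp add: eps_def)

lemma smooth_on_wv:
  assumes "open V" "\<And>j. smooth_on V (a j)" "\<And>j. smooth_on V (b j)"
  shows "smooth_on V (wv a b Y Z)"
  unfolding wv_def[abs_def] using assms by (intro smooth_on_diff smooth_on_mult smooth_on_ev_const)

text \<open>The value of \<open>d(a \<and> b)\<close> in terms of \<open>da\<close> and \<open>db\<close>.\<close>

definition dwv :: "coeff_form \<Rightarrow> coeff_form \<Rightarrow> complex^6 \<Rightarrow> complex^6 \<Rightarrow> complex^6 \<Rightarrow> real^6 \<Rightarrow> complex" where
  "dwv a b X Y Z y = cyc3 (\<lambda>X Y Z. dform a X Y y * ev b Z y - ev a X y * dform b Y Z y) X Y Z"

lemma cyc3_wv: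
  assumes "open V" "\<And>j. smooth_on V (a j)" "\<And>j. smooth_on V (b j)" "y \<in> V"
  shows "cyc3 (\<lambda>X Y Z. dd X (wv a b Y Z) y) X Y Z = dwv a b X Y Z y"
  unfolding wv_def[abs_def] dwv_def by (rule d_wedge[OF assms])

lemma cyc3_linear:
  "cyc3 (\<lambda>X Y Z. P X Y Z + Q X Y Z) X Y Z = cyc3 P X Y Z + cyc3 Q X Y Z"
  "cyc3 (\<lambda>X Y Z. P X Y Z - Q X Y Z) X Y Z = cyc3 P X Y Z - cyc3 Q X Y Z"
  "cyc3 (\<lambda>X Y Z. - P X Y Z) X Y Z = - cyc3 P X Y Z"
  "cyc3 (\<lambda>X Y Z. c * P X Y Z) X Y Z = c * cyc3 P X Y Z"
  "cyc3 (\<lambda>X Y Z. \<Sum>i\<in>I. R i X Y Z) X Y Z = (\<Sum>i\<in>I. cyc3 (R i) X Y Z)"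
  by (simp_all add: cyc3_def algebra_simps sum.distrib)

text \<open>The data of the bundle pulled back by a section. \<open>lb\<close> and \<open>Bb\<close>
  are the components with barred derivative index, those along \<open>\<alpha>\<close>;
  \<open>lu\<close> and \<open>Bu\<close> are the components along the conjugates. By duality and
  \<open>complete\<close>, the vectors \<open>E a y\<close> and their conjugates form a basis of the
  complexified tangent space.\<close>

locale structure_on =
  fixes V :: "(real^6) set" and \<alpha> :: "3 \<Rightarrow> coeff_form" and E :: "3 \<Rightarrow> real^6 \<Rightarrow> complex^6"
    and \<rho> :: coeff_form and \<kappa> :: "3 \<Rightarrow> 3 \<Rightarrow> coeff_form"
    and B :: "3 \<Rightarrow> 3 \<Rightarrow> 3 \<Rightarrow> real^6 \<Rightarrow> complex" and lam :: "real^6 \<Rightarrow> complex"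
    and lb lu :: "3 \<Rightarrow> real^6 \<Rightarrow> complex" and Bb Bu :: "3 \<Rightarrow> 3 \<Rightarrow> 3 \<Rightarrow> 3 \<Rightarrow> real^6 \<Rightarrow> complex"
  assumes V: "open V"
    and smooth_\<alpha>: "\<And>i j. smooth_on V (\<alpha> i j)" and smooth_E: "\<And>a j. smooth_on V (\<lambda>y. E a y $ j)"
    and smooth_\<rho>: "\<And>j. smooth_on V (\<rho> j)" and smooth_\<kappa>: "\<And>i k j. smooth_on V (\<kappa> i k j)"
    and smooth_B: "\<And>i j k. smooth_on V (B i j k)" and smooth_lam: "smooth_on V lam"
    and dual: "\<And>y i a. y \<in> V \<Longrightarrow> ev (\<alpha> i) (E a y) y = (if i = a then 1 else 0)"
    and dual_cnj: "\<And>y i a. y \<in> V \<Longrightarrow> ev (\<alpha> i) (cnjv (E a y)) y = 0"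
    and complete: "\<And>y j. y \<in> V \<Longrightarrow>
      axis j 1 = (\<Sum>a\<in>UNIV. \<alpha> a j y *s E a y) + (\<Sum>a\<in>UNIV. cnj (\<alpha> a j y) *s cnjv (E a y))"
    and real_\<rho>: "\<And>y j. y \<in> V \<Longrightarrow> cnj (\<rho> j y) = \<rho> j y"
    and antiherm: "\<And>y i k j. y \<in> V \<Longrightarrow> cnj (\<kappa> i k j y) = - \<kappa> k i j y"
    and B_alt: "\<And>y i j k. y \<in> V \<Longrightarrow> B i j k y = - B j i k y"
    and B_tr: "\<And>y i. y \<in> V \<Longrightarrow> (\<Sum>j\<in>UNIV. B i j j y) = 0"
    and structure_eq: "\<And>y i j k. y \<in> V \<Longrightarrow> pd j (\<alpha> i k) y - pd k (\<alpha> i j) y =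
        - cw \<rho> (\<alpha> i) j k y - (\<Sum>p\<in>UNIV. cw (\<kappa> i p) (\<alpha> p) j k y)
        - (\<Sum>p\<in>UNIV. \<Sum>q\<in>UNIV. B i p q y * cw (cnjf (\<alpha> p)) (\<alpha> q) j k y)
        + 1/2 * (\<Sum>p\<in>UNIV. \<Sum>q\<in>UNIV. eps i p q * lam y * cnj (cw (\<alpha> p) (\<alpha> q) j k y))"
    and D_lam: "\<And>y j. y \<in> V \<Longrightarrow> pd j lam y - lam y * (\<rho> j y - (\<Sum>i\<in>UNIV. \<kappa> i i j y)) =
        (\<Sum>l\<in>UNIV. lb l y * \<alpha> l j y) + (\<Sum>l\<in>UNIV. lu l y * cnj (\<alpha> l j y))"
    and D_B: "\<And>y i j k m. y \<in> V \<Longrightarrow> pd m (B i j k) y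
        + (\<Sum>p\<in>UNIV. B p j k y * \<kappa> i p m y) + (\<Sum>p\<in>UNIV. B i p k y * \<kappa> j p m y)
        - (\<Sum>p\<in>UNIV. B i j p y * \<kappa> p k m y) - B i j k y * \<rho> m y =
        (\<Sum>l\<in>UNIV. Bb i j k l y * \<alpha> l m y) + (\<Sum>l\<in>UNIV. Bu i j k l y * cnj (\<alpha> l m y))"
begin

text \<open>With \<open>\<rho>\<close> absorbed into the connection matrix, reality of
  \<open>\<rho>\<close> and skew-hermitian symmetry of \<open>\<kappa>\<close> express the conjugate
  of \<open>\<theta>\<close> by \<open>\<tau>\<close> and the transpose of \<open>\<theta>\<close>.
  The conjugate structure equation can then be written without conjugated connection forms.\<close>

definition "\<theta> i k j y = \<kappa> i k j y + (if i = k then \<rho> j y else 0)" for i k :: 3 and j y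
definition "\<tau> j y = 2 * \<rho> j y" for j y

lemma smooth_\<theta>: "smooth_on V (\<theta> i k j)"
proof -
  have "smooth_on V (\<lambda>y. if i = k then \<rho> j y else 0)" using smooth_\<rho> by (cases "i = k") auto
  then show ?thesis
    unfolding \<theta>_def[abs_def] using V smooth_\<kappa> smooth_on_add[of V "\<kappa> i k j"] by simp
qed

lemma smooth_\<tau>: "smooth_on V (\<tau> j)"
  unfolding \<tau>_def[abs_def] using V smooth_\<rho> by (intro smooth_on_mult smooth_on_const)

lemma smooth_\<alpha>b: "smooth_on V (cnjf (\<alpha> i) j)"
  unfolding cnjf_def[abs_def] using V smooth_\<alpha> by (intro smooth_on_cnj)

lemmas smooths = smooth_\<theta> smooth_\<tau> smooth_\<alpha>b smooth_\<alpha> smooth_B smooth_lam smooth_\<rho> smooth_\<kappa>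

lemma structure_\<theta>:
  assumes y: "y \<in> V"
  shows "pd j (\<alpha> i k) y - pd k (\<alpha> i j) y =
      - (\<Sum>p\<in>UNIV. cw (\<theta> i p) (\<alpha> p) j k y)
      - (\<Sum>p\<in>UNIV. \<Sum>q\<in>UNIV. B i p q y * cw (cnjf (\<alpha> p)) (\<alpha> q) j k y)
      + 1/2 * (\<Sum>p\<in>UNIV. \<Sum>q\<in>UNIV. eps i p q * (lam y * cw (cnjf (\<alpha> p)) (cnjf (\<alpha> q)) j k y))"
proof -
  have "(\<Sum>p\<in>UNIV. cw (\<theta> i p) (\<alpha> p) j k y)
      = (\<Sum>p\<in>UNIV. cw (\<kappa> i p) (\<alpha> p) j k y + (if i = p then cw \<rho> (\<alpha> p) j k y else 0))"
    by (rule sum.cong) (auto simp: \<theta>_def cw_def algebra_simps)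
  also have "\<dots> = (\<Sum>p\<in>UNIV. cw (\<kappa> i p) (\<alpha> p) j k y) + cw \<rho> (\<alpha> i) j k y"
    by (simp add: sum.distrib)
  finally show ?thesis using structure_eq[OF y, of j i k] by (simp add: cnj_cw mult.assoc)
qed

lemma cnj_\<theta>: "y \<in> V \<Longrightarrow> cnj (\<theta> i p j y) = (if i = p then \<tau> j y else 0) - \<theta> p i j y"
  by (simp add: \<theta>_def \<tau>_def antiherm real_\<rho>)

lemma structure_cnj:
  assumes y: "y \<in> V"
  shows "pd j (cnjf (\<alpha> i) k) y - pd k (cnjf (\<alpha> i) j) y =
      - cw \<tau> (cnjf (\<alpha> i)) j k y + (\<Sum>p\<in>UNIV. cw (\<theta> p i) (cnjf (\<alpha> p)) j k y)
      - (\<Sum>p\<in>UNIV. \<Sum>q\<in>UNIV. cnj (B i p q y) * cw (\<alpha> p) (cnjf (\<alpha> q)) j k y)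
      + 1/2 * (\<Sum>p\<in>UNIV. \<Sum>q\<in>UNIV. eps i p q * (cnj (lam y) * cw (\<alpha> p) (\<alpha> q) j k y))"
proof -
  have "cnj (\<Sum>p\<in>UNIV. cw (\<theta> i p) (\<alpha> p) j k y)
      = (\<Sum>p\<in>UNIV. (if i = p then cw \<tau> (cnjf (\<alpha> p)) j k y else 0) - cw (\<theta> p i) (cnjf (\<alpha> p)) j k y)"
    unfolding cnj_sum by (rule sum.cong) (auto simp: cw_def cnj_\<theta>[OF y] cnjf_def algebra_simps)
  also have "\<dots> = cw \<tau> (cnjf (\<alpha> i)) j k y - (\<Sum>p\<in>UNIV. cw (\<theta> p i) (cnjf (\<alpha> p)) j k y)"
    by (simp add: sum_subtractf)
  finally have 1: "cnj (\<Sum>p\<in>UNIV. cw (\<theta> i p) (\<alpha> p) j k y)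
    = cw \<tau> (cnjf (\<alpha> i)) j k y - (\<Sum>p\<in>UNIV. cw (\<theta> p i) (cnjf (\<alpha> p)) j k y)" .
  have "pd j (cnjf (\<alpha> i) k) y - pd k (cnjf (\<alpha> i) j) y = cnj (pd j (\<alpha> i k) y - pd k (\<alpha> i j) y)"
    unfolding cnjf_def[abs_def] by (simp add: pd_cnj[OF smooth_\<alpha> y])
  then show ?thesis unfolding structure_\<theta>[OF y]
    by (simp add: cnj_cw del: cnj_sum add: 1) (simp add: cnj_cw)
qed

lemma dform_\<alpha>:
  assumes y: "y \<in> V"
  shows "dform (\<alpha> i) Y Z y = - (\<Sum>p\<in>UNIV. wv (\<theta> i p) (\<alpha> p) Y Z y)
      - (\<Sum>p\<in>UNIV. \<Sum>q\<in>UNIV. B i p q y * wv (cnjf (\<alpha> p)) (\<alpha> q) Y Z y)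
      + 1/2 * (\<Sum>p\<in>UNIV. \<Sum>q\<in>UNIV. eps i p q * (lam y * wv (cnjf (\<alpha> p)) (cnjf (\<alpha> q)) Y Z y))"
  unfolding dform_coeffs[OF V smooth_\<alpha> y] structure_\<theta>[OF y] contract2_def[symmetric]
  by (simp only: contract2_simps contract2_sum contract2_cw)

lemma dform_\<alpha>b:
  assumes y: "y \<in> V"
  shows "dform (cnjf (\<alpha> i)) Y Z y = - wv \<tau> (cnjf (\<alpha> i)) Y Z y + (\<Sum>p\<in>UNIV. wv (\<theta> p i) (cnjf (\<alpha> p)) Y Z y)
      - (\<Sum>p\<in>UNIV. \<Sum>q\<in>UNIV. cnj (B i p q y) * wv (\<alpha> p) (cnjf (\<alpha> q)) Y Z y)
      + 1/2 * (\<Sum>p\<in>UNIV. \<Sum>q\<in>UNIV. eps i p q * (cnj (lam y) * wv (\<alpha> p) (\<alpha> q) Y Z y))"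
  unfolding dform_coeffs[OF V smooth_\<alpha>b y] structure_cnj[OF y] contract2_def[symmetric]
  by (simp only: contract2_simps contract2_sum contract2_cw)

text \<open>The first Bianchi identity: \<open>d\<^sup>2\<alpha>\<^sub>i = 0\<close> with the
  structure equation inserted. The curvature is contained in the terms
  \<open>dwv (\<theta> i p) (\<alpha> p)\<close>.\<close>

lemma bianchi:
  assumes y: "y \<in> V"
  shows "- (\<Sum>p\<in>UNIV. dwv (\<theta> i p) (\<alpha> p) X Y Z y)
      - (\<Sum>p\<in>UNIV. \<Sum>q\<in>UNIV. B i p q y * dwv (cnjf (\<alpha> p)) (\<alpha> q) X Y Z y
          + cyc3 (\<lambda>X Y Z. dd X (B i p q) y * wv (cnjf (\<alpha> p)) (\<alpha> q) Y Z y) X Y Z)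
      + 1/2 * (\<Sum>p\<in>UNIV. \<Sum>q\<in>UNIV. eps i p q * (lam y * dwv (cnjf (\<alpha> p)) (cnjf (\<alpha> q)) X Y Z y
          + cyc3 (\<lambda>X Y Z. dd X lam y * wv (cnjf (\<alpha> p)) (cnjf (\<alpha> q)) Y Z y) X Y Z)) = 0"
proof -
  define h :: complex where "h = 1/2"
  note s = smooths smooth_on_wv[OF V] smooth_on_mult[OF V] smooth_on_sum[OF V] smooth_on_diff[OF V]
    smooth_on_minus[OF V] smooth_on_add[OF V]
  have c: "dd X (dform (\<alpha> i) Y Z) y = dd X (\<lambda>y. - (\<Sum>p\<in>UNIV. wv (\<theta> i p) (\<alpha> p) Y Z y)
      - (\<Sum>p\<in>UNIV. \<Sum>q\<in>UNIV. B i p q y * wv (cnjf (\<alpha> p)) (\<alpha> q) Y Z y)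
      + h * (\<Sum>p\<in>UNIV. \<Sum>q\<in>UNIV. eps i p q * (lam y * wv (cnjf (\<alpha> p)) (cnjf (\<alpha> q)) Y Z y))) y" for X Y Z
    by (rule dd_cong[OF V _ y, symmetric], intro s smooth_on_const) (simp add: dform_\<alpha> h_def)
  have e: "dd X (dform (\<alpha> i) Y Z) y = - (\<Sum>p\<in>UNIV. dd X (wv (\<theta> i p) (\<alpha> p) Y Z) y)
      - (\<Sum>p\<in>UNIV. \<Sum>q\<in>UNIV. B i p q y * dd X (wv (cnjf (\<alpha> p)) (\<alpha> q) Y Z) y
          + dd X (B i p q) y * wv (cnjf (\<alpha> p)) (\<alpha> q) Y Z y)
      + h * (\<Sum>p\<in>UNIV. \<Sum>q\<in>UNIV. eps i p q * (lam y * dd X (wv (cnjf (\<alpha> p)) (cnjf (\<alpha> q)) Y Z) y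
          + dd X lam y * wv (cnjf (\<alpha> p)) (cnjf (\<alpha> q)) Y Z y))" for X Y Z
    unfolding c by (simp add: s dd_add[OF _ _ y] dd_diff[OF V _ _ y] dd_minus[OF _ y] dd_sum[OF V _ y]
        dd_cmult[OF _ y] dd_mult[OF _ _ y])
  have "cyc3 (\<lambda>X Y Z. dd X (dform (\<alpha> i) Y Z) y) X Y Z = 0"
    by (rule d_squared[OF V smooth_\<alpha> y])
  then show ?thesis
    unfolding e cyc3_linear h_def
    by (simp only: cyc3_wv[OF V smooth_\<theta> smooth_\<alpha> y] cyc3_wv[OF V smooth_\<alpha>b smooth_\<alpha> y]
        cyc3_wv[OF V smooth_\<alpha>b smooth_\<alpha>b y])
qed

text \<open>Obtained by differentiating the conjugate structure equation, so that the same forms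
  \<open>\<theta>\<close> and \<open>\<tau>\<close> occur as in \<open>bianchi\<close> and the two
  identities can be combined linearly.\<close>

lemma bianchi_cnj:
  assumes y: "y \<in> V"
  shows "- dwv \<tau> (cnjf (\<alpha> i)) X Y Z y + (\<Sum>p\<in>UNIV. dwv (\<theta> p i) (cnjf (\<alpha> p)) X Y Z y)
      - (\<Sum>p\<in>UNIV. \<Sum>q\<in>UNIV. cnj (B i p q y) * dwv (\<alpha> p) (cnjf (\<alpha> q)) X Y Z y
          + cyc3 (\<lambda>X Y Z. dd X (\<lambda>y. cnj (B i p q y)) y * wv (\<alpha> p) (cnjf (\<alpha> q)) Y Z y) X Y Z)
      + 1/2 * (\<Sum>p\<in>UNIV. \<Sum>q\<in>UNIV. eps i p q * (cnj (lam y) * dwv (\<alpha> p) (\<alpha> q) X Y Z y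
          + cyc3 (\<lambda>X Y Z. dd X (\<lambda>y. cnj (lam y)) y * wv (\<alpha> p) (\<alpha> q) Y Z y) X Y Z)) = 0"
proof -
  define h :: complex where "h = 1/2"
  note s = smooths smooth_on_wv[OF V] smooth_on_mult[OF V] smooth_on_sum[OF V] smooth_on_diff[OF V]
    smooth_on_minus[OF V] smooth_on_add[OF V] smooth_on_cnj[OF V]
  have c: "dd X (dform (cnjf (\<alpha> i)) Y Z) y = dd X (\<lambda>y. - wv \<tau> (cnjf (\<alpha> i)) Y Z y + (\<Sum>p\<in>UNIV. wv (\<theta> p i) (cnjf (\<alpha> p)) Y Z y)
      - (\<Sum>p\<in>UNIV. \<Sum>q\<in>UNIV. cnj (B i p q y) * wv (\<alpha> p) (cnjf (\<alpha> q)) Y Z y)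
      + h * (\<Sum>p\<in>UNIV. \<Sum>q\<in>UNIV. eps i p q * (cnj (lam y) * wv (\<alpha> p) (\<alpha> q) Y Z y))) y" for X Y Z
    by (rule dd_cong[OF V _ y, symmetric], intro s smooth_on_const) (simp add: dform_\<alpha>b h_def)
  have e: "dd X (dform (cnjf (\<alpha> i)) Y Z) y = - dd X (wv \<tau> (cnjf (\<alpha> i)) Y Z) y
      + (\<Sum>p\<in>UNIV. dd X (wv (\<theta> p i) (cnjf (\<alpha> p)) Y Z) y)
      - (\<Sum>p\<in>UNIV. \<Sum>q\<in>UNIV. cnj (B i p q y) * dd X (wv (\<alpha> p) (cnjf (\<alpha> q)) Y Z) y
          + dd X (\<lambda>y. cnj (B i p q y)) y * wv (\<alpha> p) (cnjf (\<alpha> q)) Y Z y)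
      + h * (\<Sum>p\<in>UNIV. \<Sum>q\<in>UNIV. eps i p q * (cnj (lam y) * dd X (wv (\<alpha> p) (\<alpha> q) Y Z) y
          + dd X (\<lambda>y. cnj (lam y)) y * wv (\<alpha> p) (\<alpha> q) Y Z y))" for X Y Z
    unfolding c by (simp add: s dd_add[OF _ _ y] dd_diff[OF V _ _ y] dd_minus[OF _ y] dd_sum[OF V _ y]
        dd_cmult[OF _ y] dd_mult[OF _ _ y])
  have "cyc3 (\<lambda>X Y Z. dd X (dform (cnjf (\<alpha> i)) Y Z) y) X Y Z = 0"
    by (rule d_squared[OF V smooth_\<alpha>b y])
  then show ?thesis
    unfolding e cyc3_linear h_def
    by (simp only: cyc3_wv[OF V smooth_\<theta> smooth_\<alpha>b y] cyc3_wv[OF V smooth_\<tau> smooth_\<alpha>b y]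
        cyc3_wv[OF V smooth_\<alpha> smooth_\<alpha>b y] cyc3_wv[OF V smooth_\<alpha> smooth_\<alpha> y])
qed

end

definition contract1 :: "complex^6 \<Rightarrow> (6 \<Rightarrow> complex) \<Rightarrow> complex" where
  "contract1 Z c = (\<Sum>j\<in>UNIV. Z $ j * c j)"

lemma contract1_simps:
  "contract1 Z (\<lambda>j. c j + d j) = contract1 Z c + contract1 Z d"
  "contract1 Z (\<lambda>j. c j - d j) = contract1 Z c - contract1 Z d"
  "contract1 Z (\<lambda>j. - c j) = - contract1 Z c"
  "contract1 Z (\<lambda>j. s * c j) = s * contract1 Z c"
  unfolding contract1_def
  by (simp_all add: algebra_simps sum.distrib sum_subtractf sum_negf sum_distrib_left)

lemma contract1_sum:
  "contract1 Z (\<lambda>j. \<Sum>i\<in>I. C i j) = (\<Sum>i\<in>I. contract1 Z (C i))"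
  by (induction I rule: infinite_finite_induct) (simp_all add: contract1_simps, simp_all add: contract1_def)

lemma contract1_form: "contract1 Z (\<lambda>j. \<omega> j y) = ev \<omega> Z y"
  by (simp add: contract1_def ev_def)

section \<open>Components of the Bianchi identities and of the covariant derivatives\<close>

context structure_on begin

text \<open>The connection form of \<lambda> is \<open>\<rho> - tr \<kappa>\<close>, which is
  \<open>2\<tau> - tr \<theta>\<close>, because the trace of \<open>\<theta>\<close> contains
  \<open>3\<rho>\<close> and \<open>2\<tau>\<close> is \<open>4\<rho>\<close>.\<close>

lemma dd_lam:
  assumes y: "y \<in> V"
  shows "dd Z lam y = lam y * (2 * ev \<tau> Z y - (\<Sum>i\<in>UNIV. ev (\<theta> i i) Z y))
    + (\<Sum>l\<in>UNIV. lb l y * ev (\<alpha> l) Z y) + (\<Sum>l\<in>UNIV. lu l y * ev (cnjf (\<alpha> l)) Z y)"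
proof -
  have "pd j lam y = lam y * (2 * \<tau> j y - (\<Sum>i\<in>UNIV. \<theta> i i j y))
    + (\<Sum>l\<in>UNIV. lb l y * \<alpha> l j y) + (\<Sum>l\<in>UNIV. lu l y * cnjf (\<alpha> l) j y)" for j
    using D_lam[OF y, of j] by (simp add: sum_3 \<theta>_def \<tau>_def cnjf_def algebra_simps)
  then show ?thesis
    unfolding dd_def contract1_def[symmetric]
    by (simp only: contract1_simps contract1_sum contract1_form)
qed

text \<open>Replacing \<open>\<kappa>\<close> by \<open>\<theta>\<close> in the three connection
  terms contributes \<open>- \<rho> - \<rho> + \<rho>\<close>. Since \<open>B\<close> has weight
  \<open>\<rho>\<close> in \<open>DB\<close>, compensating for this leaves the coefficient
  \<open>2\<rho> = \<tau>\<close>.\<close>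

lemma dd_B:
  assumes y: "y \<in> V"
  shows "dd Z (B i j k) y = - (\<Sum>p\<in>UNIV. B p j k y * ev (\<theta> i p) Z y)
    - (\<Sum>p\<in>UNIV. B i p k y * ev (\<theta> j p) Z y) + (\<Sum>p\<in>UNIV. B i j p y * ev (\<theta> p k) Z y)
    + B i j k y * ev \<tau> Z y
    + (\<Sum>l\<in>UNIV. Bb i j k l y * ev (\<alpha> l) Z y) + (\<Sum>l\<in>UNIV. Bu i j k l y * ev (cnjf (\<alpha> l)) Z y)"
proof -
  have d: "(\<Sum>p\<in>UNIV. C p * \<theta> i p m y) = (\<Sum>p\<in>UNIV. C p * \<kappa> i p m y) + C i * \<rho> m y"
    "(\<Sum>p\<in>UNIV. C p * \<theta> p i m y) = (\<Sum>p\<in>UNIV. C p * \<kappa> p i m y) + C i * \<rho> m y" for C i m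
  proof -
    have "(\<Sum>p\<in>UNIV. C p * \<theta> i p m y) = (\<Sum>p\<in>UNIV. C p * \<kappa> i p m y + (if i = p then C p * \<rho> m y else 0))"
      by (rule sum.cong) (auto simp: \<theta>_def algebra_simps)
    then show "(\<Sum>p\<in>UNIV. C p * \<theta> i p m y) = (\<Sum>p\<in>UNIV. C p * \<kappa> i p m y) + C i * \<rho> m y"
      by (simp add: sum.distrib)
    have "(\<Sum>p\<in>UNIV. C p * \<theta> p i m y) = (\<Sum>p\<in>UNIV. C p * \<kappa> p i m y + (if p = i then C p * \<rho> m y else 0))"
      by (rule sum.cong) (auto simp: \<theta>_def algebra_simps)
    then show "(\<Sum>p\<in>UNIV. C p * \<theta> p i m y) = (\<Sum>p\<in>UNIV. C p * \<kappa> p i m y) + C i * \<rho> m y"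
      by (simp add: sum.distrib)
  qed
  have "pd m (B i j k) y = - (\<Sum>p\<in>UNIV. B p j k y * \<theta> i p m y)
    - (\<Sum>p\<in>UNIV. B i p k y * \<theta> j p m y) + (\<Sum>p\<in>UNIV. B i j p y * \<theta> p k m y)
    + B i j k y * \<tau> m y
    + (\<Sum>l\<in>UNIV. Bb i j k l y * \<alpha> l m y) + (\<Sum>l\<in>UNIV. Bu i j k l y * cnjf (\<alpha> l) m y)" for m
    unfolding d using D_B[OF y, of m i j k] by (simp add: \<tau>_def cnjf_def algebra_simps)
  then show ?thesis
    unfolding dd_def contract1_def[symmetric]
    by (simp only: contract1_simps contract1_sum contract1_form)
qed

lemma dual_conj:
  assumes "y \<in> V"
  shows "ev (cnjf (\<alpha> i)) (cnjv (E a y)) y = (if i = a then 1 else 0)"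
    "ev (cnjf (\<alpha> i)) (E a y) y = 0"
  using dual[OF assms, of i a] dual_cnj[OF assms, of i a] cnj_ev[of "\<alpha> i" "E a y" y]
    cnj_ev[of "\<alpha> i" "cnjv (E a y)" y] by auto

text \<open>Rewrite rules that leave six independent components, \<open>B 1 2 k\<close>,
  \<open>B 1 3 1\<close>, \<open>B 1 3 2\<close> and \<open>B 2 3 1\<close>. They bring the expanded
  Bianchi identities into a normal form.\<close>

lemma B_relations:
  assumes y: "y \<in> V"
  shows "B 1 1 k y = 0" "B 2 2 k y = 0" "B 3 3 k y = 0"
    "B 2 1 k y = - B 1 2 k y" "B 3 1 k y = - B 1 3 k y" "B 3 2 k y = - B 2 3 k y"
    "B 1 3 3 y = - B 1 2 2 y" "B 2 3 3 y = B 1 2 1 y" "B 2 3 2 y = - B 1 3 1 y"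
  using B_alt[OF y, of 1 1 k] B_alt[OF y, of 2 2 k] B_alt[OF y, of 3 3 k] B_alt[OF y, of 2 1 k]
    B_alt[OF y, of 3 1 k] B_alt[OF y, of 3 2 k] B_tr[OF y, of 1] B_tr[OF y, of 2] B_tr[OF y, of 3]
    B_alt[OF y, of 1 1 1] B_alt[OF y, of 2 2 2] B_alt[OF y, of 3 3 3] B_alt[OF y, of 2 1 1]
    B_alt[OF y, of 3 1 1] B_alt[OF y, of 3 2 2]
  by (simp_all add: sum_3 eq_neg_iff_add_eq_0) (simp add: add.commute)

lemmas frame_simps = dual dual_cnj dual_conj dform_\<alpha> dform_\<alpha>b B_relations dd_lam wv_def dwv_def cyc3_def sum_3 eps_def

text \<open>On three (0,1)-vectors the curvature drops out, since it is multiplied by a value of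
  \<open>\<alpha>\<close>. The torsion terms amount to \<lambda> times a trace of \<open>B\<close>,
  which is zero, and the connection terms cancel against those in the derivative of \<lambda>. Only
  \<open>lu\<close> survives.\<close>

lemma lu_zero:
  assumes y: "y \<in> V"
  shows "lu l y = 0"
proof -
  have "lu 1 y = 0"
    using bianchi[OF y, of 1 "cnjv (E 1 y)" "cnjv (E 2 y)" "cnjv (E 3 y)"]
    by (simp add: frame_simps y) (simp add: field_simps)
  moreover have "lu 2 y = 0"
    using bianchi[OF y, of 2 "cnjv (E 1 y)" "cnjv (E 2 y)" "cnjv (E 3 y)"]
    by (simp add: frame_simps y) (simp add: field_simps)
  moreover have "lu 3 y = 0"
    using bianchi[OF y, of 3 "cnjv (E 1 y)" "cnjv (E 2 y)" "cnjv (E 3 y)"]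
    by (simp add: frame_simps y) (simp add: field_simps)
  ultimately show ?thesis using exhaust_3[of l] by auto
qed

lemma dd_B_alt:
  assumes y: "y \<in> V"
  shows "dd Z (B i j k) y = - dd Z (B j i k) y"
  using dd_cong[OF V smooth_B y, of i j k "\<lambda>y. - B j i k y" Z] B_alt dd_minus[OF smooth_B y] by metis

lemma dd_B_tr:
  assumes y: "y \<in> V"
  shows "(\<Sum>j\<in>UNIV. dd Z (B i j j) y) = 0"
proof -
  have "dd Z (\<lambda>y. \<Sum>j\<in>UNIV. B i j j y) y = dd Z (\<lambda>y. 0) y"
    by (rule dd_cong[OF V _ y]) (auto intro: smooth_on_sum[OF V] smooth_B B_tr)
  then show ?thesis by (simp add: dd_sum[OF V smooth_B y])
qed

text \<open>Evaluation of \<open>DB\<close> on a (0,1)-frame vector isolates one component. Through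
  this formula \<open>Bu\<close> inherits smoothness and the symmetries of \<open>B\<close>.\<close>

lemma dd_B_Bu:
  assumes y: "y \<in> V"
  shows "Bu i j k l y = dd (cnjv (E l y)) (B i j k) y + (\<Sum>p\<in>UNIV. B p j k y * ev (\<theta> i p) (cnjv (E l y)) y)
    + (\<Sum>p\<in>UNIV. B i p k y * ev (\<theta> j p) (cnjv (E l y)) y) - (\<Sum>p\<in>UNIV. B i j p y * ev (\<theta> p k) (cnjv (E l y)) y)
    - B i j k y * ev \<tau> (cnjv (E l y)) y"
  by (simp add: dd_B[OF y] dual_cnj[OF y] dual_conj[OF y] if_distrib[of "(*) _"] cong: if_cong)

lemma Bu_alt:
  assumes y: "y \<in> V"
  shows "Bu i j k l y = - Bu j i k l y"
proof -
  have a: "(\<Sum>p\<in>UNIV. B p j k y * t p) = - (\<Sum>p\<in>UNIV. B j p k y * t p)"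
    "(\<Sum>p\<in>UNIV. B i p k y * t p) = - (\<Sum>p\<in>UNIV. B p i k y * t p)"
    "(\<Sum>p\<in>UNIV. B i j p y * t p) = - (\<Sum>p\<in>UNIV. B j i p y * t p)" for t :: "3 \<Rightarrow> complex"
    unfolding sum_negf[symmetric] using B_alt[OF y, of _ j] B_alt[OF y, of i] by (auto intro!: sum.cong)
  show ?thesis
    unfolding dd_B_Bu[OF y, of i j] dd_B_Bu[OF y, of j i] dd_B_alt[OF y, of _ i j k] B_alt[OF y, of i j k] a
    by simp
qed

text \<open>The trace pairs an unbarred with a barred index. The connection acts on the two with
  opposite signs, so these contributions cancel, and every other term contains a trace of
  \<open>B\<close> or its derivative.\<close>

lemma Bu_tr:
  assumes y: "y \<in> V"
  shows "(\<Sum>j\<in>UNIV. Bu i j j l y) = 0"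
proof -
  let ?t = "\<lambda>i j. ev (\<theta> i j) (cnjv (E l y)) y"
  have "(\<Sum>j\<in>UNIV. Bu i j j l y) = (\<Sum>j\<in>UNIV. dd (cnjv (E l y)) (B i j j) y)
      + (\<Sum>p\<in>UNIV. (\<Sum>j\<in>UNIV. B p j j y) * ?t i p)
      + ((\<Sum>j\<in>UNIV. \<Sum>p\<in>UNIV. B i p j y * ?t j p) - (\<Sum>j\<in>UNIV. \<Sum>p\<in>UNIV. B i j p y * ?t p j))
      - (\<Sum>j\<in>UNIV. B i j j y) * ev \<tau> (cnjv (E l y)) y"
    unfolding dd_B_Bu[OF y]
    by (simp add: sum.distrib sum_subtractf sum_distrib_right sum.swap[of "\<lambda>j p. B p j j y * ?t i p"])
  also have "(\<Sum>j\<in>UNIV. \<Sum>p\<in>UNIV. B i p j y * ?t j p) = (\<Sum>j\<in>UNIV. \<Sum>p\<in>UNIV. B i j p y * ?t p j)"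
    by (rule sum.swap)
  finally show ?thesis by (simp add: dd_B_tr[OF y] B_tr[OF y])
qed

lemma Bu_relations:
  assumes y: "y \<in> V"
  shows "Bu 1 1 k l y = 0" "Bu 2 2 k l y = 0" "Bu 3 3 k l y = 0"
    "Bu 2 1 k l y = - Bu 1 2 k l y" "Bu 3 1 k l y = - Bu 1 3 k l y" "Bu 3 2 k l y = - Bu 2 3 k l y"
    "Bu 1 3 3 l y = - Bu 1 2 2 l y" "Bu 2 3 3 l y = Bu 1 2 1 l y" "Bu 2 3 2 l y = - Bu 1 3 1 l y"
  using Bu_alt[OF y, of 1 1 k l] Bu_alt[OF y, of 2 2 k l] Bu_alt[OF y, of 3 3 k l] Bu_alt[OF y, of 2 1 k l]
    Bu_alt[OF y, of 3 1 k l] Bu_alt[OF y, of 3 2 k l] Bu_tr[OF y, of 1 l] Bu_tr[OF y, of 2 l] Bu_tr[OF y, of 3 l]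
    Bu_alt[OF y, of 1 1 1 l] Bu_alt[OF y, of 2 2 2 l] Bu_alt[OF y, of 3 3 3 l] Bu_alt[OF y, of 2 1 1 l]
    Bu_alt[OF y, of 3 1 1 l] Bu_alt[OF y, of 3 2 2 l]
  by (simp_all add: sum_3 eq_neg_iff_add_eq_0) (simp add: add.commute)

text \<open>
  The traces below are the (1,2)-part of \<open>d\<^sup>2\<alpha>\<^sub>i = 0\<close> contracted over \<open>i\<close> with the (1,0)-slot. For
  \<open>d\<tau>\<close>, the (1,2)-part is antisymmetrised over \<open>i\<close> and the two (0,1)-slots instead, and the
  remaining curvature terms are eliminated by the conjugate of the (3,0)-part.
\<close>

lemma trace_curvature_1:
  assumes y: "y \<in> V"
  shows "(\<Sum>i\<in>UNIV. dform (\<theta> i i) (cnjv (E 2 y)) (cnjv (E 3 y)) y) = lb 1 y"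
  using arg_cong2[of _ _ _ _ "(+)", OF arg_cong2[of _ _ _ _ "(+)", OF
    bianchi[OF y, of 1 "E 1 y" "cnjv (E 2 y)" "cnjv (E 3 y)"]
    bianchi[OF y, of 2 "E 2 y" "cnjv (E 2 y)" "cnjv (E 3 y)"]]
    bianchi[OF y, of 3 "E 3 y" "cnjv (E 2 y)" "cnjv (E 3 y)"]]
  by (simp add: frame_simps dd_B Bu_relations y) (simp add: field_simps, algebra)

lemma d_tau_1:
  assumes y: "y \<in> V"
  shows "dform \<tau> (cnjv (E 2 y)) (cnjv (E 3 y)) y
    = 3 * lb 1 y + (\<Sum>i\<in>UNIV. \<Sum>j\<in>UNIV. \<Sum>k\<in>UNIV. eps i j 1 * Bu i j k k y)"
  using arg_cong2[of _ _ _ _ "(+)", OF arg_cong2[of _ _ _ _ "(+)", OF arg_cong2[of _ _ _ _ "(+)", OF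
    bianchi[OF y, of 1 "E 1 y" "cnjv (E 2 y)" "cnjv (E 3 y)"]
    bianchi[OF y, of 2 "E 1 y" "cnjv (E 3 y)" "cnjv (E 1 y)"]]
    bianchi[OF y, of 3 "E 1 y" "cnjv (E 1 y)" "cnjv (E 2 y)"]]
    bianchi_cnj[OF y, of 1 "cnjv (E 1 y)" "cnjv (E 2 y)" "cnjv (E 3 y)"]]
  by (simp add: frame_simps dd_B Bu_relations y) (simp add: field_simps, algebra)

lemma trace_curvature_2:
  assumes y: "y \<in> V"
  shows "(\<Sum>i\<in>UNIV. dform (\<theta> i i) (cnjv (E 3 y)) (cnjv (E 1 y)) y) = lb 2 y"
  using arg_cong2[of _ _ _ _ "(+)", OF arg_cong2[of _ _ _ _ "(+)", OF
    bianchi[OF y, of 1 "E 1 y" "cnjv (E 3 y)" "cnjv (E 1 y)"]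
    bianchi[OF y, of 2 "E 2 y" "cnjv (E 3 y)" "cnjv (E 1 y)"]]
    bianchi[OF y, of 3 "E 3 y" "cnjv (E 3 y)" "cnjv (E 1 y)"]]
  by (simp add: frame_simps dd_B Bu_relations y) (simp add: field_simps, algebra)

lemma d_tau_2:
  assumes y: "y \<in> V"
  shows "dform \<tau> (cnjv (E 3 y)) (cnjv (E 1 y)) y
    = 3 * lb 2 y + (\<Sum>i\<in>UNIV. \<Sum>j\<in>UNIV. \<Sum>k\<in>UNIV. eps i j 2 * Bu i j k k y)"
  using arg_cong2[of _ _ _ _ "(+)", OF arg_cong2[of _ _ _ _ "(+)", OF arg_cong2[of _ _ _ _ "(+)", OF
    bianchi[OF y, of 1 "E 2 y" "cnjv (E 2 y)" "cnjv (E 3 y)"]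
    bianchi[OF y, of 2 "E 2 y" "cnjv (E 3 y)" "cnjv (E 1 y)"]]
    bianchi[OF y, of 3 "E 2 y" "cnjv (E 1 y)" "cnjv (E 2 y)"]]
    bianchi_cnj[OF y, of 2 "cnjv (E 1 y)" "cnjv (E 2 y)" "cnjv (E 3 y)"]]
  by (simp add: frame_simps dd_B Bu_relations y) (simp add: field_simps, algebra)

lemma trace_curvature_3:
  assumes y: "y \<in> V"
  shows "(\<Sum>i\<in>UNIV. dform (\<theta> i i) (cnjv (E 1 y)) (cnjv (E 2 y)) y) = lb 3 y"
  using arg_cong2[of _ _ _ _ "(+)", OF arg_cong2[of _ _ _ _ "(+)", OF
    bianchi[OF y, of 1 "E 1 y" "cnjv (E 1 y)" "cnjv (E 2 y)"]
    bianchi[OF y, of 2 "E 2 y" "cnjv (E 1 y)" "cnjv (E 2 y)"]]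
    bianchi[OF y, of 3 "E 3 y" "cnjv (E 1 y)" "cnjv (E 2 y)"]]
  by (simp add: frame_simps dd_B Bu_relations y) (simp add: field_simps, algebra)

lemma d_tau_3:
  assumes y: "y \<in> V"
  shows "dform \<tau> (cnjv (E 1 y)) (cnjv (E 2 y)) y
    = 3 * lb 3 y + (\<Sum>i\<in>UNIV. \<Sum>j\<in>UNIV. \<Sum>k\<in>UNIV. eps i j 3 * Bu i j k k y)"
  using arg_cong2[of _ _ _ _ "(+)", OF arg_cong2[of _ _ _ _ "(+)", OF arg_cong2[of _ _ _ _ "(+)", OF
    bianchi[OF y, of 1 "E 3 y" "cnjv (E 2 y)" "cnjv (E 3 y)"]
    bianchi[OF y, of 2 "E 3 y" "cnjv (E 3 y)" "cnjv (E 1 y)"]]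
    bianchi[OF y, of 3 "E 3 y" "cnjv (E 1 y)" "cnjv (E 2 y)"]]
    bianchi_cnj[OF y, of 3 "cnjv (E 1 y)" "cnjv (E 2 y)" "cnjv (E 3 y)"]]
  by (simp add: frame_simps dd_B Bu_relations y) (simp add: field_simps, algebra)

text \<open>The connection form acting on \<lambda>, that is,
  \<open>D\<lambda> = d\<lambda> - \<lambda> \<sigma>\<close>.\<close>

definition "\<sigma> j y = 2 * \<tau> j y - (\<Sum>i\<in>UNIV. \<theta> i i j y)" for j y

lemma smooth_\<sigma>: "smooth_on V (\<sigma> j)"
  unfolding \<sigma>_def[abs_def]
  by (intro smooth_on_diff[OF V] smooth_on_mult[OF V] smooth_on_sum[OF V] smooths smooth_on_const)

lemma ev_\<sigma>: "ev \<sigma> Z y = 2 * ev \<tau> Z y - (\<Sum>i\<in>UNIV. ev (\<theta> i i) Z y)"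
  unfolding contract1_form[symmetric] \<sigma>_def by (simp only: contract1_simps contract1_sum)

lemma dform_\<sigma>:
  assumes y: "y \<in> V"
  shows "dform \<sigma> X Y y = 2 * dform \<tau> X Y y - (\<Sum>i\<in>UNIV. dform (\<theta> i i) X Y y)"
proof -
  note s = smooth_on_ev_const[OF V] smooth_\<tau> smooth_\<theta> smooth_on_mult[OF V] smooth_on_sum[OF V]
  have "dd X (ev \<sigma> Z) y = 2 * dd X (ev \<tau> Z) y - (\<Sum>i\<in>UNIV. dd X (ev (\<theta> i i) Z) y)" for X Z
    unfolding ev_\<sigma>[abs_def]
    by (simp add: s dd_diff[OF V _ _ y] dd_cmult[OF _ y] dd_sum[OF V _ y])
  then show ?thesis by (simp add: dform_def sum_subtractf)
qed

lemma dd_lam_\<sigma>: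
  assumes y: "y \<in> V"
  shows "dd Z lam y = lam y * ev \<sigma> Z y + (\<Sum>l\<in>UNIV. lb l y * ev (\<alpha> l) Z y)"
  unfolding dd_lam[OF y] ev_\<sigma> by (simp add: lu_zero[OF y])

lemma lb_eq:
  assumes y: "y \<in> V"
  shows "lb l y = dd (E l y) lam y - lam y * ev \<sigma> (E l y) y"
  by (simp add: dd_lam_\<sigma>[OF y] dual[OF y] if_distrib[of "(*) _"] cong: if_cong)

lemma smooth_lb: "smooth_on V (lb l)"
  by (rule smooth_on_cong[OF V _ lb_eq[symmetric]])
     (intro smooth_on_diff[OF V] smooth_on_mult[OF V] smooth_on_dd[OF V] smooth_on_ev[OF V] smooth_E smooth_\<sigma> smooths)

lemma smooth_Bu: "smooth_on V (Bu i j k l)"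
  by (rule smooth_on_cong[OF V _ dd_B_Bu[symmetric]])
     (intro smooth_on_diff[OF V] smooth_on_add[OF V] smooth_on_sum[OF V] smooth_on_mult[OF V] smooth_on_dd[OF V]
       smooth_on_ev[OF V] smooths, auto simp: smooth_on_cnj[OF V smooth_E])

text \<open>On two (0,1)-vectors the product of the derivative of \<lambda> with
  \<open>\<sigma>\<close> reduces to \<lambda> times \<open>\<sigma> \<and> \<sigma> = 0\<close>,
  and \<open>lb\<close> enters only through \<open>d\<alpha>\<^sub>l\<close>, whose value there is
  \<open>lam y * eps l p q\<close>. Hence \<lambda> factors out of the whole identity.\<close>

lemma d_squared_lam:
  assumes y: "y \<in> V"
  shows "lam y * (dform \<sigma> (cnjv (E p y)) (cnjv (E q y)) y + (\<Sum>l\<in>UNIV. lb l y * eps l p q)) = 0"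
proof -
  let ?X = "cnjv (E p y)" and ?Y = "cnjv (E q y)"
  note s = smooth_lb smooth_on_ev_const[OF V] smooth_\<sigma> smooths smooth_on_mult[OF V] smooth_on_sum[OF V] smooth_on_add[OF V]
  have "dd X (dd Y lam) y = dd X (\<lambda>y. lam y * ev \<sigma> Y y + (\<Sum>l\<in>UNIV. lb l y * ev (\<alpha> l) Y y)) y" for X Y
    by (rule dd_cong[OF V _ y, symmetric]) (simp_all add: s dd_lam_\<sigma>)
  then have e: "dd X (dd Y lam) y = lam y * dd X (ev \<sigma> Y) y + dd X lam y * ev \<sigma> Y y
      + (\<Sum>l\<in>UNIV. lb l y * dd X (ev (\<alpha> l) Y) y + dd X (lb l) y * ev (\<alpha> l) Y y)" for X Y
    by (simp add: s dd_add[OF _ _ y] dd_mult[OF _ _ y] dd_sum[OF V _ y])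
  have d: "dform (\<alpha> l) ?X ?Y y = lam y * eps l p q" for l
    using exhaust_3[of l] exhaust_3[of p] exhaust_3[of q]
    by (auto simp: dform_\<alpha> dual dual_cnj dual_conj wv_def sum_3 eps_def y)
  have "0 = lam y * dform \<sigma> ?X ?Y y + (\<Sum>l\<in>UNIV. lb l y * dform (\<alpha> l) ?X ?Y y)"
    using dd_commute[OF V smooth_lam y, of ?X ?Y] unfolding e
    by (simp add: dd_lam_\<sigma>[OF y] dual_cnj[OF y] dform_def algebra_simps sum_subtractf)
  then show ?thesis unfolding d by (simp add: algebra_simps sum_distrib_left)
qed

text \<open>The origin of the factor 1/3: with S for the triple sum, the (0,2)-parts are
  \<open>3 lb + S\<close> for \<open>d\<tau>\<close> and \<open>lb\<close> for the trace of
  \<open>d\<theta>\<close>. The bracket in \<open>d_squared_lam\<close> is therefore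
  \<open>2 (3 lb + S) - lb + lb\<close>, twice \<open>3 lb + S\<close>.\<close>

lemma lam_times_second_order:
  assumes y: "y \<in> V"
  shows "lam y * (lb l y + 1/3 * (\<Sum>i\<in>UNIV. \<Sum>j\<in>UNIV. \<Sum>k\<in>UNIV. eps i j l * Bu i j k k y)) = 0"
proof -
  have "lam y * (3 * lb l y + (\<Sum>i\<in>UNIV. \<Sum>j\<in>UNIV. \<Sum>k\<in>UNIV. eps i j l * Bu i j k k y)) = 0" (is "lam y * ?A = 0")
  proof -
    have 1: "lam y * (3 * lb 1 y + (\<Sum>i\<in>UNIV. \<Sum>j\<in>UNIV. \<Sum>k\<in>UNIV. eps i j 1 * Bu i j k k y)) = 0"
      using d_squared_lam[OF y, of 2 3] unfolding dform_\<sigma>[OF y] trace_curvature_1[OF y] d_tau_1[OF y, symmetric]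
      by (simp add: sum_3 eps_def)
    have 2: "lam y * (3 * lb 2 y + (\<Sum>i\<in>UNIV. \<Sum>j\<in>UNIV. \<Sum>k\<in>UNIV. eps i j 2 * Bu i j k k y)) = 0"
      using d_squared_lam[OF y, of 3 1] unfolding dform_\<sigma>[OF y] trace_curvature_2[OF y] d_tau_2[OF y, symmetric]
      by (simp add: sum_3 eps_def)
    have 3: "lam y * (3 * lb 3 y + (\<Sum>i\<in>UNIV. \<Sum>j\<in>UNIV. \<Sum>k\<in>UNIV. eps i j 3 * Bu i j k k y)) = 0"
      using d_squared_lam[OF y, of 1 2] unfolding dform_\<sigma>[OF y] trace_curvature_3[OF y] d_tau_3[OF y, symmetric]
      by (simp add: sum_3 eps_def)
    from exhaust_3[of l] show ?thesis by (elim disjE) (simp_all only: 1 2 3)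
  qed
  moreover have "lb l y + 1/3 * (\<Sum>i\<in>UNIV. \<Sum>j\<in>UNIV. \<Sum>k\<in>UNIV. eps i j l * Bu i j k k y) = ?A / 3"
    by (simp add: field_simps)
  ultimately show ?thesis by (simp only: times_divide_eq_right div_0)
qed

end

section \<open>Unique continuation\<close>

lemma max_second_derivative:
  fixes q :: "'a::euclidean_space \<Rightarrow> real"
  assumes U: "open U" "x \<in> U" and q: "smooth_on U q" and max: "\<And>y. y \<in> U \<Longrightarrow> q y \<le> q x"
  shows "frechet_derivative (\<lambda>y. frechet_derivative q (at y) p) (at x) p \<le> 0"
proof (rule ccontr)
  let ?D = "\<lambda>y. frechet_derivative q (at y) p"
  assume "\<not> ?thesis"
  then have pos: "frechet_derivative ?D (at x) p > 0" by simp
  have zero: "?D x = 0"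
    using differential_zero_maxmin[OF U(2,1) frechet_derivative_works[THEN iffD1, OF smooth_on_differentiable[OF q U(2)]]]
      max by (metis (no_types, lifting))
  have cont: "isCont (\<lambda>t. x + t *\<^sub>R p) 0" by (intro continuous_intros)
  have "\<forall>\<^sub>F t in nhds (0::real). x + t *\<^sub>R p \<in> U"
    using cont U unfolding continuous_at_open eventually_nhds by (metis add.right_neutral scaleR_zero_left)
  then obtain d1 where d1: "d1 > 0" "\<And>t. \<bar>t\<bar> < d1 \<Longrightarrow> x + t *\<^sub>R p \<in> U"
    unfolding eventually_nhds_metric by (auto simp: dist_real_def)
  have "((\<lambda>t. ?D (x + t *\<^sub>R p)) has_real_derivative frechet_derivative ?D (at (x + 0 *\<^sub>R p)) p) (at 0)"
    using U by (intro line_derivative smooth_on_differentiable[OF smooth_on_frechet[OF q]]) simp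
  then obtain d2 where d2: "d2 > 0" "\<And>t. t > 0 \<Longrightarrow> t < d2 \<Longrightarrow> ?D (x + t *\<^sub>R p) > 0"
    using DERIV_pos_inc_right[of "\<lambda>t. ?D (x + t *\<^sub>R p)" _ 0] pos zero by auto
  define t where "t = min d1 d2 / 2"
  have t: "t > 0" "t < d1" "t < d2" using d1 d2 by (auto simp: t_def)
  have "\<exists>z>0. z < t \<and> q (x + t *\<^sub>R p) - q (x + 0 *\<^sub>R p) = (t - 0) * ?D (x + z *\<^sub>R p)"
    by (rule MVT2[OF t(1)]) (use t d1 in \<open>auto intro!: line_derivative smooth_on_differentiable[OF q]\<close>)
  then obtain z where "0 < z" "z < t" "q (x + t *\<^sub>R p) - q x = t * ?D (x + z *\<^sub>R p)" by auto
  then have "q (x + t *\<^sub>R p) > q x" using d2(2)[of z] t by (smt (verit) mult_pos_pos)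
  then show False using max[of "x + t *\<^sub>R p"] d1(2)[of t] t by auto
qed

definition cv :: "real^6 \<Rightarrow> complex^6" where
  "cv a = (\<chi> j. of_real (a $ j))"

lemma dd_cv:
  assumes "f differentiable (at y)"
  shows "dd (cv a) f y = frechet_derivative f (at y) a"
  by (subst linear_axis_sum[OF linear_frechet_derivative[OF assms]]) (simp add: dd_def pd_def cv_def scaleR_conv_of_real)

lemma complex_vector_split: "z = cv (\<chi> j. Re (z $ j)) + \<i> *s cv (\<chi> j. Im (z $ j))"
  by (simp add: vec_eq_iff cv_def complex_eq)

lemma cnjv_split: "cnjv z = cv (\<chi> j. Re (z $ j)) - \<i> *s cv (\<chi> j. Im (z $ j))"
  by (simp add: vec_eq_iff cv_def complex_eq_iff)

text \<open>For \<open>z = a + \<i> b\<close> with real vectors \<open>a\<close> and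
  \<open>b\<close>, the mixed terms cancel by symmetry, and the second derivative along
  \<open>z\<close> and its conjugate is the sum of the real second derivatives along
  \<open>a\<close> and \<open>b\<close>, each nonpositive at a maximum.\<close>

lemma max_complex_hessian:
  fixes q :: "real^6 \<Rightarrow> real"
  assumes U: "open U" "x \<in> U" and q: "smooth_on U q" and max: "\<And>y. y \<in> U \<Longrightarrow> q y \<le> q x"
  shows "Re (dd z (dd (cnjv z) (\<lambda>y. complex_of_real (q y))) x) \<le> 0"
proof -
  let ?Q = "\<lambda>y. complex_of_real (q y)"
  have Q: "smooth_on U ?Q" by (rule smooth_on_of_real[OF U(1) q])
  define a where "a = cv (\<chi> j. Re (z $ j))"
  define b where "b = cv (\<chi> j. Im (z $ j))"
  have zab: "z = a + \<i> *s b" "cnjv z = a - \<i> *s b"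
    unfolding a_def b_def by (rule complex_vector_split, rule cnjv_split)
  have s: "smooth_on U (dd w ?Q)" for w by (rule smooth_on_dd_const[OF U(1) Q])
  have 1: "dd (cnjv z) ?Q = (\<lambda>y. dd a ?Q y - \<i> * dd b ?Q y)"
    unfolding zab(2) by (simp add: dd_linear fun_eq_iff)
  have 2: "dd w (dd (cnjv z) ?Q) x = dd w (dd a ?Q) x - \<i> * dd w (dd b ?Q) x" for w
    unfolding 1 using s U by (simp add: dd_diff[OF U(1) _ _ U(2)] dd_cmult[OF s U(2)] smooth_on_mult)
  have 3: "dd z (dd (cnjv z) ?Q) x = dd a (dd a ?Q) x + dd b (dd b ?Q) x"
    unfolding 2 unfolding zab(1) dd_linear
    by (simp add: dd_commute[OF U(1) Q U(2), of a b] algebra_simps)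
  have 4: "dd (cv p) (dd (cv p) ?Q) x = of_real (frechet_derivative (\<lambda>y. frechet_derivative q (at y) p) (at x) p)" for p
  proof -
    have "dd (cv p) ?Q y = of_real (frechet_derivative q (at y) p)" if "y \<in> U" for y
      using dd_cv[OF smooth_on_differentiable[OF Q that]]
        frechet_derivative_bounded_linear[OF bounded_linear_of_real smooth_on_differentiable[OF q that]] by simp
    then have "dd (cv p) (dd (cv p) ?Q) x = dd (cv p) (\<lambda>y. of_real (frechet_derivative q (at y) p)) x"
      by (rule dd_cong[OF U(1) s U(2)])
    also have "\<dots> = frechet_derivative (\<lambda>y. of_real (frechet_derivative q (at y) p)) (at x) p"
      by (rule dd_cv[OF smooth_on_differentiable[OF smooth_on_of_real[OF U(1) smooth_on_frechet[OF q]] U(2)]])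
    also have "\<dots> = of_real (frechet_derivative (\<lambda>y. frechet_derivative q (at y) p) (at x) p)"
      by (rule frechet_derivative_bounded_linear[OF bounded_linear_of_real
            smooth_on_differentiable[OF smooth_on_frechet[OF q] U(2)]])
    finally show ?thesis .
  qed
  show ?thesis unfolding 3 a_def b_def 4 using max_second_derivative[OF U q max] by (simp add: add_nonpos_nonpos)
qed

lemma max_complex_gradient:
  fixes q :: "real^6 \<Rightarrow> real"
  assumes U: "open U" "x \<in> U" and q: "smooth_on U q" and max: "\<And>y. y \<in> U \<Longrightarrow> q y \<le> q x"
  shows "dd z (\<lambda>y. complex_of_real (q y)) x = 0"
proof -
  have "frechet_derivative q (at x) = (\<lambda>v. 0)"
    using differential_zero_maxmin[OF U(2,1) frechet_derivative_works[THEN iffD1, OF smooth_on_differentiable[OF q U(2)]]]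
      max by blast
  then have "pd j (\<lambda>y. complex_of_real (q y)) x = 0" for j
    unfolding pd_def frechet_derivative_bounded_linear[OF bounded_linear_of_real smooth_on_differentiable[OF q U(2)]]
    by simp
  then show ?thesis by (simp add: dd_def)
qed

lemma continuous_on_compact_abs_bound:
  fixes f :: "'a::topological_space \<Rightarrow> real"
  assumes "compact K" "continuous_on K f"
  shows "\<exists>M. \<forall>y\<in>K. \<bar>f y\<bar> \<le> M"
  using compact_imp_bounded[OF compact_continuous_image[OF assms(2,1)]] unfolding bounded_iff by auto

section \<open>Exponential weights and the Gaussian barrier\<close>

lemma dd_exp:
  assumes "open V" "smooth_on V u" "y \<in> V"
  shows "dd z (\<lambda>y. of_real (exp (k * u y))) y
    = of_real (exp (k * u y)) * (of_real k * dd z (\<lambda>y. of_real (u y)) y)"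
proof -
  have ku: "(\<lambda>y. k * u y) differentiable (at y)"
    using assms by (intro smooth_on_differentiable[of V] smooth_on_mult smooth_on_const)
  have e: "frechet_derivative exp (at r) = (*) (exp r)" for r :: real
    by (rule frechet_derivative_at[symmetric]) (rule has_field_derivative_imp_has_derivative[OF DERIV_exp])
  have ed: "(exp :: real \<Rightarrow> real) differentiable (at r)" for r
    by (rule differentiableI) (rule has_field_derivative_imp_has_derivative[OF DERIV_exp])
  have uk: "frechet_derivative (\<lambda>y. k * u y) (at y) h = k * frechet_derivative u (at y) h" for h
    by (rule frechet_derivative_bounded_linear[OF bounded_linear_mult_right smooth_on_differentiable[OF assms(2,3)]])
  have se: "smooth_on V (\<lambda>y. exp (k * u y))"
    by (rule smooth_on_compose[OF assms(1) open_UNIV _ smooth_on_exp])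
       (use assms in \<open>auto intro!: smooth_on_mult\<close>)
  have "pd j (\<lambda>y. of_real (exp (k * u y))) y = of_real (exp (k * u y)) * (of_real k * pd j (\<lambda>y. of_real (u y)) y)" for j
    unfolding pd_def
      frechet_derivative_bounded_linear[OF bounded_linear_of_real smooth_on_differentiable[OF se assms(3)]]
      frechet_derivative_bounded_linear[OF bounded_linear_of_real smooth_on_differentiable[OF assms(2,3)]]
      frechet_derivative_chain[OF ku ed] e uk by simp
  then show ?thesis by (simp add: dd_def sum_distrib_left ac_simps)
qed

lemma smooth_on_sqdist: "smooth_on UNIV (\<lambda>y::real^6. (y - c) \<bullet> (y - c))"
  by (intro smooth_on_inner smooth_on_diff open_UNIV smooth_on_id smooth_on_const)

lemma dd_sqdist: "dd z (\<lambda>y. of_real ((y - c) \<bullet> (y - c))) y = 2 * (\<Sum>j\<in>UNIV. z $ j * of_real ((y - c) $ j))"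
proof -
  have d: "((\<lambda>y::real^6. y - c) has_derivative (\<lambda>h. h)) (at y)" by (auto intro!: derivative_eq_intros)
  have fd: "frechet_derivative (\<lambda>y::real^6. y - c) (at y) = (\<lambda>h. h)"
    by (rule frechet_derivative_at[OF d, symmetric])
  have "pd j (\<lambda>y. of_real ((y - c) \<bullet> (y - c))) y = 2 * of_real ((y - c) $ j)" for j
    unfolding pd_def
      frechet_derivative_bounded_linear[OF bounded_linear_of_real smooth_on_differentiable[OF smooth_on_sqdist UNIV_I]]
      frechet_derivative_bilinear[OF bounded_bilinear_inner differentiableI[OF d] differentiableI[OF d]] fd
    by (simp add: inner_axis inner_commute[of "axis j 1"])
  then show ?thesis by (simp add: dd_def sum_distrib_left ac_simps)
qed

lemma smooth_on_gauss:
  fixes c :: "real^6"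
  shows "smooth_on UNIV (\<lambda>y. exp (- s * ((y - c) \<bullet> (y - c))))"
proof (rule smooth_on_compose[OF open_UNIV open_UNIV _ smooth_on_exp])
  show "smooth_on UNIV (\<lambda>y. - s * ((y - c) \<bullet> (y - c)))"
    by (intro smooth_on_mult[OF open_UNIV] smooth_on_const smooth_on_sqdist)
qed simp

section \<open>Maximum principle for the weighted modulus of \<lambda>\<close>

context structure_on begin

lemma frame_expansion:
  assumes y: "y \<in> V"
  shows "w = (\<Sum>a\<in>UNIV. ev (\<alpha> a) w y *s E a y) + (\<Sum>a\<in>UNIV. ev (cnjf (\<alpha> a)) w y *s cnjv (E a y))"
proof -
  have "w = (\<Sum>j\<in>UNIV. w $ j *s axis j 1)" by (simp add: basis_expansion)
  also have "\<dots> = (\<Sum>j\<in>UNIV. \<Sum>a\<in>UNIV. (w $ j * \<alpha> a j y) *s E a y)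
      + (\<Sum>j\<in>UNIV. \<Sum>a\<in>UNIV. (w $ j * cnj (\<alpha> a j y)) *s cnjv (E a y))"
    unfolding complete[OF y]
    by (simp add: vec.scale_right_distrib vec.scale_sum_right sum.distrib)
  also have "\<dots> = (\<Sum>a\<in>UNIV. \<Sum>j\<in>UNIV. (w $ j * \<alpha> a j y) *s E a y)
      + (\<Sum>a\<in>UNIV. \<Sum>j\<in>UNIV. (w $ j * cnj (\<alpha> a j y)) *s cnjv (E a y))"
    by (subst (1 2) sum.swap) (rule refl)
  finally show ?thesis by (simp add: ev_def cnjf_def vec.scale_sum_left)
qed

text \<open>At the maximum all first derivatives of \<open>g\<close> are determined by the coefficients \<open>t\<close>, and the
  terms of the complex Hessian of \<open>|g|\<^sup>2\<close> that are quadratic in \<open>t\<close> cancel.\<close>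

lemma max_modulus_condition:
  assumes x: "x \<in> U" "open U" "U \<subseteq> V" and g: "smooth_on V g" and t: "\<And>a. smooth_on V (t a)"
    and eq: "\<And>a y. y \<in> V \<Longrightarrow> dd (cnjv (E a y)) g y = t a y * g y"
    and max: "\<And>y. y \<in> U \<Longrightarrow> (cmod (g y))\<^sup>2 \<le> (cmod (g x))\<^sup>2" and nz: "g x \<noteq> 0"
    and w: "w = (\<chi> j. dd (E a x) (\<lambda>y. cnjv (E a y) $ j) x)"
  shows "Re (dd (E a x) (t a) x)
    \<le> Re (\<Sum>b\<in>UNIV. ev (cnjf (\<alpha> b)) w x * t b x - ev (\<alpha> b) w x * cnj (t b x))"
proof -
  have xV: "x \<in> V" using x by blast
  define Q where "Q = (\<lambda>y. g y * cnj (g y))"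
  have gU: "smooth_on U g" by (rule smooth_on_subset[OF g x(3)])
  have "smooth_on U (\<lambda>y. Re (g y * cnj (g y)))"
    by (intro smooth_on_Re[OF x(2)] smooth_on_mult[OF x(2)] smooth_on_cnj[OF x(2)] gU)
  moreover have "Re (g y * cnj (g y)) = (cmod (g y))\<^sup>2" for y
    by (simp add: complex_norm_square[symmetric] del: of_real_power)
  ultimately have q: "smooth_on U (\<lambda>y. (cmod (g y))\<^sup>2)" by (simp only:)
  have Qq: "Q = (\<lambda>y. complex_of_real ((cmod (g y))\<^sup>2))"
    unfolding Q_def by (rule ext) (rule complex_norm_square[symmetric])
  have cg: "smooth_on V (\<lambda>y. cnj (g y))" by (rule smooth_on_cnj[OF V g])
  have dQ: "dd z Q y = g y * cnj (dd (cnjv z) g y) + dd z g y * cnj (g y)" if "y \<in> V" for z y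
    unfolding Q_def dd_mult[OF g cg that] by (simp add: dd_cnj[OF g that])
  have grad: "dd (E b x) g x = - cnj (t b x) * g x" for b
  proof -
    have "dd (E b x) Q x = 0" unfolding Qq by (rule max_complex_gradient[OF x(2,1) q max])
    then have "cnj (g x) * (dd (E b x) g x + cnj (t b x) * g x) = 0"
      unfolding dQ[OF xV] eq[OF xV] by (simp add: algebra_simps)
    then show ?thesis using nz by (simp add: add_eq_0_iff)
  qed
  let ?e = "E a x" and ?eb = "cnjv (E a x)"
  define K where "K = dd ?e (dd ?eb g) x"
  note sg = smooth_on_dd_const[OF V g]
  have "dd ?e (dd ?eb Q) x = dd ?e (\<lambda>y. g y * cnj (dd ?e g y) + dd ?eb g y * cnj (g y)) x"
  proof (rule dd_cong[OF V _ xV])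
    show "smooth_on V (dd ?eb Q)"
      unfolding Q_def by (intro smooth_on_dd_const[OF V] smooth_on_mult[OF V] g cg)
  qed (simp add: dQ)
  also have "\<dots> = g x * cnj (dd ?eb (dd ?e g) x) + dd ?e g x * cnj (dd ?e g x)
      + (dd ?eb g x * cnj (dd ?eb g x) + K * cnj (g x))"
    using sg g cg smooth_on_cnj[OF V sg]
    by (simp add: dd_add[OF _ _ xV] dd_mult[OF _ _ xV] smooth_on_mult[OF V] dd_cnj[OF _ xV] K_def)
  also have "dd ?eb (dd ?e g) x = K" unfolding K_def by (rule dd_commute[OF V g xV])
  finally have hess: "dd ?e (dd ?eb Q) x = g x * cnj K + cnj (g x) * K
      + 2 * (t a x * cnj (t a x)) * (g x * cnj (g x))"
    unfolding grad eq[OF xV] by (simp add: algebra_simps)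
  have dw: "dd w g x = - g x * (\<Sum>b\<in>UNIV. ev (\<alpha> b) w x * cnj (t b x) - ev (cnjf (\<alpha> b)) w x * t b x)"
    by (subst frame_expansion[OF xV, of w])
       (simp add: dd_linear grad eq[OF xV] sum_distrib_left sum_subtractf right_diff_distrib ac_simps sum_negf)
  have sEb: "smooth_on V (\<lambda>y. cnjv (E a y) $ j)" for j
    by (simp add: smooth_on_cnj[OF V smooth_E])
  \<comment> \<open>The field \<open>cnjv (E a y)\<close> varies with \<open>y\<close>, so
    differentiating the first-order equation for \<open>g\<close> yields, besides the second
    derivative \<open>K\<close> in frozen directions, the derivative of \<open>g\<close> along
    \<open>w\<close>.\<close>
  have "dd ?e (\<lambda>y. dd (cnjv (E a y)) g y) x = dd ?e (\<lambda>y. t a y * g y) x"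
    by (rule dd_cong[OF V smooth_on_dd[OF V g sEb] xV]) (rule eq)
  then have "K + dd w g x = t a x * (- cnj (t a x) * g x) + dd ?e (t a) x * g x"
    unfolding dd_dd_field[OF V g sEb xV] K_def w by (simp add: dd_mult[OF t g xV] grad)
  then have K: "K = g x * (dd ?e (t a) x - t a x * cnj (t a x)
      + (\<Sum>b\<in>UNIV. ev (\<alpha> b) w x * cnj (t b x) - ev (cnjf (\<alpha> b)) w x * t b x))"
    unfolding dw by (simp add: algebra_simps)
  define S where "S = (\<Sum>b\<in>UNIV. ev (\<alpha> b) w x * cnj (t b x) - ev (cnjf (\<alpha> b)) w x * t b x)"
  have "dd ?e (dd ?eb Q) x = (g x * cnj (g x)) * (dd ?e (t a) x + S + cnj (dd ?e (t a) x + S))"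
    unfolding hess K S_def[symmetric] by (simp add: algebra_simps)
  also have "\<dots> = of_real ((cmod (g x))\<^sup>2 * (2 * Re (dd ?e (t a) x + S)))"
    by (simp only: complex_norm_square[symmetric] complex_add_cnj of_real_mult)
  finally have "Re (dd ?e (dd ?eb Q) x) = (cmod (g x))\<^sup>2 * (2 * Re (dd ?e (t a) x + S))" by simp
  moreover have "Re (dd ?e (dd ?eb Q) x) \<le> 0"
    unfolding Qq by (rule max_complex_hessian[OF x(2,1) q max])
  ultimately have "(cmod (g x))\<^sup>2 * (2 * Re (dd ?e (t a) x + S)) \<le> 0" by simp
  then have "Re (dd ?e (t a) x + S) \<le> 0"
    using nz by (simp add: mult_le_0_iff)
  moreover have "(\<Sum>b\<in>UNIV. ev (cnjf (\<alpha> b)) w x * t b x - ev (\<alpha> b) w x * cnj (t b x)) = - S"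
    unfolding S_def by (simp add: sum_subtractf)
  ultimately show ?thesis by simp
qed

text \<open>Half the derivative of the squared distance to \<open>c\<close> along the conjugate of
  \<open>E a y\<close>.\<close>

definition "radial c a y = (\<Sum>j\<in>UNIV. cnj (E a y $ j) * of_real ((y - c) $ j))" for c a y

text \<open>The coordinate derivative of the conjugate frame vector along \<open>E a x\<close>. It
  produces the first-order terms due to the variation of the frame.\<close>

definition "frame_div a x = (\<chi> j. dd (E a x) (\<lambda>y. cnjv (E a y) $ j) x)" for a x

text \<open>The logarithmic derivative of \<open>g\<close> along \<open>frame_div a x\<close> at a
  maximum of its modulus with \<open>g x\<close> nonzero, when \<open>f b x\<close> is the
  logarithmic derivative of \<open>g\<close> along the conjugate of \<open>E b x\<close>. It is
  real-linear in \<open>f\<close>, so the contributions of \<lambda> and of the weight can be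
  separated.\<close>

definition "bracket_term a f x = (\<Sum>b\<in>UNIV. ev (cnjf (\<alpha> b)) (frame_div a x) x * f b x
    - ev (\<alpha> b) (frame_div a x) x * cnj (f b x))" for a f x

definition "\<sigma>b a y = ev \<sigma> (cnjv (E a y)) y" for a y

text \<open>The contribution of \<lambda> alone to the condition at a maximum; \<open>coeff1\<close>
  below collects the lower-order contributions of the Gaussian weight.\<close>

definition "coeff0 x = (\<Sum>a\<in>UNIV. Re (dd (E a x) (\<sigma>b a) x) - Re (bracket_term a \<sigma>b x))" for x

definition "coeff1 c x = (\<Sum>a\<in>UNIV. Re (dd (E a x) (radial c a) x) - Re (bracket_term a (radial c) x))" for c x

text \<open>Up to sign, the principal symbol of the sum of the operators \<open>E\<^sub>a\<close>
  conj \<open>E\<^sub>a\<close> at the covector \<open>x - c\<close>.\<close>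

definition "symbol c x = (\<Sum>a\<in>UNIV. (cmod (radial c a x))\<^sup>2)" for c x

lemma smooth_Eb: "smooth_on V (\<lambda>y. cnjv (E a y) $ j)"
  by (simp add: smooth_on_cnj[OF V smooth_E])

lemma smooth_\<sigma>b: "smooth_on V (\<sigma>b a)"
  unfolding \<sigma>b_def[abs_def] by (intro smooth_on_ev[OF V] smooth_\<sigma> smooth_Eb)

lemma smooth_radial: "smooth_on V (radial c a)"
proof -
  have "smooth_on V (\<lambda>y::real^6. (y - c) $ j)" for j
    by (intro smooth_on_vec_nth[OF V] smooth_on_diff[OF V] smooth_on_id smooth_on_const)
  then show ?thesis unfolding radial_def[abs_def]
    by (intro smooth_on_sum[OF V] smooth_on_mult[OF V] smooth_on_cnj[OF V] smooth_E smooth_on_of_real[OF V])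
qed

lemma smooth_bracket_term:
  assumes "\<And>b. smooth_on V (f b)"
  shows "smooth_on V (bracket_term a f)"
proof -
  have "smooth_on V (\<lambda>x. frame_div a x $ j)" for j
  proof -
    have "smooth_on V (\<lambda>x. dd (E a x) (\<lambda>y. cnjv (E a y) $ j) x)"
      by (intro smooth_on_dd[OF V] smooth_Eb smooth_E)
    then show ?thesis by (simp only: frame_div_def vec_lambda_beta)
  qed
  then show ?thesis unfolding bracket_term_def[abs_def]
    by (intro smooth_on_sum[OF V] smooth_on_diff[OF V] smooth_on_mult[OF V] smooth_on_ev[OF V]
        smooth_on_cnj[OF V] smooths assms)
qed

lemma continuous_coeffs:
  "continuous_on V coeff0" "continuous_on V (coeff1 c)" "continuous_on V (symbol c)"
proof -
  have "smooth_on V coeff0" unfolding coeff0_def[abs_def]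
    by (intro smooth_on_sum[OF V] smooth_on_diff[OF V] smooth_on_Re[OF V] smooth_on_dd[OF V] smooth_E
        smooth_\<sigma>b smooth_bracket_term)
  then show "continuous_on V coeff0" by (rule smooth_on_continuous)
  have "smooth_on V (coeff1 c)" unfolding coeff1_def[abs_def]
    by (intro smooth_on_sum[OF V] smooth_on_diff[OF V] smooth_on_Re[OF V] smooth_on_dd[OF V] smooth_E
        smooth_radial smooth_bracket_term)
  then show "continuous_on V (coeff1 c)" by (rule smooth_on_continuous)
  show "continuous_on V (symbol c)" unfolding symbol_def[abs_def]
    by (intro continuous_intros smooth_on_continuous smooth_radial)
qed

text \<open>Ellipticity: a real covector that vanishes on every conjugate frame vector also vanishes
  on the frame itself, and together these vectors span.\<close>

lemma symbol_pos:
  assumes y: "y \<in> V" "y \<noteq> c"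
  shows "symbol c y > 0"
proof (rule ccontr)
  assume "\<not> ?thesis"
  then have "symbol c y = 0" unfolding symbol_def by (metis order_antisym not_le sum_nonneg zero_le_power2)
  then have r: "radial c a y = 0" for a
    unfolding symbol_def by (subst (asm) sum_nonneg_eq_0_iff) auto
  have "(y - c) $ k = 0" for k
  proof -
    define N :: coeff_form where "N = (\<lambda>j y. of_real ((y - c) $ j))"
    let ?p = "\<lambda>z. ev N z y"
    have p0: "?p (cnjv (E a y)) = 0" for a using r[of a] by (simp add: radial_def ev_def N_def)
    have p1: "?p (E a y) = 0" for a
    proof -
      have "?p (E a y) = cnj (radial c a y)" by (simp add: radial_def ev_def N_def)
      then show ?thesis using r by simp
    qed
    have "?p (axis k 1) = 0"
      unfolding complete[OF y(1)] ev_linear p0 p1 by simp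
    moreover have "?p (axis k 1) = of_real ((y - c) $ k)"
    proof -
      have "?p (axis k 1) = (\<Sum>j\<in>UNIV. if j = k then of_real ((y - c) $ j) else 0)"
        unfolding ev_def N_def by (rule sum.cong) (auto simp: axis_def)
      then show ?thesis by simp
    qed
    ultimately show ?thesis by simp
  qed
  then show False using y(2) by (simp add: vec_eq_iff)
qed

text \<open>Multiplication by the weight \<open>exp (t * h y)\<close> only shifts the logarithmic
  (0,1)-derivatives of \<lambda>, by \<open>- 2 * s * t * h y\<close> times \<open>radial\<close>,
  so \<open>max_modulus_condition\<close> applies to the product. Differentiating \<open>h\<close>
  once more brings a second factor \<open>- 2 * s\<close>, hence the dominant coefficient
  \<open>4 * s\<^sup>2\<close>.\<close>

lemma weighted_max_condition:
  fixes c :: "real^6" and s t :: real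
  defines "h \<equiv> \<lambda>y. exp (- s * ((y - c) \<bullet> (y - c)))"
  assumes x: "x \<in> U" "open U" "U \<subseteq> V" and nz: "lam x \<noteq> 0"
    and max: "\<And>y. y \<in> U \<Longrightarrow> (cmod (lam y))\<^sup>2 * exp (2 * t * h y) \<le> (cmod (lam x))\<^sup>2 * exp (2 * t * h x)"
  shows "coeff0 x + t * h x * (4 * s\<^sup>2 * symbol c x - 2 * s * coeff1 c x) \<le> 0"
proof -
  have xV: "x \<in> V" using x by blast
  define H where "H = (\<lambda>y. complex_of_real (h y))"
  define g where "g = (\<lambda>y. lam y * of_real (exp (t * h y)))"
  define T where "T = (\<lambda>a y. \<sigma>b a y + of_real (- 2 * s * t) * (H y * radial c a y))"
  have hU: "smooth_on V h" unfolding h_def by (rule smooth_on_subset[OF smooth_on_gauss]) simp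
  have HV: "smooth_on V H" unfolding H_def by (rule smooth_on_of_real[OF V hU])
  have eV: "smooth_on V (\<lambda>y. complex_of_real (exp (t * h y)))"
    by (rule smooth_on_of_real[OF V], rule smooth_on_compose[OF V open_UNIV _ smooth_on_exp])
       (auto intro!: smooth_on_mult[OF V] hU)
  have gV: "smooth_on V g" unfolding g_def by (intro smooth_on_mult[OF V] smooth_lam eV)
  have HP: "smooth_on V (\<lambda>y. H y * radial c a y)" for a by (intro smooth_on_mult[OF V] HV smooth_radial)
  have TV: "smooth_on V (T a)" for a unfolding T_def
    by (intro smooth_on_add[OF V] smooth_on_mult[OF V] smooth_on_const smooth_\<sigma>b HV smooth_radial)
  have dH: "dd z H y = H y * (of_real (- 2 * s) * (\<Sum>j\<in>UNIV. z $ j * of_real ((y - c) $ j)))" for z y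
    unfolding H_def h_def dd_exp[OF open_UNIV smooth_on_sqdist UNIV_I] dd_sqdist by simp
  have de: "dd z (\<lambda>y. complex_of_real (exp (t * h y))) y = of_real (exp (t * h y)) * (of_real t * dd z H y)"
    if "y \<in> V" for z y unfolding H_def by (rule dd_exp[OF V hU that])
  have eq: "dd (cnjv (E a y)) g y = T a y * g y" if y: "y \<in> V" for a y
  proof -
    have "dd (cnjv (E a y)) lam y = lam y * \<sigma>b a y"
      by (simp add: dd_lam_\<sigma>[OF y] \<sigma>b_def dual_cnj[OF y])
    moreover have "dd (cnjv (E a y)) H y = H y * (of_real (- 2 * s) * radial c a y)"
      unfolding dH radial_def by simp
    ultimately show ?thesis
      unfolding g_def T_def dd_mult[OF smooth_lam eV y] de[OF y] by (simp add: algebra_simps)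
  qed
  have norm_g: "(cmod (g y))\<^sup>2 = (cmod (lam y))\<^sup>2 * exp (2 * t * h y)" for y
    unfolding g_def by (simp add: norm_mult power_mult_distrib exp_double[symmetric] mult.assoc)
  have gnz: "g x \<noteq> 0" using nz by (simp add: g_def)
  have gmax: "(cmod (g y))\<^sup>2 \<le> (cmod (g x))\<^sup>2" if "y \<in> U" for y unfolding norm_g by (rule max[OF that])
  have main: "Re (dd (E a x) (\<sigma>b a) x) - Re (bracket_term a \<sigma>b x)
      + t * h x * (4 * s\<^sup>2 * (cmod (radial c a x))\<^sup>2
        - 2 * s * (Re (dd (E a x) (radial c a) x) - Re (bracket_term a (radial c) x))) \<le> 0" for a
  proof -
    have le: "Re (dd (E a x) (T a) x) \<le> Re (bracket_term a T x)"
      unfolding bracket_term_def by (rule max_modulus_condition[OF x gV TV eq gmax gnz frame_div_def])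
    have dHx: "dd (E a x) H x = H x * (of_real (- 2 * s) * cnj (radial c a x))"
      unfolding dH radial_def by simp
    have "dd (E a x) (T a) x = dd (E a x) (\<sigma>b a) x + of_real (- 2 * s * t) *
        (H x * dd (E a x) (radial c a) x + H x * (of_real (- 2 * s) * (radial c a x * cnj (radial c a x))))"
      unfolding T_def dd_add[OF smooth_\<sigma>b smooth_on_mult[OF V smooth_on_const HP] xV] dd_cmult[OF HP xV]
        dd_mult[OF HV smooth_radial xV] dHx by (simp add: algebra_simps)
    also have "\<dots> = dd (E a x) (\<sigma>b a) x + of_real (- 2 * s * t * h x) * dd (E a x) (radial c a) x
        + of_real (4 * s * s * t * h x * (cmod (radial c a x))\<^sup>2)"
      unfolding H_def complex_norm_square[symmetric] by (simp add: algebra_simps)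
    finally have e: "dd (E a x) (T a) x = dd (E a x) (\<sigma>b a) x + of_real (- 2 * s * t * h x) * dd (E a x) (radial c a) x
        + of_real (4 * s * s * t * h x * (cmod (radial c a x))\<^sup>2)" .
    have 1: "Re (dd (E a x) (T a) x) = Re (dd (E a x) (\<sigma>b a) x)
        - 2 * s * t * h x * (Re (dd (E a x) (radial c a) x) - 2 * s * (cmod (radial c a x))\<^sup>2)"
      unfolding e plus_complex.sel times_complex.sel Re_complex_of_real Im_complex_of_real by (simp add: algebra_simps)
    have e2: "bracket_term a T x = bracket_term a \<sigma>b x + of_real (- 2 * s * t * h x) * bracket_term a (radial c) x"
      unfolding bracket_term_def T_def H_def
      by (simp add: algebra_simps sum.distrib sum_subtractf sum_distrib_left sum_negf)
    have 2: "Re (bracket_term a T x) = Re (bracket_term a \<sigma>b x) - 2 * s * t * h x * Re (bracket_term a (radial c) x)"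
      unfolding e2 plus_complex.sel times_complex.sel Re_complex_of_real Im_complex_of_real by (simp add: algebra_simps)
    show ?thesis using le unfolding 1 2 by (simp add: algebra_simps power2_eq_square)
  qed
  have "coeff0 x + t * h x * (4 * s\<^sup>2 * symbol c x - 2 * s * coeff1 c x)
     = (\<Sum>a\<in>UNIV. Re (dd (E a x) (\<sigma>b a) x) - Re (bracket_term a \<sigma>b x)
      + t * h x * (4 * s\<^sup>2 * (cmod (radial c a x))\<^sup>2
        - 2 * s * (Re (dd (E a x) (radial c a) x) - Re (bracket_term a (radial c) x))))"
    unfolding coeff0_def coeff1_def symbol_def
    by (simp only: sum.distrib sum_subtractf sum_distrib_left right_diff_distrib)
  also have "\<dots> \<le> 0" by (rule sum_nonpos) (rule main)
  finally show ?thesis .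
qed

text \<open>
  With \<open>h(y) = exp(-s|y - c|\<^sup>2)\<close> and \<open>s\<close> large, \<open>|\<lambda>|\<^sup>2 exp(2 t h)\<close> has no interior maximum in an
  annulus around \<open>c\<close> for any large \<open>t\<close>; letting \<open>t\<close> tend to infinity forces \<open>\<lambda> = 0\<close>.
\<close>

lemma unique_continuation_ball:
  assumes r: "0 < r1" and sub: "cball c r2 \<subseteq> V"
    and zero: "\<And>y. y \<in> ball c r1 \<Longrightarrow> lam y = 0" and y1: "y1 \<in> ball c r2"
  shows "lam y1 = 0"
proof (rule ccontr)
  assume nz: "lam y1 \<noteq> 0"
  \<comment> \<open>With the inner radius halved, \<lambda> vanishes on a neighbourhood of the inner
    sphere, so a point where \<lambda> is nonzero cannot lie on that sphere. The centre, where
    \<open>symbol\<close> degenerates, is removed.\<close>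
  define K where "K = cball c r2 - ball c (r1 / 2)"
  have K: "compact K" "K \<subseteq> V" unfolding K_def using sub by (auto intro!: compact_diff)
  have y1r: "r1 \<le> dist c y1" using zero nz by (meson mem_ball not_le)
  have y1K: "y1 \<in> K" using y1 y1r r by (auto simp: K_def)
  have Kc: "y \<noteq> c" if "y \<in> K" for y using that r by (auto simp: K_def)
  note cont = continuous_coeffs[THEN continuous_on_subset, OF K(2)]
  obtain xm where xm: "xm \<in> K" "\<And>y. y \<in> K \<Longrightarrow> symbol c xm \<le> symbol c y"
    using continuous_attains_inf[OF K(1) _ cont(3)] y1K by blast
  define m where "m = symbol c xm"
  have m: "m > 0" unfolding m_def using symbol_pos xm(1) K(2) Kc by blast
  obtain M0 where M0: "\<And>y. y \<in> K \<Longrightarrow> \<bar>coeff0 y\<bar> \<le> M0"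
    using continuous_on_compact_abs_bound[OF K(1) cont(1)] by blast
  obtain M1 where M1: "\<And>y. y \<in> K \<Longrightarrow> \<bar>coeff1 c y\<bar> \<le> M1"
    using continuous_on_compact_abs_bound[OF K(1) cont(2)] by blast
  have M: "M0 \<ge> 0" "M1 \<ge> 0" using M0[OF y1K] M1[OF y1K] by linarith+
  \<comment> \<open>Since \<open>symbol\<close> is at least \<open>m\<close> on \<open>K\<close>,
    this makes \<open>2 * s * symbol - coeff1\<close> at least \<open>2 * (M1 + 1) - M1\<close>,
    hence at least 1.\<close>
  define s where "s = (M1 + 1) / m"
  have s: "s > 0" using M m by (simp add: s_def)
  define h where "h = (\<lambda>y::real^6. exp (- s * ((y - c) \<bullet> (y - c))))"
  have hd: "h y = exp (- s * (dist c y)\<^sup>2)" for y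
  proof -
    have "dist c y = norm (y - c)" by (simp add: dist_norm norm_minus_commute)
    then show ?thesis by (simp only: h_def power2_norm_eq_inner)
  qed
  define h0 where "h0 = exp (- s * r2\<^sup>2)"
  have h0: "h0 > 0" by (simp add: h0_def)
  have hK: "h y \<ge> h0" if "y \<in> K" for y
    using that s by (auto simp: hd h0_def K_def intro!: mult_left_mono power_mono)
  have hy1: "h y1 > h0" using y1 s by (auto simp: hd h0_def intro!: mult_strict_left_mono power_strict_mono)
  have core: "coeff0 y + t * h y * (4 * s\<^sup>2 * symbol c y - 2 * s * coeff1 c y) > 0"
    if y: "y \<in> K" and t: "t > M0 / (2 * s * h0)" for y t
  proof -
    have tp: "t > 0" using t M s h0 by (smt (verit) divide_nonneg_pos mult_pos_pos)
    have "s * m = M1 + 1" using m by (simp add: s_def)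
    moreover have "s * m \<le> s * symbol c y" using xm(2)[OF y] s unfolding m_def by (intro mult_left_mono) auto
    moreover have "coeff1 c y \<le> M1" using M1[OF y] by simp
    ultimately have "2 * (s * symbol c y) - coeff1 c y \<ge> 1" using M(2) by argo
    then have "2 * s * symbol c y - coeff1 c y \<ge> 1" by (simp only: mult.assoc)
    then have "4 * s\<^sup>2 * symbol c y - 2 * s * coeff1 c y \<ge> 2 * s"
      using mult_left_mono[of 1 "2 * s * symbol c y - coeff1 c y" "2 * s"] s
      by (simp add: algebra_simps power2_eq_square)
    moreover have "t * h y \<ge> t * h0" using hK[OF y] tp by simp
    ultimately have "t * h y * (4 * s\<^sup>2 * symbol c y - 2 * s * coeff1 c y) \<ge> t * h0 * (2 * s)"
      using tp h0 s by (intro mult_mono) auto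
    moreover have "t * h0 * (2 * s) > M0" using t h0 s by (simp add: field_simps)
    ultimately show ?thesis using M0[OF y] by linarith
  qed
  have cl: "continuous_on K lam"
    by (rule continuous_on_subset[OF smooth_on_continuous[OF smooth_lam] K(2)])
  have clam: "continuous_on K (\<lambda>y. cmod (lam y))" by (rule continuous_on_norm[OF cl])
  obtain L where L: "\<And>y. y \<in> K \<Longrightarrow> (cmod (lam y))\<^sup>2 \<le> L"
    using continuous_on_compact_abs_bound[OF K(1) continuous_on_power[OF clam, of 2]] by auto
  have bound: "(cmod (lam y1))\<^sup>2 * exp (2 * t * (h y1 - h0)) \<le> L" if t: "t > M0 / (2 * s * h0)" for t
  proof -
    define G where "G = (\<lambda>y. (cmod (lam y))\<^sup>2 * exp (2 * t * h y))"
    have ch: "continuous_on K h" unfolding h_def by (intro continuous_intros)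
    have "continuous_on K G" unfolding G_def by (intro continuous_intros cl ch)
    then obtain x where x: "x \<in> K" "\<And>y. y \<in> K \<Longrightarrow> G y \<le> G x"
      using continuous_attains_sup[OF K(1)] y1K by blast
    have "G y1 > 0" using nz by (simp add: G_def)
    then have "G x > 0" using x(2)[OF y1K] by linarith
    then have xnz: "lam x \<noteq> 0" by (auto simp: G_def)
    then have xr: "r1 \<le> dist c x" using zero by (meson mem_ball not_le)
    \<comment> \<open>The maximum is forced onto the outer sphere, where the weight has the exponent
      \<open>h0\<close>, strictly smaller than \<open>h y1\<close>.\<close>
    have xb: "dist c x = r2"
    proof (rule ccontr)
      assume "dist c x \<noteq> r2"
      then have xU: "x \<in> ball c r2 - cball c (r1 / 2)" using x(1) xr r by (auto simp: K_def)
      have UK: "ball c r2 - cball c (r1 / 2) \<subseteq> K" by (auto simp: K_def)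
      have "coeff0 x + t * h x * (4 * s\<^sup>2 * symbol c x - 2 * s * coeff1 c x) \<le> 0"
        unfolding h_def
      proof (rule weighted_max_condition[OF xU _ _ xnz])
        show "open (ball c r2 - cball c (r1 / 2))" by (intro open_Diff open_ball closed_cball)
        show "ball c r2 - cball c (r1 / 2) \<subseteq> V" using UK K(2) by blast
      qed (use x(2) UK in \<open>auto simp: G_def h_def\<close>)
      then show False using core[OF x(1) t] by linarith
    qed
    have "(cmod (lam y1))\<^sup>2 * exp (2 * t * h y1) \<le> (cmod (lam x))\<^sup>2 * exp (2 * t * h0)"
      using x(2)[OF y1K] unfolding G_def hd[of x] xb h0_def .
    also have "\<dots> \<le> L * exp (2 * t * h0)" using L[OF x(1)] by (intro mult_right_mono) auto
    finally have "(cmod (lam y1))\<^sup>2 * (exp (2 * t * h y1) / exp (2 * t * h0)) \<le> L"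
      by (simp add: divide_le_eq)
    then show ?thesis by (simp add: exp_diff[symmetric] algebra_simps)
  qed
  define A where "A = (cmod (lam y1))\<^sup>2"
  have A: "A > 0" using nz by (simp add: A_def)
  have L0: "L \<ge> 0" using L[OF y1K] by (smt (verit) zero_le_power2)
  define d where "d = h y1 - h0"
  have d: "d > 0" using hy1 by (simp add: d_def)
  \<comment> \<open>The first summand excludes interior maxima, the last makes
    \<open>A * (2 * t * d)\<close> exceed \<open>L\<close>, and the summand 1 makes both bounds
    strict.\<close>
  define t where "t = M0 / (2 * s * h0) + 1 + L / (2 * A * d)"
  have Ld: "L / (2 * A * d) \<ge> 0" using L0 A d by simp
  then have t: "t > M0 / (2 * s * h0)" unfolding t_def by linarith
  have t2: "t > L / (2 * A * d)" using M s h0 unfolding t_def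
    by (smt (verit) divide_nonneg_pos mult_pos_pos)
  have "L < A * (2 * t * d)" using t2 A d by (simp add: field_simps)
  also have "\<dots> \<le> A * exp (2 * t * d)"
    using A exp_ge_add_one_self[of "2 * t * d"] by (intro mult_left_mono) linarith+
  also have "\<dots> \<le> L" using bound[OF t] by (simp add: A_def d_def)
  finally show False by simp
qed

end

section \<open>Charts and tangent vectors\<close>

lemma deriv_frechet:
  fixes g :: "real \<Rightarrow> real"
  assumes "g differentiable (at t)"
  shows "deriv g t = frechet_derivative g (at t) 1"
proof (rule DERIV_imp_deriv)
  have "frechet_derivative g (at t) = (*) (frechet_derivative g (at t) 1)"
  proof (rule ext)
    fix x :: real
    show "frechet_derivative g (at t) x = frechet_derivative g (at t) 1 * x"
      using linear_cmul[OF linear_frechet_derivative[OF assms], of x 1] by simp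
  qed
  then show "(g has_field_derivative frechet_derivative g (at t) 1) (at t)"
    using frechet_derivative_works[THEN iffD1, OF assms] unfolding has_field_derivative_def by simp
qed

text \<open>The tangent vector with coordinates \<open>h\<close>. Like \<open>velocity\<close>, it
  is set to zero on functions that are not smooth near \<open>p\<close>, so that it equals a
  velocity as a function on all functions.\<close>

definition chart_vec ::
  "('m, real^6) atlas \<Rightarrow> 'm set \<Rightarrow> ('m \<Rightarrow> real^6) \<Rightarrow> 'm \<Rightarrow> real^6 \<Rightarrow> 'm tvec" where
  "chart_vec A U \<phi> p h = (\<lambda>f. if smooth_at A p f
     then frechet_derivative (\<lambda>y. f (inv_into U \<phi> y)) (at (\<phi> p)) h else 0)"

lemma smooth_on_line:
  fixes y h :: "'a::real_normed_vector"
  shows "open S \<Longrightarrow> smooth_on S (\<lambda>t::real. y + t *\<^sub>R h)"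
  by (intro smooth_on_add smooth_on_scaleR smooth_on_const smooth_on_id)

lemma line_interval:
  fixes y h :: "'a::real_normed_vector"
  assumes "open V" "y \<in> V"
  obtains \<delta> where "\<delta> > 0" "\<And>t. \<bar>t\<bar> < \<delta> \<Longrightarrow> y + t *\<^sub>R h \<in> V"
proof -
  have cont: "continuous_on UNIV (\<lambda>t::real. y + t *\<^sub>R h)" by (intro continuous_intros)
  have "open ((\<lambda>t::real. y + t *\<^sub>R h) -` V)" by (rule open_vimage[OF assms(1) cont])
  moreover have "0 \<in> (\<lambda>t::real. y + t *\<^sub>R h) -` V" using assms by simp
  ultimately obtain \<delta> where "\<delta> > 0" "ball 0 \<delta> \<subseteq> (\<lambda>t::real. y + t *\<^sub>R h) -` V"
    using openE by blast
  then show thesis by (intro that[of \<delta>]) (auto simp: subset_iff dist_real_def)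
qed

lemma frechet_line:
  fixes g :: "'a::euclidean_space \<Rightarrow> 'b::real_normed_vector"
  assumes "g differentiable (at y)"
  shows "frechet_derivative (\<lambda>t::real. g (y + t *\<^sub>R h)) (at 0) 1 = frechet_derivative g (at y) h"
proof -
  have l: "((\<lambda>t::real. y + t *\<^sub>R h) has_derivative (\<lambda>t. t *\<^sub>R h)) (at 0)"
    by (auto intro!: derivative_eq_intros)
  have g: "g differentiable (at (y + 0 *\<^sub>R h))" using assms by simp
  show ?thesis
    unfolding frechet_derivative_chain[OF differentiableI[OF l] g] frechet_derivative_at[OF l, symmetric] by simp
qed

locale atlas6 =
  fixes A :: "('m::{t2_space,second_countable_topology}, real^6) atlas"
  assumes atlas: "smooth_atlas6 A"
begin

lemma covers: obtains U \<phi> where "(U, \<phi>) \<in> A" "p \<in> U"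
proof -
  have "p \<in> \<Union>(fst ` A)" using atlas unfolding smooth_atlas6_def by simp
  then show thesis using that by auto
qed

lemma chart_props:
  assumes "(U, \<phi>) \<in> A"
  shows "open U" "open (\<phi> ` U)" "homeomorphism U (\<phi> ` U) \<phi> (inv_into U \<phi>)"
    and "continuous_on U \<phi>" "continuous_on (\<phi> ` U) (inv_into U \<phi>)" "inj_on \<phi> U"
proof -
  show 1: "open U" "open (\<phi> ` U)" and h: "homeomorphism U (\<phi> ` U) \<phi> (inv_into U \<phi>)"
    using atlas assms unfolding smooth_atlas6_def by auto
  show "continuous_on U \<phi>" "continuous_on (\<phi> ` U) (inv_into U \<phi>)"
    using h unfolding homeomorphism_def by auto
  show "inj_on \<phi> U" by (rule inj_onI) (metis h homeomorphism_apply1)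
qed

lemma inv_chart [simp]: "(U, \<phi>) \<in> A \<Longrightarrow> p \<in> U \<Longrightarrow> inv_into U \<phi> (\<phi> p) = p"
  using chart_props(6) by simp

lemma chart_inv: "y \<in> \<phi> ` U \<Longrightarrow> \<phi> (inv_into U \<phi> y) = y" "y \<in> \<phi> ` U \<Longrightarrow> inv_into U \<phi> y \<in> U"
  by (auto simp: f_inv_into_f inv_into_into)

lemma overlap_eq:
  "(U, \<phi>) \<in> A \<Longrightarrow> \<phi> ` (U \<inter> U') = {y \<in> \<phi> ` U. inv_into U \<phi> y \<in> U'}"
  by (auto simp: image_iff)

lemma open_inv_preimage:
  assumes "(U, \<phi>) \<in> A" "open O'"
  shows "open {y \<in> \<phi> ` U. inv_into U \<phi> y \<in> O'}"
proof -
  have "{y \<in> \<phi> ` U. inv_into U \<phi> y \<in> O'} = \<phi> ` U \<inter> inv_into U \<phi> -` O'" by auto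
  then show ?thesis
    using continuous_open_preimage[OF chart_props(5,2)[OF assms(1)] assms(2)] by simp
qed

lemma open_overlap:
  assumes "(U, \<phi>) \<in> A" "(U', \<phi>') \<in> A"
  shows "open (\<phi> ` (U \<inter> U'))"
  unfolding overlap_eq[OF assms(1)] by (rule open_inv_preimage[OF assms(1) chart_props(1)[OF assms(2)]])

lemma smooth_transition:
  assumes "(U, \<phi>) \<in> A" "(U', \<phi>') \<in> A"
  shows "smooth_on (\<phi> ` (U \<inter> U')) (\<lambda>y. \<phi>' (inv_into U \<phi> y))"
proof -
  have "smooth_on (\<phi> ` (U \<inter> U')) (\<phi>' \<circ> inv_into U \<phi>)"
    using atlas assms unfolding smooth_atlas6_def by (metis (no_types, lifting) case_prodD)
  then show ?thesis by (simp add: o_def)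
qed

lemma open_preimage_smooth:
  fixes f :: "'a::real_normed_vector \<Rightarrow> 'b::real_normed_vector"
  assumes "open V" "smooth_on V f" "open S"
  shows "open {y \<in> V. f y \<in> S}"
proof -
  have "{y \<in> V. f y \<in> S} = V \<inter> f -` S" by auto
  then show ?thesis using continuous_open_preimage[OF smooth_on_continuous[OF assms(2)] assms(1,3)] by simp
qed

lemma smooth_at_chart:
  fixes f :: "'m \<Rightarrow> 'b::real_normed_vector"
  assumes f: "smooth_at A p f" and c: "(U, \<phi>) \<in> A" "p \<in> U"
  obtains S where "open S" "\<phi> p \<in> S" "S \<subseteq> \<phi> ` U" "smooth_on S (\<lambda>y. f (inv_into U \<phi> y))"
proof -
  obtain D k S g where k: "(D, k) \<in> A" "p \<in> D" and S: "open S" "k p \<in> S" "smooth_on S g"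
    and fg: "\<And>q. q \<in> D \<Longrightarrow> k q \<in> S \<Longrightarrow> f q = g (k q)"
    using f unfolding smooth_at_def by auto
  define O' where "O' = {y \<in> \<phi> ` (U \<inter> D). k (inv_into U \<phi> y) \<in> S}"
  have o: "open O'" unfolding O'_def
    by (rule open_preimage_smooth[OF open_overlap[OF c(1) k(1)] smooth_transition[OF c(1) k(1)] S(1)])
  have D: "inv_into U \<phi> y \<in> D" "k (inv_into U \<phi> y) \<in> S" if "y \<in> O'" for y
    using that c unfolding O'_def by auto
  show thesis
  proof (rule that[OF o])
    show "\<phi> p \<in> O'" using c k S unfolding O'_def by auto
    show "O' \<subseteq> \<phi> ` U" unfolding O'_def by auto
    show "smooth_on O' (\<lambda>y. f (inv_into U \<phi> y))"
    proof (rule smooth_on_cong[OF o])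
      have "smooth_on O' (\<lambda>y. k (inv_into U \<phi> y))"
        by (rule smooth_on_subset[OF smooth_transition[OF c(1) k(1)]]) (auto simp: O'_def)
      then show "smooth_on O' (\<lambda>y. g (k (inv_into U \<phi> y)))"
        by (rule smooth_on_compose[OF o S(1) _ S(3)]) (auto simp: D)
    qed (simp add: fg D)
  qed
qed

lemma smooth_atI:
  fixes f :: "'m \<Rightarrow> 'b::real_normed_vector"
  assumes c: "(U, \<phi>) \<in> A" "p \<in> U" and S: "open S" "\<phi> p \<in> S" "smooth_on S g"
    and "\<And>q. q \<in> U \<Longrightarrow> \<phi> q \<in> S \<Longrightarrow> f q = g (\<phi> q)"
  shows "smooth_at A p f"
  unfolding smooth_at_def using assms by (intro bexI[of _ "(U, \<phi>)"]) auto

lemma smooth_curve_chart: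
  assumes \<gamma>: "smooth_curve A \<gamma>" and c: "(U, \<phi>) \<in> A" "\<gamma> 0 \<in> U"
  obtains \<delta> where "\<delta> > 0" "\<And>t. \<bar>t\<bar> < \<delta> \<Longrightarrow> \<gamma> t \<in> U" "smooth_on {-\<delta><..<\<delta>} (\<lambda>t. \<phi> (\<gamma> t))"
proof -
  obtain D k \<delta>0 where k: "(D, k) \<in> A" and \<delta>0: "\<delta>0 > 0" "\<And>t. \<bar>t\<bar> < \<delta>0 \<Longrightarrow> \<gamma> t \<in> D"
    and s: "smooth_on {-\<delta>0<..<\<delta>0} (k \<circ> \<gamma>)"
    using \<gamma> unfolding smooth_curve_def by auto
  have s': "smooth_on {-\<delta>0<..<\<delta>0} (\<lambda>t. k (\<gamma> t))" using s by (simp add: o_def)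
  have o: "open {t \<in> {-\<delta>0<..<\<delta>0}. k (\<gamma> t) \<in> k ` (D \<inter> U)}"
    by (rule open_preimage_smooth[OF _ s' open_overlap[OF k c(1)]]) simp
  moreover have "0 \<in> {t \<in> {-\<delta>0<..<\<delta>0}. k (\<gamma> t) \<in> k ` (D \<inter> U)}"
    using \<delta>0(1) \<delta>0(2)[of 0] c(2) by auto
  ultimately obtain \<delta> where \<delta>: "\<delta> > 0" "ball 0 \<delta> \<subseteq> {t \<in> {-\<delta>0<..<\<delta>0}. k (\<gamma> t) \<in> k ` (D \<inter> U)}"
    using openE by blast
  have I: "\<bar>t\<bar> < \<delta>0" "k (\<gamma> t) \<in> k ` (D \<inter> U)" if "\<bar>t\<bar> < \<delta>" for t
    using subsetD[OF \<delta>(2), of t] that by (auto simp: dist_real_def)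
  have U: "\<gamma> t \<in> U" if "\<bar>t\<bar> < \<delta>" for t
    using I[OF that] \<delta>0(2)[of t] chart_props(6)[OF k] by (auto dest: inj_onD)
  have "smooth_on {-\<delta><..<\<delta>} (\<lambda>t. \<phi> (inv_into D k (k (\<gamma> t))))"
  proof (rule smooth_on_compose[OF _ open_overlap[OF k c(1)] _ smooth_transition[OF k c(1)]])
    show "smooth_on {-\<delta><..<\<delta>} (\<lambda>t. k (\<gamma> t))"
    proof (rule smooth_on_subset[OF s'], rule subsetI)
      fix t assume "t \<in> {-\<delta><..<\<delta>}"
      then have "\<bar>t\<bar> < \<delta>" by auto
      from I(1)[OF this] show "t \<in> {-\<delta>0<..<\<delta>0}" by auto
    qed
  qed (use I in auto)
  then have "smooth_on {-\<delta><..<\<delta>} (\<lambda>t. \<phi> (\<gamma> t))"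
    by (rule smooth_on_cong[rotated]) (use I \<delta>0(2) k in auto)
  with \<delta>(1) U show thesis by (rule that)
qed

lemma velocity_chart:
  assumes \<gamma>: "smooth_curve A \<gamma>" and c: "(U, \<phi>) \<in> A" "\<gamma> 0 \<in> U"
  shows "velocity A \<gamma> = chart_vec A U \<phi> (\<gamma> 0) (frechet_derivative (\<lambda>t. \<phi> (\<gamma> t)) (at 0) 1)"
proof (rule ext)
  fix f
  show "velocity A \<gamma> f = chart_vec A U \<phi> (\<gamma> 0) (frechet_derivative (\<lambda>t. \<phi> (\<gamma> t)) (at 0) 1) f"
  proof (cases "smooth_at A (\<gamma> 0) f")
    case True
    obtain S where S: "open S" "\<phi> (\<gamma> 0) \<in> S" "S \<subseteq> \<phi> ` U" "smooth_on S (\<lambda>y. f (inv_into U \<phi> y))"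
      by (rule smooth_at_chart[OF True c])
    obtain \<delta> where \<delta>: "\<delta> > 0" "\<And>t. \<bar>t\<bar> < \<delta> \<Longrightarrow> \<gamma> t \<in> U" "smooth_on {-\<delta><..<\<delta>} (\<lambda>t. \<phi> (\<gamma> t))"
      by (rule smooth_curve_chart[OF \<gamma> c]) blast
    have d1: "(\<lambda>t. \<phi> (\<gamma> t)) differentiable (at 0)"
      using \<delta>(1) by (intro smooth_on_differentiable[OF \<delta>(3)]) simp
    have d2: "(\<lambda>y. f (inv_into U \<phi> y)) differentiable (at (\<phi> (\<gamma> 0)))"
      by (rule smooth_on_differentiable[OF S(4,2)])
    have d3: "(\<lambda>t. f (inv_into U \<phi> (\<phi> (\<gamma> t)))) differentiable (at 0)"
      using differentiable_chain_at[OF d1 d2] by (simp add: o_def)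
    have eq: "f (inv_into U \<phi> (\<phi> (\<gamma> t))) = (f \<circ> \<gamma>) t" if "t \<in> {-\<delta><..<\<delta>}" for t
      using \<delta>(2)[of t] that c by (simp add: abs_less_iff)
    have "frechet_derivative (\<lambda>t. f (inv_into U \<phi> (\<phi> (\<gamma> t)))) (at 0) = frechet_derivative (f \<circ> \<gamma>) (at 0)"
      by (rule frechet_derivative_transform_within_open[OF d3, of "{-\<delta><..<\<delta>}"]) (use \<delta>(1) eq in auto)
    moreover have "(f \<circ> \<gamma>) differentiable (at 0)"
    proof -
      have "(f \<circ> \<gamma> has_derivative frechet_derivative (\<lambda>t. f (inv_into U \<phi> (\<phi> (\<gamma> t)))) (at 0)) (at 0)"
        by (rule has_derivative_transform_within_open[OF frechet_derivative_works[THEN iffD1, OF d3], of "{-\<delta><..<\<delta>}"])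
          (use \<delta>(1) eq in auto)
      then show ?thesis by (rule differentiableI)
    qed
    ultimately show ?thesis
      using True frechet_derivative_chain[OF d1 d2] by (simp add: velocity_def chart_vec_def deriv_frechet)
  qed (simp add: velocity_def chart_vec_def)
qed

lemma chart_vec_velocity:
  assumes c: "(U, \<phi>) \<in> A" "p \<in> U"
  shows "smooth_curve A (\<lambda>t. inv_into U \<phi> (\<phi> p + t *\<^sub>R h))"
    and "velocity A (\<lambda>t. inv_into U \<phi> (\<phi> p + t *\<^sub>R h)) = chart_vec A U \<phi> p h"
proof -
  let ?\<gamma> = "\<lambda>t. inv_into U \<phi> (\<phi> p + t *\<^sub>R h)"
  obtain \<delta> where \<delta>: "\<delta> > 0" "\<And>t. \<bar>t\<bar> < \<delta> \<Longrightarrow> \<phi> p + t *\<^sub>R h \<in> \<phi> ` U"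
    by (rule line_interval[OF chart_props(2)[OF c(1)], of "\<phi> p" h]) (use c in auto)
  have I: "\<phi> (?\<gamma> t) = \<phi> p + t *\<^sub>R h" "?\<gamma> t \<in> U" if "\<bar>t\<bar> < \<delta>" for t
    using \<delta>(2)[OF that] by (auto simp: chart_inv)
  have s: "smooth_on {-\<delta><..<\<delta>} (\<phi> \<circ> ?\<gamma>)"
    by (rule smooth_on_cong[OF _ smooth_on_line, of _ "\<phi> p" h]) (use I in \<open>auto simp: abs_less_iff\<close>)
  show sc: "smooth_curve A ?\<gamma>"
    unfolding smooth_curve_def using c(1) \<delta>(1) I(2) s by (intro bexI[of _ "(U, \<phi>)"]) auto
  have g0: "?\<gamma> 0 = p" using c by simp
  have ld: "((\<lambda>t::real. \<phi> p + t *\<^sub>R h) has_derivative (\<lambda>t. t *\<^sub>R h)) (at 0)"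
    by (auto intro!: derivative_eq_intros)
  have "frechet_derivative (\<lambda>t::real. \<phi> p + t *\<^sub>R h) (at 0) = frechet_derivative (\<lambda>t. \<phi> (?\<gamma> t)) (at 0)"
    by (rule frechet_derivative_transform_within_open[OF differentiableI[OF ld], of "{-\<delta><..<\<delta>}"])
       (use I \<delta>(1) in \<open>auto simp: abs_less_iff\<close>)
  then have "frechet_derivative (\<lambda>t. \<phi> (?\<gamma> t)) (at 0) 1 = h"
    using frechet_derivative_at[OF ld] by (metis scaleR_one)
  then show "velocity A ?\<gamma> = chart_vec A U \<phi> p h"
    using velocity_chart[OF sc c(1)] c g0 by simp
qed

text \<open>The description by curves shows no linear structure. A velocity is determined by the
  derivative of the curve in the chart, and every coordinate vector is realised by a coordinate
  line, so the tangent space is a copy of \<open>real^6\<close>.\<close>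

lemma tangent_space_chart:
  assumes c: "(U, \<phi>) \<in> A" "p \<in> U"
  shows "tangent_space A p = range (chart_vec A U \<phi> p)"
proof (intro set_eqI iffI)
  fix v assume "v \<in> tangent_space A p"
  then show "v \<in> range (chart_vec A U \<phi> p)"
    unfolding tangent_space_def using velocity_chart[OF _ c(1)] c(2) by auto
next
  fix v assume "v \<in> range (chart_vec A U \<phi> p)"
  then obtain h where "v = chart_vec A U \<phi> p h" by blast
  then show "v \<in> tangent_space A p"
    unfolding tangent_space_def using chart_vec_velocity[OF c, of h] c
    by (auto intro!: exI[of _ "\<lambda>t. inv_into U \<phi> (\<phi> p + t *\<^sub>R h)"])
qed

lemma chart_vec_tangent: "(U, \<phi>) \<in> A \<Longrightarrow> p \<in> U \<Longrightarrow> chart_vec A U \<phi> p h \<in> tangent_space A p"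
  by (simp add: tangent_space_chart)

lemma coord_vec_chart:
  "(U, \<phi>) \<in> A \<Longrightarrow> p \<in> U \<Longrightarrow> coord_vec A (U, \<phi>) p j = chart_vec A U \<phi> p (axis j 1)"
  unfolding coord_vec_def using chart_vec_velocity(2)[of U \<phi> p "axis j 1"] by simp

lemma smooth_at_coordinate:
  assumes c: "(U, \<phi>) \<in> A" "p \<in> U"
  shows "smooth_at A p (\<lambda>q. \<phi> q \<bullet> b)"
  by (rule smooth_atI[OF c open_UNIV UNIV_I, of "\<lambda>y. y \<bullet> b"]) (auto intro: smooth_on_inner)

lemma chart_vec_coordinate:
  assumes c: "(U, \<phi>) \<in> A" "p \<in> U"
  shows "chart_vec A U \<phi> p h (\<lambda>q. \<phi> q \<bullet> b) = h \<bullet> b"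
proof -
  have ld: "((\<lambda>y. y \<bullet> b) has_derivative (\<lambda>y. y \<bullet> b)) (at (\<phi> p))"
    by (auto intro!: derivative_eq_intros)
  have "frechet_derivative (\<lambda>y. y \<bullet> b) (at (\<phi> p)) = frechet_derivative (\<lambda>y. \<phi> (inv_into U \<phi> y) \<bullet> b) (at (\<phi> p))"
    by (rule frechet_derivative_transform_within_open[OF differentiableI[OF ld] chart_props(2)[OF c(1)]])
       (use c in \<open>auto simp: chart_inv\<close>)
  then show ?thesis
    using frechet_derivative_at[OF ld] smooth_at_coordinate[OF c] by (simp add: chart_vec_def) metis
qed

lemma dcoord_chart_vec:
  assumes c: "(U, \<phi>) \<in> A" "p \<in> U"
  shows "dcoord \<phi> (chart_vec A U \<phi> p h) = h"
  unfolding dcoord_def chart_vec_coordinate[OF c] by (rule euclidean_representation)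

lemma chart_vec_linear:
  assumes c: "(U, \<phi>) \<in> A" "p \<in> U"
  shows "chart_vec A U \<phi> p (a *\<^sub>R h + b *\<^sub>R h') = (\<lambda>f. a * chart_vec A U \<phi> p h f + b * chart_vec A U \<phi> p h' f)"
proof (rule ext)
  fix f
  show "chart_vec A U \<phi> p (a *\<^sub>R h + b *\<^sub>R h') f = a * chart_vec A U \<phi> p h f + b * chart_vec A U \<phi> p h' f"
  proof (cases "smooth_at A p f")
    case True
    obtain S where S: "open S" "\<phi> p \<in> S" "S \<subseteq> \<phi> ` U" "smooth_on S (\<lambda>y. f (inv_into U \<phi> y))"
      by (rule smooth_at_chart[OF True c])
    have l: "linear (frechet_derivative (\<lambda>y. f (inv_into U \<phi> y)) (at (\<phi> p)))"
      by (rule linear_frechet_derivative[OF smooth_on_differentiable[OF S(4,2)]])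
    show ?thesis using True by (simp add: chart_vec_def linear_add[OF l] linear_cmul[OF l])
  qed (simp add: chart_vec_def)
qed

lemma chart_vec_change:
  assumes c: "(U, \<phi>) \<in> A" "p \<in> U" and c': "(U', \<phi>') \<in> A" "p \<in> U'"
  shows "chart_vec A U' \<phi>' p h
    = chart_vec A U \<phi> p (frechet_derivative (\<lambda>y. \<phi> (inv_into U' \<phi>' y)) (at (\<phi>' p)) h)"
proof -
  let ?\<gamma> = "\<lambda>t. inv_into U' \<phi>' (\<phi>' p + t *\<^sub>R h)"
  have "(\<lambda>y. \<phi> (inv_into U' \<phi>' y)) differentiable (at (\<phi>' p))"
    by (rule smooth_on_differentiable[OF smooth_transition[OF c'(1) c(1)]]) (use c c' in auto)
  from frechet_line[OF this, of h]
  have "frechet_derivative (\<lambda>t. \<phi> (?\<gamma> t)) (at 0) 1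
      = frechet_derivative (\<lambda>y. \<phi> (inv_into U' \<phi>' y)) (at (\<phi>' p)) h" .
  then show ?thesis
    using velocity_chart[OF chart_vec_velocity(1)[OF c'] c(1), of h] chart_vec_velocity(2)[OF c', of h] c c'
    by simp
qed

end

section \<open>Local sections of the coframe bundle\<close>

lemma frechet_derivative_sum:
  assumes "\<And>i. i \<in> I \<Longrightarrow> f i differentiable (at x)"
  shows "frechet_derivative (\<lambda>x. \<Sum>i\<in>I. f i x) (at x) h = (\<Sum>i\<in>I. frechet_derivative (f i) (at x) h)"
proof -
  have "((\<lambda>x. \<Sum>i\<in>I. f i x) has_derivative (\<lambda>h. \<Sum>i\<in>I. frechet_derivative (f i) (at x) h)) (at x)"
    by (rule has_derivative_sum) (rule frechet_derivative_works[THEN iffD1, OF assms])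
  from frechet_derivative_at[OF this] show ?thesis by metis
qed

text \<open>Exterior differentiation commutes with pullback: the second derivatives of
  \<open>G\<close> enter symmetrically in \<open>j\<close> and \<open>l\<close> and cancel. The
  target is an open set of a Euclidean space of any dimension, since the bundle is only embedded as
  a submanifold and its forms are given by local extensions.\<close>

lemma pullback_form:
  fixes G :: "real^6 \<Rightarrow> 'e::euclidean_space" and W :: "'e \<Rightarrow> 'e \<Rightarrow> complex"
  assumes V: "open V" and S: "open S" and G: "smooth_on V G" and GS: "\<And>y. y \<in> V \<Longrightarrow> G y \<in> S"
    and W: "\<And>h. smooth_on S (\<lambda>x. W x h)" and lin: "\<And>x. x \<in> S \<Longrightarrow> linear (W x)"
  defines "P \<equiv> \<lambda>l z. W (G z) (frechet_derivative G (at z) (axis l 1))"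
  shows "smooth_on V (P l)"
    and "y \<in> V \<Longrightarrow> pd j (P l) y - pd l (P j) y =
      frechet_derivative (\<lambda>x. W x (frechet_derivative G (at y) (axis l 1))) (at (G y)) (frechet_derivative G (at y) (axis j 1))
      - frechet_derivative (\<lambda>x. W x (frechet_derivative G (at y) (axis j 1))) (at (G y)) (frechet_derivative G (at y) (axis l 1))"
proof -
  let ?D = "\<lambda>l z. frechet_derivative G (at z) (axis l 1)"
  define R where "R = (\<lambda>l z. \<Sum>b\<in>Basis. (?D l z \<bullet> b) *\<^sub>R W (G z) b)"
  have RP: "R l z = P l z" if "z \<in> V" for l z
    unfolding R_def P_def using linear_basis_sum[OF lin[OF GS[OF that]]] by metis
  have WG: "smooth_on V (\<lambda>z. W (G z) b)" for b
    by (rule smooth_on_compose[OF V S G W]) (use GS in auto)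
  have D: "smooth_on V (\<lambda>z. ?D l z)" for l by (rule smooth_on_frechet[OF G])
  have Db: "smooth_on V (\<lambda>z. ?D l z \<bullet> b)" for l b
    by (rule smooth_on_inner[OF V D smooth_on_const])
  have T: "smooth_on V (\<lambda>z. (?D l z \<bullet> b) *\<^sub>R W (G z) b)" for l b
    by (intro smooth_on_scaleR[OF V] Db WG)
  have R: "smooth_on V (R l)" for l unfolding R_def by (intro smooth_on_sum[OF V] T)
  show "smooth_on V (P l)" by (rule smooth_on_cong[OF V R RP])
  show "pd j (P l) y - pd l (P j) y =
      frechet_derivative (\<lambda>x. W x (?D l y)) (at (G y)) (?D j y)
      - frechet_derivative (\<lambda>x. W x (?D j y)) (at (G y)) (?D l y)" if y: "y \<in> V"
  proof -
    define H where "H = (\<lambda>j l. frechet_derivative (\<lambda>z. ?D l z) (at y) (axis j 1))"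
    have Hsym: "H j l = H l j" for j l unfolding H_def by (rule frechet_derivative_symmetric[OF V G y])
    have 1: "pd j (P l) y = (\<Sum>b\<in>Basis. (?D l y \<bullet> b) *\<^sub>R frechet_derivative (\<lambda>x. W x b) (at (G y)) (?D j y))
        + W (G y) (H j l)" for j l
    proof -
      have "pd j (P l) y = pd j (R l) y" by (rule pd_cong[OF V R y RP, symmetric])
      also have "\<dots> = (\<Sum>b\<in>Basis. frechet_derivative (\<lambda>z. (?D l z \<bullet> b) *\<^sub>R W (G z) b) (at y) (axis j 1))"
        unfolding pd_def R_def by (rule frechet_derivative_sum) (rule smooth_on_differentiable[OF T y])
      also have "\<dots> = (\<Sum>b\<in>Basis. (?D l y \<bullet> b) *\<^sub>R frechet_derivative (\<lambda>x. W x b) (at (G y)) (?D j y)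
          + (H j l \<bullet> b) *\<^sub>R W (G y) b)"
      proof (rule sum.cong[OF refl])
        fix b :: 'e
        have "frechet_derivative (\<lambda>z. W (G z) b) (at y) (axis j 1)
            = frechet_derivative (\<lambda>x. W x b) (at (G y)) (?D j y)"
          by (rule frechet_derivative_chain[OF smooth_on_differentiable[OF G y] smooth_on_differentiable[OF W GS[OF y]]])
        moreover have "frechet_derivative (\<lambda>z. ?D l z \<bullet> b) (at y) (axis j 1) = H j l \<bullet> b"
          unfolding H_def
          by (rule frechet_derivative_bounded_linear[OF bounded_linear_inner_left smooth_on_differentiable[OF D y]])
        ultimately show "frechet_derivative (\<lambda>z. (?D l z \<bullet> b) *\<^sub>R W (G z) b) (at y) (axis j 1)
          = (?D l y \<bullet> b) *\<^sub>R frechet_derivative (\<lambda>x. W x b) (at (G y)) (?D j y) + (H j l \<bullet> b) *\<^sub>R W (G y) b"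
          using frechet_derivative_bilinear[OF bounded_bilinear_scaleR smooth_on_differentiable[OF Db y]
              smooth_on_differentiable[OF WG y]] by simp
      qed
      finally show ?thesis
        unfolding sum.distrib linear_basis_sum[OF lin[OF GS[OF y]], of "H j l", symmetric] .
    qed
    have 2: "frechet_derivative (\<lambda>x. W x v) (at (G y)) w
        = (\<Sum>b\<in>Basis. (v \<bullet> b) *\<^sub>R frechet_derivative (\<lambda>x. W x b) (at (G y)) w)" for v w
    proof -
      have s: "smooth_on S (\<lambda>x. (v \<bullet> b) *\<^sub>R W x b)" for b
        by (intro smooth_on_scaleR[OF S] smooth_on_const W)
      have e: "frechet_derivative (\<lambda>x. \<Sum>b\<in>Basis. (v \<bullet> b) *\<^sub>R W x b) (at (G y)) = frechet_derivative (\<lambda>x. W x v) (at (G y))"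
        by (rule frechet_derivative_transform_within_open[OF
              smooth_on_differentiable[OF smooth_on_sum[OF S s] GS[OF y]] S GS[OF y]])
           (metis linear_basis_sum lin)
      have "frechet_derivative (\<lambda>x. W x v) (at (G y)) w
          = (\<Sum>b\<in>Basis. frechet_derivative (\<lambda>x. (v \<bullet> b) *\<^sub>R W x b) (at (G y)) w)"
        unfolding e[symmetric] by (rule frechet_derivative_sum) (rule smooth_on_differentiable[OF s GS[OF y]])
      then show ?thesis
        using frechet_derivative_bounded_linear[OF bounded_linear_scaleR_right smooth_on_differentiable[OF W GS[OF y]]]
        by simp
    qed
    show ?thesis unfolding 1 2[of "?D l y"] 2[of "?D j y"] Hsym[of l j] by simp
  qed
qed

lemma dcoord_inner: "b \<in> Basis \<Longrightarrow> dcoord k v \<bullet> b = v (\<lambda>q. k q \<bullet> b)"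
  unfolding dcoord_def by simp

definition bundle_coord ::
  "('m, real^6) atlas \<Rightarrow> 'm set \<times> ('m \<Rightarrow> real^6) \<Rightarrow> 'm coframe \<Rightarrow> (real^6) \<times> ((complex^3)^6)" where
  "bundle_coord A c = (\<lambda>(p, u). (snd c p, \<chi> j. u (coord_vec A c p j)))"

locale coframe_setting = atlas6 A
  for A :: "('m::{t2_space,second_countable_topology}, real^6) atlas" +
  fixes J :: "'m \<Rightarrow> 'm tvec \<Rightarrow> 'm tvec" and \<eta> :: "'m \<Rightarrow> 'm tvec \<Rightarrow> 'm tvec \<Rightarrow> real"
begin

abbreviation "F \<equiv> coframe_bundle A J \<eta>"
abbreviation "\<Phi> \<equiv> coframe_atlas A J \<eta>"

lemma bundle_chart: "(U, \<phi>) \<in> A \<Longrightarrow> ({x \<in> F. fst x \<in> U}, bundle_coord A (U, \<phi>)) \<in> \<Phi>"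
  unfolding coframe_atlas_def bundle_coord_def by (intro image_eqI[of _ _ "(U, \<phi>)"]) simp_all

lemma bundle_chartE:
  assumes "(D, K) \<in> \<Phi>"
  obtains U \<phi> where "(U, \<phi>) \<in> A" "D = {x \<in> F. fst x \<in> U}" "K = bundle_coord A (U, \<phi>)"
  using assms unfolding coframe_atlas_def bundle_coord_def by auto

lemma coframe_linear:
  assumes x: "(p, u) \<in> F" and c: "(U, \<phi>) \<in> A" "p \<in> U"
  shows "linear (\<lambda>h. u (chart_vec A U \<phi> p h))"
proof -
  have "u (chart_vec A U \<phi> p (a *\<^sub>R h + b *\<^sub>R h'))
      = a *\<^sub>R u (chart_vec A U \<phi> p h) + b *\<^sub>R u (chart_vec A U \<phi> p h')" for a b h h'
    unfolding chart_vec_linear[OF c] using x chart_vec_tangent[OF c]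
    unfolding coframe_bundle_def conformally_unitary_def J_linear_coframe_def by simp
  from this[of 1 _ 1] this[of _ _ 0 0] show ?thesis by (intro linearI) simp_all
qed

lemma smooth_at_fst:
  fixes f :: "'m \<Rightarrow> 'b::real_normed_vector"
  assumes x: "x \<in> F" and f: "smooth_at A (fst x) f"
  shows "smooth_at \<Phi> x (f \<circ> fst)"
proof -
  obtain D k S g where k: "(D, k) \<in> A" "fst x \<in> D" and S: "open S" "k (fst x) \<in> S" "smooth_on S g"
    and fg: "\<And>q. q \<in> D \<Longrightarrow> k q \<in> S \<Longrightarrow> f q = g (k q)"
    using f unfolding smooth_at_def by auto
  have o: "open (S \<times> (UNIV :: ((complex^3)^6) set))" by (rule open_Times[OF S(1) open_UNIV])
  have "smooth_on (S \<times> (UNIV :: ((complex^3)^6) set)) (\<lambda>z. g (fst z))"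
    by (rule smooth_on_compose[OF o S(1) smooth_on_fst[OF o smooth_on_id] S(3)]) auto
  then show ?thesis
    unfolding smooth_at_def
    by (intro bexI[OF _ bundle_chart[OF k(1)]])
       (use x k S fg o in \<open>auto simp: bundle_coord_def case_prod_unfold intro!: exI[of _ "S \<times> UNIV"] exI[of _ "\<lambda>z. g (fst z)"]\<close>)
qed

lemma smooth_curve_fst:
  assumes "smooth_curve \<Phi> \<gamma>"
  shows "smooth_curve A (\<lambda>t. fst (\<gamma> t))" "\<gamma> 0 \<in> F"
proof -
  obtain D K \<delta> where K: "(D, K) \<in> \<Phi>" and \<delta>: "\<delta> > 0" "\<And>t. \<bar>t\<bar> < \<delta> \<Longrightarrow> \<gamma> t \<in> D" "smooth_on {-\<delta><..<\<delta>} (K \<circ> \<gamma>)"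
    using assms unfolding smooth_curve_def by auto
  obtain U \<phi> where c: "(U, \<phi>) \<in> A" and D: "D = {x \<in> F. fst x \<in> U}" and Kd: "K = bundle_coord A (U, \<phi>)"
    by (rule bundle_chartE[OF K])
  have "smooth_on {-\<delta><..<\<delta>} (\<lambda>t. fst ((K \<circ> \<gamma>) t))" by (rule smooth_on_fst[OF _ \<delta>(3)]) simp
  then have "smooth_on {-\<delta><..<\<delta>} (\<phi> \<circ> (\<lambda>t. fst (\<gamma> t)))"
    by (simp add: Kd bundle_coord_def o_def case_prod_unfold)
  then show "smooth_curve A (\<lambda>t. fst (\<gamma> t))"
    unfolding smooth_curve_def using c \<delta>(1,2) D by (intro bexI[of _ "(U, \<phi>)"]) auto
  show "\<gamma> 0 \<in> F" using \<delta>(1) \<delta>(2)[of 0] D by simp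
qed

lemma dproj_velocity:
  assumes "smooth_curve \<Phi> \<gamma>"
  shows "dproj A (fst (\<gamma> 0)) (velocity \<Phi> \<gamma>) = velocity A (\<lambda>t. fst (\<gamma> t))"
  using smooth_at_fst[OF smooth_curve_fst(2)[OF assms], where 'b = real]
  by (auto simp: dproj_def velocity_def fun_eq_iff o_def)

text \<open>The projected vector is tested on functions pulled back from the base, and the base
  coordinates are the first component of the bundle coordinates.\<close>

lemma dproj_chart:
  assumes c: "(U, \<phi>) \<in> A" and x: "x \<in> F" "fst x \<in> U" and v: "v \<in> tangent_space \<Phi> x"
  shows "dproj A (fst x) v = chart_vec A U \<phi> (fst x) (fst (dcoord (bundle_coord A (U, \<phi>)) v))"
proof -
  obtain \<gamma> where \<gamma>: "smooth_curve \<Phi> \<gamma>" "\<gamma> 0 = x" "v = velocity \<Phi> \<gamma>"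
    using v unfolding tangent_space_def by auto
  have "dproj A (fst x) v \<in> tangent_space A (fst x)"
    using dproj_velocity[OF \<gamma>(1)] smooth_curve_fst(1)[OF \<gamma>(1)] \<gamma> unfolding tangent_space_def by auto
  then obtain h where h: "dproj A (fst x) v = chart_vec A U \<phi> (fst x) h"
    unfolding tangent_space_chart[OF c x(2)] by auto
  have "fst (dcoord (bundle_coord A (U, \<phi>)) v) = h"
  proof (rule euclidean_eqI)
    fix b :: "real^6" assume b: "b \<in> Basis"
    have b0: "(b, 0 :: (complex^3)^6) \<in> Basis" using b by (simp add: Basis_prod_def)
    have "fst (dcoord (bundle_coord A (U, \<phi>)) v) \<bullet> b = dcoord (bundle_coord A (U, \<phi>)) v \<bullet> (b, 0)"
      by (simp add: inner_prod_def)
    also have "\<dots> = v (\<lambda>q. bundle_coord A (U, \<phi>) q \<bullet> (b, 0))" by (rule dcoord_inner[OF b0])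
    also have "(\<lambda>q. bundle_coord A (U, \<phi>) q \<bullet> (b, 0)) = (\<lambda>p. \<phi> p \<bullet> b) \<circ> fst"
      by (auto simp: bundle_coord_def fun_eq_iff inner_prod_def)
    also have "v ((\<lambda>p. \<phi> p \<bullet> b) \<circ> fst) = dproj A (fst x) v (\<lambda>p. \<phi> p \<bullet> b)"
      using smooth_at_coordinate[OF c x(2)] by (simp add: dproj_def)
    also have "\<dots> = h \<bullet> b" unfolding h by (rule chart_vec_coordinate[OF c x(2)])
    finally show "fst (dcoord (bundle_coord A (U, \<phi>)) v) \<bullet> b = h \<bullet> b" .
  qed
  then show ?thesis using h by simp
qed

text \<open>With fibre coordinates \<open>u\<^sub>j\<close>, the values of the coframe on the
  coordinate fields, the tautological form is the sum of \<open>u\<^sub>j dx\<^sub>j\<close>. This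
  is linear in the fibre coordinates and so extends to the entire ambient space.\<close>

lemma tautological_rep:
  assumes c: "(U, \<phi>) \<in> A" and x: "x \<in> F" "fst x \<in> U"
  shows "form1_rep \<Phi> (tautological_form A i) x (bundle_coord A (U, \<phi>))
    (\<lambda>z w. \<Sum>j\<in>UNIV. of_real (fst w $ j) * snd z $ j $ i)"
  unfolding form1_rep_def
proof (intro exI conjI allI ballI impI)
  show "({x \<in> F. fst x \<in> U}, bundle_coord A (U, \<phi>)) \<in> \<Phi>" by (rule bundle_chart[OF c])
  show "x \<in> {x \<in> F. fst x \<in> U}" using x by simp
  show "open (UNIV :: ((real^6) \<times> ((complex^3)^6)) set)" by simp
  show "bundle_coord A (U, \<phi>) x \<in> UNIV" by simp
  show "smooth_on UNIV (\<lambda>z::(real^6) \<times> ((complex^3)^6). \<Sum>j\<in>UNIV. complex_of_real (fst h $ j) * snd z $ j $ i)" for h :: "(real^6) \<times> ((complex^3)^6)"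
    by (intro smooth_on_sum smooth_on_mult smooth_on_const smooth_on_vec_nth smooth_on_snd smooth_on_id open_UNIV)
  show "linear (\<lambda>w::(real^6) \<times> ((complex^3)^6). \<Sum>j\<in>UNIV. complex_of_real (fst w $ j) * snd z $ j $ i)" for z :: "(real^6) \<times> ((complex^3)^6)"
    by (rule linearI) (simp_all add: algebra_simps sum.distrib scaleR_conv_of_real[where 'a=complex] sum_distrib_left)
  fix q v assume q: "q \<in> {x \<in> F. fst x \<in> U}" and v: "v \<in> tangent_space \<Phi> q"
  let ?h = "fst (dcoord (bundle_coord A (U, \<phi>)) v)"
  have qF: "q \<in> F" "fst q \<in> U" "(fst q, snd q) \<in> F" using q by auto
  have "tautological_form A i q v = snd q (chart_vec A U \<phi> (fst q) ?h) $ i"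
    unfolding tautological_form_def dproj_chart[OF c qF(1,2) v] ..
  also have "\<dots> = (\<Sum>j\<in>UNIV. of_real (?h $ j) * snd q (chart_vec A U \<phi> (fst q) (axis j 1)) $ i)"
    using linear_axis_sum[OF coframe_linear[OF qF(3) c qF(2)], of ?h] by (simp add: scaleR_conv_of_real[where 'a=complex])
  also have "\<dots> = (\<Sum>j\<in>UNIV. of_real (?h $ j) * snd (bundle_coord A (U, \<phi>) q) $ j $ i)"
    by (simp add: bundle_coord_def case_prod_unfold coord_vec_chart[OF c qF(2)])
  finally show "tautological_form A i q v = (\<Sum>j\<in>UNIV. of_real (?h $ j) * snd (bundle_coord A (U, \<phi>) q) $ j $ i)" .
qed

lemma smooth_tautological: "smooth_form1 \<Phi> F (tautological_form A i)"
  unfolding smooth_form1_def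
proof
  fix x assume x: "x \<in> F"
  obtain U \<phi> where "(U, \<phi>) \<in> A" "fst x \<in> U" by (rule covers)
  from tautological_rep[OF this(1) x this(2)]
  show "\<exists>k W. form1_rep \<Phi> (tautological_form A i) x k W" by blast
qed

end

locale local_section = coframe_setting A J \<eta>
  for A :: "('m::{t2_space,second_countable_topology}, real^6) atlas" and J \<eta> +
  fixes U :: "'m set" and \<phi> :: "'m \<Rightarrow> real^6" and V :: "(real^6) set" and u :: "real^6 \<Rightarrow> 'm tvec \<Rightarrow> complex^3"
  assumes chart: "(U, \<phi>) \<in> A" and V: "open V" "V \<subseteq> \<phi> ` U"
    and frame_smooth: "\<And>j. smooth_on V (\<lambda>y. u y (chart_vec A U \<phi> (inv_into U \<phi> y) (axis j 1)))"
    and in_bundle: "\<And>y. y \<in> V \<Longrightarrow> (inv_into U \<phi> y, u y) \<in> coframe_bundle A J \<eta>"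
begin

definition "sec y = (inv_into U \<phi> y, u y)" for y

text \<open>The differential of the section, defined by velocities of image curves so that its
  values are tangent to the bundle in the sense of \<open>tangent_space\<close>.\<close>

definition "lift y h = velocity \<Phi> (\<lambda>t. sec (y + t *\<^sub>R h))" for y h

definition "pull \<omega> j y = \<omega> (sec y) (lift y (axis j 1))" for \<omega> :: "'m coframe form1" and j y

lemma sec_bundle: "y \<in> V \<Longrightarrow> sec y \<in> F"
  unfolding sec_def by (rule in_bundle)

lemma base: "y \<in> V \<Longrightarrow> inv_into U \<phi> y \<in> U" "y \<in> V \<Longrightarrow> \<phi> (inv_into U \<phi> y) = y" "fst (sec y) = inv_into U \<phi> y"
  by (rule chart_inv, erule subsetD[OF V(2)])+ (simp add: sec_def)

text \<open>The section is assumed smooth with respect to one chart, while functions and forms on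
  the bundle may be represented in any other. The change of coordinate fields is smooth and
  transfers the smoothness.\<close>

lemma bundle_coord_sec:
  assumes y: "y \<in> V" and c': "(U', \<phi>') \<in> A" "inv_into U \<phi> y \<in> U'"
  obtains V' where "open V'" "y \<in> V'" "V' \<subseteq> V" "\<And>z. z \<in> V' \<Longrightarrow> inv_into U \<phi> z \<in> U'"
    "smooth_on V' (\<lambda>z. bundle_coord A (U', \<phi>') (sec z))"
proof -
  define V' where "V' = V \<inter> \<phi> ` (U \<inter> U')"
  have o: "open V'" unfolding V'_def by (rule open_Int[OF V(1) open_overlap[OF chart c'(1)]])
  have sub: "V' \<subseteq> V" by (auto simp: V'_def)
  have yV: "y \<in> V'" using y c' base(1,2)[OF y] by (auto simp: V'_def overlap_eq[OF chart] image_iff intro!: bexI[of _ "inv_into U \<phi> y"])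
  have U': "inv_into U \<phi> z \<in> U'" "inv_into U \<phi> z \<in> U" if "z \<in> V'" for z
    using that chart by (auto simp: V'_def)
  let ?T = "\<lambda>z. \<phi>' (inv_into U \<phi> z)"
  let ?D = "\<lambda>j z. frechet_derivative (\<lambda>y. \<phi> (inv_into U' \<phi>' y)) (at (?T z)) (axis j 1)"
  have T: "smooth_on V' ?T"
    by (rule smooth_on_subset[OF smooth_transition[OF chart c'(1)]]) (auto simp: V'_def)
  have D: "smooth_on V' (\<lambda>z. ?D j z)" for j
    by (rule smooth_on_compose[OF o open_overlap[OF c'(1) chart] T smooth_on_frechet[OF smooth_transition[OF c'(1) chart]]])
       (use U' in auto)
  have e: "bundle_coord A (U', \<phi>') (sec z)
      = (?T z, \<chi> j. \<Sum>i\<in>UNIV. ?D j z $ i *\<^sub>R u z (chart_vec A U \<phi> (inv_into U \<phi> z) (axis i 1)))" if z: "z \<in> V'" for z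
  proof -
    have "u z (coord_vec A (U', \<phi>') (inv_into U \<phi> z) j)
        = (\<Sum>i\<in>UNIV. ?D j z $ i *\<^sub>R u z (chart_vec A U \<phi> (inv_into U \<phi> z) (axis i 1)))" for j
      unfolding coord_vec_chart[OF c'(1) U'(1)[OF z]] chart_vec_change[OF chart U'(2)[OF z] c'(1) U'(1)[OF z]]
      by (rule linear_axis_sum[OF coframe_linear[OF in_bundle chart U'(2)[OF z]]]) (use z sub in auto)
    then show ?thesis by (simp add: bundle_coord_def sec_def)
  qed
  have "smooth_on V' (\<lambda>z. bundle_coord A (U', \<phi>') (sec z))"
  proof (rule smooth_on_cong[OF o _ e[symmetric]])
    show "smooth_on V' (\<lambda>z. (?T z, \<chi> j. \<Sum>i\<in>UNIV. ?D j z $ i *\<^sub>R u z (chart_vec A U \<phi> (inv_into U \<phi> z) (axis i 1))))"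
    proof (rule smooth_on_Pair[OF o T], rule smooth_on_vec[OF o])
      show "smooth_on V' (\<lambda>z. (\<chi> j. \<Sum>i\<in>UNIV. ?D j z $ i *\<^sub>R u z (chart_vec A U \<phi> (inv_into U \<phi> z) (axis i 1))) $ j)" for j
        unfolding vec_lambda_beta
        by (intro smooth_on_sum[OF o] smooth_on_scaleR[OF o] smooth_on_vec_nth[OF o D] smooth_on_subset[OF frame_smooth sub])
    qed
  qed
  with o yV sub U'(1) show thesis by (rule that)
qed

lemma chart_sec:
  assumes y: "y \<in> V" and K: "(D, K) \<in> \<Phi>" "sec y \<in> D"
  obtains V' where "open V'" "y \<in> V'" "V' \<subseteq> V" "\<And>z. z \<in> V' \<Longrightarrow> sec z \<in> D" "smooth_on V' (\<lambda>z. K (sec z))"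
proof -
  obtain U' \<phi>' where c: "(U', \<phi>') \<in> A" and D: "D = {x \<in> F. fst x \<in> U'}" and Kd: "K = bundle_coord A (U', \<phi>')"
    by (rule bundle_chartE[OF K(1)])
  have "inv_into U \<phi> y \<in> U'" using K(2) by (simp add: D base)
  from bundle_coord_sec[OF y c this] obtain V' where V': "open V'" "y \<in> V'" "V' \<subseteq> V" "\<And>z. z \<in> V' \<Longrightarrow> inv_into U \<phi> z \<in> U'"
    "smooth_on V' (\<lambda>z. bundle_coord A (U', \<phi>') (sec z))" by blast
  show thesis
    by (rule that[OF V'(1-3)]) (use V' sec_bundle in \<open>auto simp: D Kd base\<close>)
qed

lemma smooth_curve_sec:
  assumes y: "y \<in> V"
  shows "smooth_curve \<Phi> (\<lambda>t. sec (y + t *\<^sub>R h))"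
proof -
  have m: "sec y \<in> {x \<in> F. fst x \<in> U}" using sec_bundle[OF y] base(1)[OF y] by (simp add: base)
  obtain V' where V': "open V'" "y \<in> V'" "V' \<subseteq> V" "\<And>z. z \<in> V' \<Longrightarrow> sec z \<in> {x \<in> F. fst x \<in> U}"
    "smooth_on V' (\<lambda>z. bundle_coord A (U, \<phi>) (sec z))"
    by (rule chart_sec[OF y bundle_chart[OF chart] m]) blast
  obtain \<delta> where \<delta>: "\<delta> > 0" "\<And>t. \<bar>t\<bar> < \<delta> \<Longrightarrow> y + t *\<^sub>R h \<in> V'"
    by (rule line_interval[OF V'(1,2), of h]) blast
  have I: "t \<in> {-\<delta><..<\<delta>} \<Longrightarrow> y + t *\<^sub>R h \<in> V'" for t by (rule \<delta>(2)) auto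
  have "smooth_on {-\<delta><..<\<delta>} (\<lambda>t. bundle_coord A (U, \<phi>) (sec (y + t *\<^sub>R h)))"
    by (rule smooth_on_compose[OF _ V'(1) smooth_on_line V'(5)]) (use I in auto)
  then show ?thesis
    unfolding smooth_curve_def
    by (intro bexI[OF _ bundle_chart[OF chart]]) (use \<delta> V'(4) in \<open>auto simp: o_def intro!: exI[of _ \<delta>]\<close>)
qed

lemma lift_tangent: "y \<in> V \<Longrightarrow> lift y h \<in> tangent_space \<Phi> (sec y)"
  unfolding tangent_space_def lift_def using smooth_curve_sec[of y h]
  by (auto intro!: exI[of _ "\<lambda>t. sec (y + t *\<^sub>R h)"])

lemma smooth_at_sec:
  fixes f :: "'m coframe \<Rightarrow> 'b::real_normed_vector"
  assumes y: "y \<in> V" and f: "smooth_at \<Phi> (sec y) f"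
  obtains V' where "open V'" "y \<in> V'" "V' \<subseteq> V" "smooth_on V' (\<lambda>z. f (sec z))"
proof -
  obtain D K S g where K: "(D, K) \<in> \<Phi>" "sec y \<in> D" and S: "open S" "K (sec y) \<in> S" "smooth_on S g"
    and fg: "\<And>q. q \<in> D \<Longrightarrow> K q \<in> S \<Longrightarrow> f q = g (K q)"
    using f unfolding smooth_at_def by blast
  obtain V' where V': "open V'" "y \<in> V'" "V' \<subseteq> V" "\<And>z. z \<in> V' \<Longrightarrow> sec z \<in> D" "smooth_on V' (\<lambda>z. K (sec z))"
    by (rule chart_sec[OF y K]) blast
  define V'' where "V'' = {z \<in> V'. K (sec z) \<in> S}"
  have o: "open V''" unfolding V''_def by (rule open_preimage_smooth[OF V'(1,5) S(1)])
  have "smooth_on V'' (\<lambda>z. g (K (sec z)))"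
    by (rule smooth_on_compose[OF o S(1) smooth_on_subset[OF V'(5)] S(3)]) (auto simp: V''_def)
  then have "smooth_on V'' (\<lambda>z. f (sec z))"
    by (rule smooth_on_cong[OF o]) (use V'(4) fg in \<open>auto simp: V''_def\<close>)
  then show thesis by (rule that[OF o, rotated 2]) (use V' S in \<open>auto simp: V''_def\<close>)
qed

lemma smooth_function_sec:
  fixes f :: "'m coframe \<Rightarrow> 'b::real_normed_vector"
  assumes "\<And>x. x \<in> F \<Longrightarrow> smooth_at \<Phi> x f"
  shows "smooth_on V (\<lambda>y. f (sec y))"
proof (rule smooth_on_local)
  fix y assume y: "y \<in> V"
  from smooth_at_sec[OF y assms[OF sec_bundle[OF y]]]
  show "\<exists>T. open T \<and> y \<in> T \<and> smooth_on T (\<lambda>y. f (sec y))" by metis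
qed

lemma lift_apply:
  assumes y: "y \<in> V" and f: "smooth_at \<Phi> (sec y) f"
  shows "lift y h f = frechet_derivative (\<lambda>z. f (sec z)) (at y) h"
proof -
  obtain V' where V': "open V'" "y \<in> V'" "V' \<subseteq> V" "smooth_on V' (\<lambda>z. f (sec z))"
    by (rule smooth_at_sec[OF y f]) blast
  have "(\<lambda>z. f (sec z)) differentiable (at (y + 0 *\<^sub>R h))"
    using smooth_on_differentiable[OF V'(4,2)] by simp
  from DERIV_imp_deriv[OF line_derivative[OF this]]
  show ?thesis using f by (simp add: lift_def velocity_def o_def)
qed

lemma d0_lift:
  assumes y: "y \<in> V" and f: "smooth_at \<Phi> (sec y) f"
  shows "d0 f (lift y (axis j 1)) = pd j (\<lambda>z. f (sec z)) y"
proof -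
  obtain V' where V': "open V'" "y \<in> V'" "V' \<subseteq> V" "smooth_on V' (\<lambda>z. f (sec z))"
    by (rule smooth_at_sec[OF y f]) blast
  have d: "(\<lambda>z. f (sec z)) differentiable (at y)" by (rule smooth_on_differentiable[OF V'(4,2)])
  obtain D K S g where K: "(D, K) \<in> \<Phi>" "sec y \<in> D" and S: "open S" "K (sec y) \<in> S" "smooth_on S g"
    and fg: "\<forall>q\<in>D. K q \<in> S \<longrightarrow> f q = g (K q)"
    using f unfolding smooth_at_def by blast
  have "smooth_at \<Phi> (sec y) (\<lambda>q. L (f q))" if "bounded_linear L" for L :: "complex \<Rightarrow> real"
    unfolding smooth_at_def
    by (rule bexI[OF _ K(1)])
       (use K S fg smooth_on_bounded_linear[OF that S(1,3)] in \<open>auto intro!: exI[of _ S] exI[of _ "\<lambda>z. L (g z)"]\<close>)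
  then have s: "smooth_at \<Phi> (sec y) (\<lambda>q. Re (f q))" "smooth_at \<Phi> (sec y) (\<lambda>q. Im (f q))"
    using bounded_linear_Re bounded_linear_Im by blast+
  show ?thesis
    unfolding d0_def lift_apply[OF y s(1)] lift_apply[OF y s(2)] pd_def
      frechet_derivative_bounded_linear[OF bounded_linear_Re d] frechet_derivative_bounded_linear[OF bounded_linear_Im d]
    by simp
qed

lemma dcoord_lift:
  assumes y: "y \<in> V" and K: "(D, K) \<in> \<Phi>" "sec y \<in> D"
  shows "dcoord K (lift y h) = frechet_derivative (\<lambda>z. K (sec z)) (at y) h"
proof (rule euclidean_eqI)
  fix b :: "(real^6) \<times> ((complex^3)^6)" assume b: "b \<in> Basis"
  obtain V' where V': "open V'" "y \<in> V'" "V' \<subseteq> V" "\<And>z. z \<in> V' \<Longrightarrow> sec z \<in> D" "smooth_on V' (\<lambda>z. K (sec z))"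
    by (rule chart_sec[OF y K]) blast
  have "smooth_on UNIV (\<lambda>z. z \<bullet> b)" by (intro smooth_on_inner open_UNIV smooth_on_id smooth_on_const)
  then have s: "smooth_at \<Phi> (sec y) (\<lambda>q. K q \<bullet> b)"
    unfolding smooth_at_def
    by (intro bexI[OF _ K(1)]) (use K in \<open>auto intro!: exI[of _ UNIV] exI[of _ "\<lambda>z. z \<bullet> b"]\<close>)
  show "dcoord K (lift y h) \<bullet> b = frechet_derivative (\<lambda>z. K (sec z)) (at y) h \<bullet> b"
    unfolding dcoord_inner[OF b] lift_apply[OF y s]
    by (rule frechet_derivative_bounded_linear[OF bounded_linear_inner_left smooth_on_differentiable[OF V'(5,2)]])
qed

lemma form_rep_sec:
  assumes y: "y \<in> V" and rep: "form1_rep \<Phi> \<omega> (sec y) K W"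
  obtains V' S where "open V'" "y \<in> V'" "V' \<subseteq> V" "open S" "smooth_on V' (\<lambda>z. K (sec z))"
    "\<And>z. z \<in> V' \<Longrightarrow> K (sec z) \<in> S" "\<And>h. smooth_on S (\<lambda>x. W x h)" "\<And>x. x \<in> S \<Longrightarrow> linear (W x)"
    "\<And>z h. z \<in> V' \<Longrightarrow> \<omega> (sec z) (lift z h) = W (K (sec z)) (frechet_derivative (\<lambda>z. K (sec z)) (at z) h)"
    "\<And>h. dcoord K (lift y h) = frechet_derivative (\<lambda>z. K (sec z)) (at y) h"
proof -
  obtain D S where K: "(D, K) \<in> \<Phi>" "sec y \<in> D" and S: "open S" "K (sec y) \<in> S"
    and W: "\<And>h. smooth_on S (\<lambda>x. W x h)" "\<And>x. x \<in> S \<Longrightarrow> linear (W x)"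
    and eq: "\<And>q v. q \<in> D \<Longrightarrow> K q \<in> S \<Longrightarrow> v \<in> tangent_space \<Phi> q \<Longrightarrow> \<omega> q v = W (K q) (dcoord K v)"
    using rep unfolding form1_rep_def by blast
  obtain V' where V': "open V'" "y \<in> V'" "V' \<subseteq> V" "\<And>z. z \<in> V' \<Longrightarrow> sec z \<in> D" "smooth_on V' (\<lambda>z. K (sec z))"
    by (rule chart_sec[OF y K]) blast
  define V'' where "V'' = {z \<in> V'. K (sec z) \<in> S}"
  have o: "open V''" unfolding V''_def by (rule open_preimage_smooth[OF V'(1,5) S(1)])
  have in': "z \<in> V" "sec z \<in> D" "K (sec z) \<in> S" if "z \<in> V''" for z using that V' by (auto simp: V''_def)
  show thesis
  proof (rule that[OF o _ _ S(1) _ _ W])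
    show "y \<in> V''" "V'' \<subseteq> V" using V' S by (auto simp: V''_def)
    show "smooth_on V'' (\<lambda>z. K (sec z))" by (rule smooth_on_subset[OF V'(5)]) (auto simp: V''_def)
    show "\<omega> (sec z) (lift z h) = W (K (sec z)) (frechet_derivative (\<lambda>z. K (sec z)) (at z) h)" if "z \<in> V''" for z h
      unfolding eq[OF in'(2,3)[OF that] lift_tangent[OF in'(1)[OF that]]] dcoord_lift[OF in'(1)[OF that] K(1) in'(2)[OF that]] ..
    show "dcoord K (lift y h) = frechet_derivative (\<lambda>z. K (sec z)) (at y) h" for h
      by (rule dcoord_lift[OF y K])
  qed (rule in'(3))
qed

lemma smooth_pull:
  assumes "smooth_form1 \<Phi> F \<omega>"
  shows "smooth_on V (pull \<omega> j)"
proof (rule smooth_on_local)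
  fix y assume y: "y \<in> V"
  obtain K W where rep: "form1_rep \<Phi> \<omega> (sec y) K W"
    using assms sec_bundle[OF y] unfolding smooth_form1_def by blast
  obtain V' S where V': "open V'" "y \<in> V'" "V' \<subseteq> V" "open S" "smooth_on V' (\<lambda>z. K (sec z))"
    "\<And>z. z \<in> V' \<Longrightarrow> K (sec z) \<in> S" "\<And>h. smooth_on S (\<lambda>x. W x h)" "\<And>x. x \<in> S \<Longrightarrow> linear (W x)"
    "\<And>z h. z \<in> V' \<Longrightarrow> \<omega> (sec z) (lift z h) = W (K (sec z)) (frechet_derivative (\<lambda>z. K (sec z)) (at z) h)"
    by (rule form_rep_sec[OF y rep]) blast
  have "smooth_on V' (pull \<omega> j)"
    by (rule smooth_on_cong[OF V'(1) pullback_form(1)[OF V'(1,4,5,6,7,8), of j]]) (simp_all add: pull_def V'(9))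
  then show "\<exists>T. open T \<and> y \<in> T \<and> smooth_on T (pull \<omega> j)" using V' by blast
qed

text \<open>\<open>d1\<close> is computed from an arbitrarily chosen coordinate expression.
  \<open>pullback_form\<close> holds for each of them, so the result on lifted vectors does not
  depend on the choice.\<close>

lemma d1_lift:
  assumes \<omega>: "smooth_form1 \<Phi> F \<omega>" and y: "y \<in> V"
  shows "d1 \<Phi> \<omega> (sec y) (lift y (axis j 1)) (lift y (axis k 1)) = pd j (pull \<omega> k) y - pd k (pull \<omega> j) y"
proof -
  obtain K W where KW: "(K, W) = (SOME (K, W). form1_rep \<Phi> \<omega> (sec y) K W)" by (metis surj_pair)
  have "\<exists>KW. case KW of (K, W) \<Rightarrow> form1_rep \<Phi> \<omega> (sec y) K W"
    using \<omega> sec_bundle[OF y] unfolding smooth_form1_def by auto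
  from someI_ex[OF this] have rep: "form1_rep \<Phi> \<omega> (sec y) K W" unfolding KW[symmetric] by simp
  obtain V' S where V': "open V'" "y \<in> V'" "V' \<subseteq> V" "open S" "smooth_on V' (\<lambda>z. K (sec z))"
    "\<And>z. z \<in> V' \<Longrightarrow> K (sec z) \<in> S" "\<And>h. smooth_on S (\<lambda>x. W x h)" "\<And>x. x \<in> S \<Longrightarrow> linear (W x)"
    "\<And>z h. z \<in> V' \<Longrightarrow> \<omega> (sec z) (lift z h) = W (K (sec z)) (frechet_derivative (\<lambda>z. K (sec z)) (at z) h)"
    "\<And>h. dcoord K (lift y h) = frechet_derivative (\<lambda>z. K (sec z)) (at y) h"
    by (rule form_rep_sec[OF y rep]) blast
  let ?P = "\<lambda>l z. W (K (sec z)) (frechet_derivative (\<lambda>z. K (sec z)) (at z) (axis l 1))"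
  have e: "pd j (pull \<omega> k) y = pd j (?P k) y" for j k
    by (rule pd_cong[OF V'(1) pullback_form(1)[OF V'(1,4,5,6,7,8)] V'(2), symmetric]) (simp_all add: pull_def V'(9))
  have "pd j (?P k) y - pd k (?P j) y =
      frechet_derivative (\<lambda>x. W x (frechet_derivative (\<lambda>z. K (sec z)) (at y) (axis k 1))) (at (K (sec y)))
        (frechet_derivative (\<lambda>z. K (sec z)) (at y) (axis j 1))
      - frechet_derivative (\<lambda>x. W x (frechet_derivative (\<lambda>z. K (sec z)) (at y) (axis j 1))) (at (K (sec y)))
        (frechet_derivative (\<lambda>z. K (sec z)) (at y) (axis k 1))"
    by (rule pullback_form(2)[OF V'(1,4,5,6,7,8,2)])
  then show ?thesis
    unfolding d1_def KW[symmetric] e by (simp add: V'(10))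
qed

lemma pull_tautological:
  assumes y: "y \<in> V"
  shows "tautological_form A i (sec y) (lift y h) = u y (chart_vec A U \<phi> (inv_into U \<phi> y) h) $ i"
proof -
  have "dproj A (fst (sec y)) (lift y h) = velocity A (\<lambda>t. fst (sec (y + t *\<^sub>R h)))"
    using dproj_velocity[OF smooth_curve_sec[OF y, of h]] by (simp add: lift_def)
  also have "\<dots> = velocity A (\<lambda>t. inv_into U \<phi> (\<phi> (inv_into U \<phi> y) + t *\<^sub>R h))"
    by (simp add: base(2)[OF y] base(3))
  also have "\<dots> = chart_vec A U \<phi> (inv_into U \<phi> y) h"
    by (rule chart_vec_velocity(2)[OF chart base(1)[OF y]])
  finally show ?thesis by (simp add: tautological_form_def sec_def)
qed

end

section \<open>Unitary frames\<close>

lemma linear_inj_surj: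
  fixes L :: "'a::euclidean_space \<Rightarrow> 'b::euclidean_space"
  assumes L: "linear L" and ker: "\<And>v. L v = 0 \<Longrightarrow> v = 0" and dim: "DIM('a) = DIM('b)"
  shows "surj L"
proof -
  have inj: "inj L" using linear_injective_0[OF L] ker by blast
  have "dim (range L) = DIM('a)"
    using dim_image_eq[OF L, of UNIV] inj by simp
  then have "span (range L) = (UNIV :: 'b set)" using dim dim_eq_full[of "range L"] by simp
  moreover have "span (range L) = range L"
    using linear_subspace_image[OF L subspace_UNIV] by (simp add: span_eq_iff)
  ultimately show ?thesis by simp
qed

lemma linear_kernel_nontrivial:
  fixes L :: "'a::euclidean_space \<Rightarrow> 'b::euclidean_space"
  assumes L: "linear L" and dim: "DIM('b) < DIM('a)"
  obtains v where "v \<noteq> 0" "L v = 0"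
proof (rule ccontr)
  assume "\<not> thesis"
  then have "inj L" using linear_injective_0[OF L] that by blast
  then have "dim (range L) = DIM('a)" using dim_image_eq[OF L, of UNIV] by simp
  then show False using dim dim_subset_UNIV[of "range L"] by simp
qed

section \<open>Hermitian linear algebra in a chart\<close>

locale local_structure = coframe_setting A J \<eta>
  for A :: "('m::{t2_space,second_countable_topology}, real^6) atlas" and J \<eta> +
  fixes U :: "'m set" and \<phi> :: "'m \<Rightarrow> real^6" and V :: "(real^6) set"
    and Jc :: "real^6 \<Rightarrow> real^6 \<Rightarrow> real^6" and Hc :: "real^6 \<Rightarrow> real^6 \<Rightarrow> real^6 \<Rightarrow> real"
  assumes struct: "R_U3_structure A J \<eta>"
    and chart: "(U, \<phi>) \<in> A" and V: "open V" "V \<subseteq> \<phi> ` U"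
    and Jc: "\<And>y h. y \<in> V \<Longrightarrow> J (inv_into U \<phi> y) (chart_vec A U \<phi> (inv_into U \<phi> y) h)
      = chart_vec A U \<phi> (inv_into U \<phi> y) (Jc y h)"
    and Hc: "\<And>y h h'. y \<in> V \<Longrightarrow> \<eta> (inv_into U \<phi> y) (chart_vec A U \<phi> (inv_into U \<phi> y) h)
      (chart_vec A U \<phi> (inv_into U \<phi> y) h') = Hc y h h'"
    and smooth_Jc: "\<And>h. smooth_on V (\<lambda>y. Jc y h)" and smooth_Hc: "\<And>h h'. smooth_on V (\<lambda>y. Hc y h h')"
    and linear_Jc: "\<And>y. y \<in> V \<Longrightarrow> linear (Jc y)" and bilinear_Hc: "\<And>y. y \<in> V \<Longrightarrow> bilinear (Hc y)"
    and alt_Hc: "\<And>y h h'. y \<in> V \<Longrightarrow> Hc y h h' = - Hc y h' h"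
begin

abbreviation "tv y \<equiv> chart_vec A U \<phi> (inv_into U \<phi> y)"

lemma base: "y \<in> V \<Longrightarrow> inv_into U \<phi> y \<in> U" "y \<in> V \<Longrightarrow> \<phi> (inv_into U \<phi> y) = y"
  by (rule chart_inv, erule subsetD[OF V(2)])+

lemma tv_tangent: "y \<in> V \<Longrightarrow> tv y h \<in> tangent_space A (inv_into U \<phi> y)"
  by (rule chart_vec_tangent[OF chart base(1)])

lemma dcoord_tv: "y \<in> V \<Longrightarrow> dcoord \<phi> (tv y h) = h"
  by (rule dcoord_chart_vec[OF chart base(1)])

lemma Jc_Jc: assumes y: "y \<in> V" shows "Jc y (Jc y h) = - h"
proof -
  have "tv y (Jc y (Jc y h)) = (\<lambda>f. - tv y h f)"
    using struct tv_tangent[OF y, of h] unfolding R_U3_structure_def almost_complex_structure_def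
    by (simp flip: Jc[OF y])
  also have "\<dots> = tv y (- h)"
    using chart_vec_linear[OF chart base(1)[OF y], of "-1" h 0 0] by simp
  finally have "dcoord \<phi> (tv y (Jc y (Jc y h))) = dcoord \<phi> (tv y (- h))" by simp
  then show ?thesis by (simp only: dcoord_tv[OF y])
qed

lemma Hc_Jc: "y \<in> V \<Longrightarrow> Hc y (Jc y h) (Jc y h') = Hc y h h'"
  using struct tv_tangent[of y h] tv_tangent[of y h']
  unfolding R_U3_structure_def positive_form11_def by (simp flip: Hc Jc)

lemma Hc_pos: assumes y: "y \<in> V" and h: "h \<noteq> 0" shows "Hc y h (Jc y h) > 0"
proof -
  have "tv y h \<noteq> (\<lambda>f. 0)"
  proof
    assume "tv y h = (\<lambda>f. 0)"
    then have "dcoord \<phi> (tv y h) = 0" by (simp add: dcoord_def)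
    then show False using h dcoord_tv[OF y] by simp
  qed
  then show ?thesis
    using struct tv_tangent[OF y, of h] unfolding R_U3_structure_def positive_form11_def
    by (simp flip: Hc[OF y] Jc[OF y])
qed

lemma Hc_linear:
  assumes "y \<in> V"
  shows "Hc y (a + b) c = Hc y a c + Hc y b c" "Hc y (r *\<^sub>R a) c = r * Hc y a c"
    "Hc y c (a + b) = Hc y c a + Hc y c b" "Hc y c (r *\<^sub>R a) = r * Hc y c a"
  using bilinear_Hc[OF assms] by (simp_all add: bilinear_ladd bilinear_radd bilinear_lmul bilinear_rmul)

lemma Jc_linear:
  assumes "y \<in> V"
  shows "Jc y (a + b) = Jc y a + Jc y b" "Jc y (r *\<^sub>R a) = r *\<^sub>R Jc y a"
  using linear_Jc[OF assms] by (simp_all add: linear_add linear_cmul)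

lemma Hc_Jc_swap:
  assumes y: "y \<in> V"
  shows "Hc y (Jc y h) h' = - Hc y h (Jc y h')"
  using Hc_Jc[OF y, of h "Jc y h'"] Jc_Jc[OF y, of h'] Hc_linear(4)[OF y, of "Jc y h" "-1" h'] by simp

text \<open>The Hermitian form with imaginary part \<open>-\<eta>/m\<close>, conjugate-linear in the second argument.\<close>

definition hm :: "real \<Rightarrow> real^6 \<Rightarrow> real^6 \<Rightarrow> real^6 \<Rightarrow> complex" where
  "hm m y v w = Complex (Hc y v (Jc y w) / m) (- Hc y v w / m)"

text \<open>Multiplication by a complex scalar for the complex structure
  \<open>Jc y\<close>.\<close>

definition cs :: "real^6 \<Rightarrow> complex \<Rightarrow> real^6 \<Rightarrow> real^6" where
  "cs y c v = Re c *\<^sub>R v + Im c *\<^sub>R Jc y v"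

lemma hm_linear:
  assumes "y \<in> V"
  shows "hm m y (a + b) c = hm m y a c + hm m y b c" "hm m y (r *\<^sub>R a) c = of_real r * hm m y a c"
    "hm m y c (a + b) = hm m y c a + hm m y c b" "hm m y c (r *\<^sub>R a) = of_real r * hm m y c a"
  by (simp_all add: hm_def complex_eq_iff Hc_linear[OF assms] Jc_linear[OF assms] add_divide_distrib diff_divide_distrib)

lemma hm_Jc:
  assumes y: "y \<in> V"
  shows "hm m y (Jc y a) c = \<i> * hm m y a c" "hm m y c (Jc y a) = - \<i> * hm m y c a"
proof -
  show "hm m y (Jc y a) c = \<i> * hm m y a c"
    using Hc_Jc_swap[OF y, of a c] by (simp add: hm_def complex_eq_iff Hc_Jc[OF y])
  have "Hc y c (- a) = - Hc y c a" using Hc_linear(4)[OF y, of c "-1" a] by simp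
  then show "hm m y c (Jc y a) = - \<i> * hm m y c a"
    by (simp add: hm_def complex_eq_iff Jc_Jc[OF y])
qed

lemma hm_cs:
  assumes y: "y \<in> V"
  shows "hm m y (cs y r a) c = r * hm m y a c" "hm m y c (cs y r a) = cnj r * hm m y c a"
  unfolding cs_def hm_linear[OF y] hm_Jc[OF y] by (simp_all add: complex_eq_iff)

lemma hm_cnj:
  assumes y: "y \<in> V"
  shows "hm m y a b = cnj (hm m y b a)"
  using Hc_Jc_swap[OF y, of a b] alt_Hc[OF y, of "Jc y a" b] alt_Hc[OF y, of a b]
  by (simp add: hm_def complex_eq_iff)

lemma hm_self:
  assumes y: "y \<in> V"
  shows "hm m y a a = of_real (Hc y a (Jc y a) / m)"
  using alt_Hc[OF y, of a a] by (simp add: hm_def complex_eq_iff)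

lemma hm_diff:
  assumes "y \<in> V"
  shows "hm m y (a - b) c = hm m y a c - hm m y b c" "hm m y c (a - b) = hm m y c a - hm m y c b"
  using hm_linear(1)[OF assms, of m "a - b" b c] hm_linear(3)[OF assms, of m c "a - b" b] by simp_all

lemma hm_sum:
  fixes I :: "'i set"
  assumes y: "y \<in> V"
  shows "hm m y (\<Sum>i\<in>I. v i) c = (\<Sum>i\<in>I. hm m y (v i) c)" "hm m y c (\<Sum>i\<in>I. v i) = (\<Sum>i\<in>I. hm m y c (v i))"
proof -
  have l: "linear (\<lambda>v. hm m y v c)" "linear (\<lambda>v. hm m y c v)"
    by (auto intro!: linearI simp: hm_linear[OF y] scaleR_conv_of_real[where 'a=complex])
  show "hm m y (\<Sum>i\<in>I. v i) c = (\<Sum>i\<in>I. hm m y (v i) c)" "hm m y c (\<Sum>i\<in>I. v i) = (\<Sum>i\<in>I. hm m y c (v i))"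
    using linear_sum[OF l(1)] linear_sum[OF l(2)] by auto
qed

definition unitary :: "real \<Rightarrow> real^6 \<Rightarrow> (3 \<Rightarrow> real^6) \<Rightarrow> bool" where
  "unitary m y f \<longleftrightarrow> (\<forall>i j. hm m y (f i) (f j) = (if i = j then 1 else 0))"

text \<open>Pairing with the vectors \<open>f j\<close> recovers the coefficients of a complex
  combination, so the combination map from \<open>complex^3\<close> is injective, and by equality of
  real dimensions it is onto.\<close>

lemma unitary_expansion:
  assumes y: "y \<in> V" and f: "unitary m y f"
  shows "v = (\<Sum>i\<in>UNIV. cs y (hm m y v (f i)) (f i))"
proof -
  define L where "L = (\<lambda>c::complex^3. \<Sum>i\<in>UNIV. cs y (c $ i) (f i))"
  have hL: "hm m y (L c) (f j) = c $ j" for c j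
    using f unfolding L_def hm_sum[OF y] hm_cs[OF y] unitary_def by (simp add: if_distrib[of "(*) _"] cong: if_cong)
  have "linear L"
    unfolding L_def
    by (rule linearI) (simp_all add: cs_def algebra_simps sum.distrib scaleR_sum_right)
  moreover have "c = 0" if "L c = 0" for c
    using hL[of c] hm_linear(2)[OF y, of m 0 0] that by (simp add: vec_eq_iff)
  moreover have "DIM(complex^3) = DIM(real^6)" by simp
  ultimately have "surj L" by (rule linear_inj_surj)
  then obtain c where c: "v = L c" by (metis surjD)
  have ci: "hm m y v (f i) = c $ i" for i unfolding c by (rule hL)
  show ?thesis unfolding ci unfolding c L_def ..
qed

definition coframe_of :: "real \<Rightarrow> real^6 \<Rightarrow> (3 \<Rightarrow> real^6) \<Rightarrow> 'm tvec \<Rightarrow> complex^3" where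
  "coframe_of m y f v = (if v \<in> tangent_space A (inv_into U \<phi> y) then \<chi> i. hm m y (dcoord \<phi> v) (f i) else 0)"

lemma coframe_of_tv: "y \<in> V \<Longrightarrow> coframe_of m y f (tv y h) = (\<chi> i. hm m y h (f i))"
  by (simp add: coframe_of_def tv_tangent dcoord_tv)

lemma tangent_tv: "y \<in> V \<Longrightarrow> v \<in> tangent_space A (inv_into U \<phi> y) \<Longrightarrow> \<exists>h. v = tv y h"
  unfolding tangent_space_chart[OF chart base(1)] by auto

lemma coframe_of_bundle:
  assumes y: "y \<in> V" and f: "unitary m y f" and m: "m > 0"
  shows "(inv_into U \<phi> y, coframe_of m y f) \<in> F"
  unfolding coframe_bundle_def conformally_unitary_def J_linear_coframe_def mem_Collect_eq case_prod_conv
proof (intro conjI ballI allI impI exI[of _ m])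
  note tv = tangent_tv[OF y]
  show "coframe_of m y f (\<lambda>g. a * v g + b * w g) = a *\<^sub>R coframe_of m y f v + b *\<^sub>R coframe_of m y f w"
    if vw: "v \<in> tangent_space A (inv_into U \<phi> y)" "w \<in> tangent_space A (inv_into U \<phi> y)" for v w a b
  proof -
    obtain h h' where h: "v = tv y h" "w = tv y h'" using tv[OF vw(1)] tv[OF vw(2)] by blast
    show ?thesis
      unfolding h chart_vec_linear[OF chart base(1)[OF y], symmetric] coframe_of_tv[OF y]
      by (simp add: vec_eq_iff hm_linear[OF y] scaleR_conv_of_real[where 'a=complex])
  qed
  show "coframe_of m y f (J (inv_into U \<phi> y) v) = \<i> *s coframe_of m y f v"
    if vT: "v \<in> tangent_space A (inv_into U \<phi> y)" for v
  proof -
    obtain h where h: "v = tv y h" using tv[OF vT] by blast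
    show ?thesis unfolding h Jc[OF y] coframe_of_tv[OF y] by (simp add: vec_eq_iff hm_Jc[OF y])
  qed
  show "c i = 0" if "\<forall>v\<in>tangent_space A (inv_into U \<phi> y). (\<Sum>i\<in>UNIV. c i * coframe_of m y f v $ i) = 0" for c i
  proof -
    have "(\<Sum>j\<in>UNIV. c j * coframe_of m y f (tv y (f i)) $ j) = 0" using that tv_tangent[OF y] by blast
    then show ?thesis using f unfolding coframe_of_tv[OF y] unitary_def
      by (simp add: if_distrib[of "(*) _"] cong: if_cong)
  qed
  show "0 < m" by (rule m)
  show "complex_of_real (\<eta> (inv_into U \<phi> y) v w) = of_real m * (\<i> / 2) *
      (\<Sum>i\<in>UNIV. wedge (\<lambda>x. coframe_of m y f x $ i) (\<lambda>x. cnj (coframe_of m y f x $ i)) v w)"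
    if vw: "v \<in> tangent_space A (inv_into U \<phi> y)" "w \<in> tangent_space A (inv_into U \<phi> y)" for v w
  proof -
    obtain h h' where h: "v = tv y h" "w = tv y h'" using tv[OF vw(1)] tv[OF vw(2)] by blast
    \<comment> \<open>Parseval's identity, which turns the sum of wedge products into the imaginary
      part of \<open>hm\<close>, a multiple of \<open>\<eta>\<close>.\<close>
    have e: "(\<Sum>i\<in>UNIV. hm m y a (f i) * cnj (hm m y b (f i))) = hm m y a b" for a b
    proof -
      have "hm m y a b = hm m y a (\<Sum>i\<in>UNIV. cs y (hm m y b (f i)) (f i))"
        using unitary_expansion[OF y f, of b] by metis
      then show ?thesis unfolding hm_sum[OF y] hm_cs[OF y] by (simp add: mult.commute)
    qed
    have "(\<Sum>i\<in>UNIV. wedge (\<lambda>x. coframe_of m y f x $ i) (\<lambda>x. cnj (coframe_of m y f x $ i)) v w)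
        = hm m y h h' - hm m y h' h"
      unfolding wedge_def h coframe_of_tv[OF y] vec_lambda_beta sum_subtractf e
      using e[of h' h] by (simp add: mult.commute)
    also have "\<dots> = - 2 * \<i> * of_real (Hc y h h' / m)"
      unfolding hm_cnj[OF y, of m h' h] by (simp add: hm_def complex_eq_iff)
    finally show ?thesis using m unfolding h Hc[OF y] by simp
  qed
  show "coframe_of m y f v = 0" if "v \<notin> tangent_space A (inv_into U \<phi> y)" for v
    using that by (simp add: coframe_of_def)
qed

lemma smooth_Jc_field:
  assumes "open W" "W \<subseteq> V" "smooth_on W v"
  shows "smooth_on W (\<lambda>y. Jc y (v y))"
  by (rule smooth_on_linear_family[OF assms(1) smooth_on_subset[OF smooth_Jc assms(2)] linear_Jc assms(3)])
     (use assms(2) in auto)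

lemma smooth_Hc_field:
  assumes "open W" "W \<subseteq> V" "smooth_on W v" "smooth_on W w"
  shows "smooth_on W (\<lambda>y. Hc y (v y) (w y))"
  by (rule smooth_on_bilinear_family[OF assms(1) smooth_on_subset[OF smooth_Hc assms(2)] bilinear_Hc assms(3,4)])
     (use assms(2) in auto)

lemma smooth_hm:
  assumes "open W" "W \<subseteq> V" "smooth_on W v" "smooth_on W w"
  shows "smooth_on W (\<lambda>y. hm m y (v y) (w y))"
proof -
  have e: "hm m y a b = of_real (1 / m) * of_real (Hc y a (Jc y b)) - \<i> * of_real (1 / m) * of_real (Hc y a b)" for y a b
    by (simp add: hm_def complex_eq_iff)
  show ?thesis unfolding e
    by (intro smooth_on_diff smooth_on_mult smooth_on_const smooth_on_of_real smooth_Hc_field smooth_Jc_field assms)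
qed

lemma smooth_cs:
  assumes "open W" "W \<subseteq> V" "smooth_on W c" "smooth_on W v"
  shows "smooth_on W (\<lambda>y. cs y (c y) (v y))"
  unfolding cs_def
  by (intro smooth_on_add smooth_on_scaleR smooth_on_Re smooth_on_Im smooth_Jc_field assms)

lemma normalize:
  assumes W: "open W" "W \<subseteq> V" "y0 \<in> W" and w: "smooth_on W w" and 1: "hm m y0 (w y0) (w y0) = 1"
  obtains W' r where "open W'" "W' \<subseteq> W" "y0 \<in> W'" "smooth_on W' r" "r y0 = 1"
    "\<And>y. y \<in> W' \<Longrightarrow> hm m y (r y *\<^sub>R w y) (r y *\<^sub>R w y) = 1"
proof -
  define N where "N = (\<lambda>y. Re (hm m y (w y) (w y)))"
  have N: "smooth_on W N" unfolding N_def by (intro smooth_on_Re smooth_hm W w)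
  \<comment> \<open>Shrinking excludes zeros of \<open>w\<close>, where the factor
    \<open>N y powr (-1/2)\<close> would not be smooth.\<close>
  define W' where "W' = {y \<in> W. N y \<in> {0<..}}"
  have o: "open W'" unfolding W'_def by (rule open_preimage_smooth[OF W(1) N open_greaterThan])
  define r where "r = (\<lambda>y. N y powr (-1/2))"
  show thesis
  proof (rule that[OF o])
    show "W' \<subseteq> W" "y0 \<in> W'" using W 1 by (auto simp: W'_def N_def)
    show "smooth_on W' r" unfolding r_def
      by (rule smooth_on_compose[OF o open_greaterThan smooth_on_subset[OF N] smooth_on_powr]) (auto simp: W'_def)
    show "r y0 = 1" by (simp add: r_def N_def 1)
    fix y assume "y \<in> W'"
    then have y: "y \<in> V" "N y > 0" using W by (auto simp: W'_def)
    have "hm m y (w y) (w y) = of_real (N y)" unfolding N_def hm_self[OF y(1)] by simp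
    moreover have "r y * (r y * N y) = 1"
      using y(2) by (simp add: r_def mult.assoc[symmetric] powr_add[symmetric] powr_minus field_simps)
    ultimately show "hm m y (r y *\<^sub>R w y) (r y *\<^sub>R w y) = 1"
      unfolding hm_linear[OF y(1)] by (simp flip: of_real_mult)
  qed
qed

text \<open>The Gram-Schmidt process applied to the constant extensions of the \<open>v i\<close>.
  At \<open>y0\<close> these are already orthonormal, so the process returns them unchanged there.
  This is what allows a section through a prescribed coframe.\<close>

lemma unitary_extend:
  assumes y0: "y0 \<in> V" and v: "unitary m y0 v"
  obtains W f where "open W" "W \<subseteq> V" "y0 \<in> W" "\<And>i. smooth_on W (f i)" "\<And>i. f i y0 = v i"
    "\<And>y. y \<in> W \<Longrightarrow> unitary m y (\<lambda>i. f i y)"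
proof -
  have vd: "hm m y0 (v i) (v j) = (if i = j then 1 else 0)" for i j using v by (simp add: unitary_def)
  have cs0: "cs y0 0 w = 0" for w by (simp add: cs_def)
  obtain W1 r1 where W1: "open W1" "W1 \<subseteq> V" "y0 \<in> W1" "smooth_on W1 r1" "r1 y0 = 1"
    "\<And>y. y \<in> W1 \<Longrightarrow> hm m y (r1 y *\<^sub>R v 1) (r1 y *\<^sub>R v 1) = 1"
    by (rule normalize[OF V(1) subset_refl y0 smooth_on_const, of m "v 1"]) (use vd in auto)
  define f1 where "f1 = (\<lambda>y. r1 y *\<^sub>R v 1)"
  have f1: "smooth_on W1 f1" "f1 y0 = v 1" "\<And>y. y \<in> W1 \<Longrightarrow> hm m y (f1 y) (f1 y) = 1"
    unfolding f1_def using W1 by (auto intro!: smooth_on_scaleR)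
  define w2 where "w2 = (\<lambda>y. v 2 - cs y (hm m y (v 2) (f1 y)) (f1 y))"
  have w2: "smooth_on W1 w2" "w2 y0 = v 2"
    unfolding w2_def using W1 f1 by (auto intro!: smooth_on_diff smooth_cs smooth_hm simp: vd cs0)
  have w2o: "hm m y (w2 y) (f1 y) = 0" if "y \<in> W1" for y
    using that W1(2) f1(3)[OF that] unfolding w2_def by (simp add: hm_diff hm_cs subset_iff)
  obtain W2 r2 where W2: "open W2" "W2 \<subseteq> W1" "y0 \<in> W2" "smooth_on W2 r2" "r2 y0 = 1"
    "\<And>y. y \<in> W2 \<Longrightarrow> hm m y (r2 y *\<^sub>R w2 y) (r2 y *\<^sub>R w2 y) = 1"
    by (rule normalize[OF W1(1-3) w2(1), of m]) (use vd w2 in auto)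
  define f2 where "f2 = (\<lambda>y. r2 y *\<^sub>R w2 y)"
  have W2V: "W2 \<subseteq> V" using W1 W2 by blast
  have f2: "smooth_on W2 f2" "f2 y0 = v 2" "\<And>y. y \<in> W2 \<Longrightarrow> hm m y (f2 y) (f2 y) = 1"
    unfolding f2_def using W2 w2 smooth_on_subset[OF w2(1) W2(2)] by (auto intro!: smooth_on_scaleR)
  have f21: "hm m y (f2 y) (f1 y) = 0" if "y \<in> W2" for y
    using w2o[of y] that W2(2) W2V unfolding f2_def by (simp add: hm_linear subset_iff)
  have f12: "hm m y (f1 y) (f2 y) = 0" if "y \<in> W2" for y
    using hm_cnj[of y m "f1 y" "f2 y"] f21[OF that] that W2V by auto
  define w3 where "w3 = (\<lambda>y. v 3 - cs y (hm m y (v 3) (f1 y)) (f1 y) - cs y (hm m y (v 3) (f2 y)) (f2 y))"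
  have f1W2: "smooth_on W2 f1" by (rule smooth_on_subset[OF f1(1) W2(2)])
  have w3: "smooth_on W2 w3" "w3 y0 = v 3"
    unfolding w3_def using W2 W2V f1(2) f1W2 f2 by (auto intro!: smooth_on_diff smooth_cs smooth_hm simp: vd cs0)
  have w3o: "hm m y (w3 y) (f1 y) = 0" "hm m y (w3 y) (f2 y) = 0" if "y \<in> W2" for y
    using that W2(2) W2V f1(3)[of y] f2(3)[of y] f12[OF that] f21[OF that]
    unfolding w3_def by (auto simp: hm_diff hm_cs subset_iff)
  obtain W3 r3 where W3: "open W3" "W3 \<subseteq> W2" "y0 \<in> W3" "smooth_on W3 r3" "r3 y0 = 1"
    "\<And>y. y \<in> W3 \<Longrightarrow> hm m y (r3 y *\<^sub>R w3 y) (r3 y *\<^sub>R w3 y) = 1"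
    by (rule normalize[OF W2(1) W2V W2(3) w3(1), of m]) (use vd w3 in auto)
  define f3 where "f3 = (\<lambda>y. r3 y *\<^sub>R w3 y)"
  have W3V: "W3 \<subseteq> V" using W2V W3 by blast
  have f3: "smooth_on W3 f3" "f3 y0 = v 3" "\<And>y. y \<in> W3 \<Longrightarrow> hm m y (f3 y) (f3 y) = 1"
    unfolding f3_def using W3 w3 smooth_on_subset[OF w3(1) W3(2)] by (auto intro!: smooth_on_scaleR)
  have f3o: "hm m y (f3 y) (f1 y) = 0" "hm m y (f3 y) (f2 y) = 0" if "y \<in> W3" for y
    using w3o[of y] that W3(2) W3V unfolding f3_def by (auto simp: hm_linear subset_iff)
  have fo3: "hm m y (f1 y) (f3 y) = 0" "hm m y (f2 y) (f3 y) = 0" if "y \<in> W3" for y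
    using hm_cnj[of y m "f1 y" "f3 y"] hm_cnj[of y m "f2 y" "f3 y"] f3o[OF that] that W3V by auto
  define f where "f = (\<lambda>i::3. if i = 1 then f1 else if i = 2 then f2 else f3)"
  have W32: "y \<in> W2" "y \<in> W1" if "y \<in> W3" for y using that W3(2) W2(2) by auto
  show thesis
  proof (rule that[OF W3(1) W3V W3(3), of f])
    show "smooth_on W3 (f i)" for i
      using smooth_on_subset[OF f1W2 W3(2)] smooth_on_subset[OF f2(1) W3(2)] f3(1) by (simp add: f_def)
    show "f i y0 = v i" for i using exhaust_3[of i] f1(2) f2(2) f3(2) by (auto simp: f_def)
    show "unitary m y (\<lambda>i. f i y)" if "y \<in> W3" for y
      unfolding unitary_def
    proof (intro allI)
      fix i j :: 3
      show "hm m y (f i y) (f j y) = (if i = j then 1 else 0)"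
        using exhaust_3[of i] exhaust_3[of j] f1(3)[OF W32(2)[OF that]] f2(3)[OF W32(1)[OF that]] f3(3)[OF that]
          f12[OF W32(1)[OF that]] f21[OF W32(1)[OF that]] f3o[OF that] fo3[OF that]
        by (auto simp: f_def)
    qed
  qed
qed

text \<open>Orthogonality to one or two vectors imposes two or four real conditions in dimension
  six, so a nonzero solution remains; positivity then permits normalisation.\<close>

lemma unitary_exists:
  assumes y: "y \<in> V"
  obtains f where "unitary 1 y f"
proof -
  have norm: "\<exists>r. hm 1 y (r *\<^sub>R v) (r *\<^sub>R v) = 1" if "v \<noteq> 0" for v
  proof -
    let ?N = "Hc y v (Jc y v)"
    have "?N > 0" by (rule Hc_pos[OF y that])
    then have "1 / sqrt ?N * (1 / sqrt ?N * ?N) = 1" by (simp add: real_div_sqrt divide_simps)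
    moreover have "hm 1 y (r *\<^sub>R v) (r *\<^sub>R v) = of_real (r * (r * ?N))" for r
      by (simp only: hm_linear[OF y]) (simp add: hm_self[OF y])
    ultimately show ?thesis by (intro exI[of _ "1 / sqrt ?N"]) (simp only: of_real_1)
  qed
  obtain r1 where r1: "hm 1 y (r1 *\<^sub>R axis 1 1) (r1 *\<^sub>R axis 1 1) = 1" using norm[of "axis 1 1"] by auto
  define f1 :: "real^6" where "f1 = r1 *\<^sub>R axis 1 1"
  have "linear (\<lambda>v. hm 1 y v f1)" by (rule linearI) (simp_all add: hm_linear[OF y] scaleR_conv_of_real[where 'a=complex])
  then obtain v2 where v2: "v2 \<noteq> 0" "hm 1 y v2 f1 = 0" by (rule linear_kernel_nontrivial) auto
  obtain r2 where r2: "hm 1 y (r2 *\<^sub>R v2) (r2 *\<^sub>R v2) = 1" using norm[OF v2(1)] by auto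
  define f2 where "f2 = r2 *\<^sub>R v2"
  have "linear (\<lambda>v. (hm 1 y v f1, hm 1 y v f2))"
    by (rule linearI) (simp_all add: hm_linear[OF y] scaleR_conv_of_real[where 'a=complex])
  then obtain v3 where v3: "v3 \<noteq> 0" "(hm 1 y v3 f1, hm 1 y v3 f2) = 0" by (rule linear_kernel_nontrivial) auto
  obtain r3 where r3: "hm 1 y (r3 *\<^sub>R v3) (r3 *\<^sub>R v3) = 1" using norm[OF v3(1)] by auto
  define f3 where "f3 = r3 *\<^sub>R v3"
  have n: "hm 1 y f1 f1 = 1" "hm 1 y f2 f2 = 1" "hm 1 y f3 f3 = 1" using r1 r2 r3 by (auto simp: f1_def f2_def f3_def)
  have o: "hm 1 y f2 f1 = 0" "hm 1 y f3 f1 = 0" "hm 1 y f3 f2 = 0"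
    using v2 v3 by (auto simp: f2_def f3_def hm_linear[OF y] zero_prod_def)
  have o': "hm 1 y f1 f2 = 0" "hm 1 y f1 f3 = 0" "hm 1 y f2 f3 = 0"
    using o hm_cnj[OF y, of 1 f1 f2] hm_cnj[OF y, of 1 f1 f3] hm_cnj[OF y, of 1 f2 f3] by auto
  define f where "f = (\<lambda>i::3. if i = 1 then f1 else if i = 2 then f2 else f3)"
  have "unitary 1 y f"
    unfolding unitary_def
  proof (intro allI)
    fix i j :: 3
    show "hm 1 y (f i) (f j) = (if i = j then 1 else 0)"
      using exhaust_3[of i] exhaust_3[of j] n o o' by (auto simp: f_def)
  qed
  then show thesis by (rule that)
qed

text \<open>Every point of the bundle arises from a unitary frame. For \<open>m\<close> take the
  conformal factor of the coframe: the associated form \<open>hm\<close> is then the standard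
  Hermitian form pulled back by \<open>u\<close>. Positivity makes \<open>u\<close> invertible, and
  \<open>f\<close> is the frame dual to it.\<close>

lemma coframe_unitary:
  assumes y: "y \<in> V" and u: "(inv_into U \<phi> y, u) \<in> F"
  obtains m f where "m > 0" "unitary m y f" "u = coframe_of m y f"
proof -
  have cu: "conformally_unitary A J \<eta> (inv_into U \<phi> y) u" and u0: "\<And>v. v \<notin> tangent_space A (inv_into U \<phi> y) \<Longrightarrow> u v = 0"
    using u unfolding coframe_bundle_def by auto
  obtain m :: real where m: "m > 0" and \<eta>: "\<And>v w. v \<in> tangent_space A (inv_into U \<phi> y) \<Longrightarrow> w \<in> tangent_space A (inv_into U \<phi> y) \<Longrightarrow>
     complex_of_real (\<eta> (inv_into U \<phi> y) v w) = of_real m * (\<i> / 2) * (\<Sum>i\<in>UNIV. wedge (\<lambda>x. u x $ i) (\<lambda>x. cnj (u x $ i)) v w)"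
    using cu unfolding conformally_unitary_def by blast
  have uJ: "u (tv y (Jc y h)) = \<i> *s u (tv y h)" for h
    using cu tv_tangent[OF y, of h] unfolding conformally_unitary_def J_linear_coframe_def Jc[OF y, symmetric] by blast
  define h where "h = (\<lambda>v w. \<Sum>i\<in>UNIV. u (tv y v) $ i * cnj (u (tv y w) $ i))"
  have hc: "cnj (h v w) = h w v" for v w by (simp add: h_def mult.commute)
  have H: "Hc y v w = - m * Im (h v w)" for v w
  proof -
    have "complex_of_real (Hc y v w) = of_real m * (\<i> / 2) * (h v w - h w v)"
      using \<eta>[OF tv_tangent[OF y, of v] tv_tangent[OF y, of w]]
      unfolding Hc[OF y] wedge_def h_def sum_subtractf by (simp add: mult.commute)
    also have "\<dots> = of_real (- m * Im (h v w))"
      unfolding hc[of v w, symmetric] by (simp add: complex_eq_iff)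
    finally show ?thesis by (simp only: of_real_eq_iff)
  qed
  have hJ: "h v (Jc y w) = - \<i> * h v w" for v w
    unfolding h_def uJ by (simp add: sum_distrib_left ac_simps sum_negf)
  have hm_h: "hm m y v w = h v w" for v w
    using m by (simp add: hm_def H hJ complex_eq_iff)
  have lin: "linear (\<lambda>h. u (tv y h))" by (rule coframe_linear[OF u chart base(1)[OF y]])
  have "surj (\<lambda>h. u (tv y h))"
  proof (rule linear_inj_surj[OF lin])
    fix v assume "u (tv y v) = 0"
    then have "h v v = 0" by (simp add: h_def)
    then have "Hc y v (Jc y v) = 0" unfolding H hJ by simp
    then show "v = 0" using Hc_pos[OF y, of v] by auto
  qed simp
  then have "\<exists>v. u (tv y v) = axis i 1" for i by (metis surjD)
  then obtain f where f: "\<And>i. u (tv y (f i)) = axis i 1" by metis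
  have hf: "h v (f i) = u (tv y v) $ i" for v i
  proof -
    have "h v (f i) = (\<Sum>j\<in>UNIV. if j = i then u (tv y v) $ j else 0)"
      unfolding h_def f by (rule sum.cong) (auto simp: axis_def)
    then show ?thesis by simp
  qed
  show thesis
  proof (rule that[OF m])
    show "unitary m y f" unfolding unitary_def hm_h hf f by (simp add: axis_def)
    show "u = coframe_of m y f"
    proof (rule ext)
      fix v show "u v = coframe_of m y f v"
      proof (cases "v \<in> tangent_space A (inv_into U \<phi> y)")
        case True
        then obtain k where k: "v = tv y k" using tangent_tv[OF y] by blast
        show ?thesis unfolding k coframe_of_tv[OF y] hm_h hf by (simp add: vec_eq_iff)
      qed (simp add: u0 coframe_of_def)
    qed
  qed
qed

end

section \<open>The structure equations along a unitary section\<close>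

lemma cv_linear: "cv (a + b) = cv a + cv b" "cv (r *\<^sub>R a) = of_real r *s cv a"
  by (simp_all add: cv_def vec_eq_iff)

lemma cv_sum: "cv (\<Sum>i\<in>I. v i) = (\<Sum>i\<in>I. cv (v i))"
  by (simp add: cv_def vec_eq_iff)

lemma cv_axis: "cv (axis j 1) = axis j 1"
  by (simp add: cv_def vec_eq_iff axis_def)

lemma dform_linear_left:
  assumes "open V" "\<And>j. smooth_on V (\<omega> j)" "y \<in> V"
  shows "dform \<omega> (\<Sum>a\<in>I. c a *s Z a) w y = (\<Sum>a\<in>I. c a * dform \<omega> (Z a) w y)"
proof -
  have "dform \<omega> (\<Sum>a\<in>I. c a *s Z a) w y
      = (\<Sum>j\<in>UNIV. \<Sum>k\<in>UNIV. \<Sum>a\<in>I. c a * (Z a $ j * w $ k * (pd j (\<omega> k) y - pd k (\<omega> j) y)))"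
    unfolding dform_coeffs[OF assms] by (simp add: sum_distrib_right mult.assoc)
  also have "\<dots> = (\<Sum>a\<in>I. \<Sum>j\<in>UNIV. \<Sum>k\<in>UNIV. c a * (Z a $ j * w $ k * (pd j (\<omega> k) y - pd k (\<omega> j) y)))"
    by (simp only: sum.swap[of _ I])
  finally show ?thesis unfolding dform_coeffs[OF assms] by (simp add: sum_distrib_left)
qed

lemma dform_alt: "dform \<omega> z w y = - dform \<omega> w z y"
  by (simp add: dform_def)

locale bundle_structure = coframe_setting A J \<eta>
  for A :: "('m::{t2_space,second_countable_topology}, real^6) atlas" and J \<eta> +
  fixes \<rho> :: "'m coframe form1"
    and \<kappa> :: "3 \<Rightarrow> 3 \<Rightarrow> 'm coframe form1"
    and B :: "3 \<Rightarrow> 3 \<Rightarrow> 3 \<Rightarrow> 'm coframe \<Rightarrow> complex"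
    and lam :: "'m coframe \<Rightarrow> complex"
    and lam_bar lam_unbar :: "3 \<Rightarrow> 'm coframe \<Rightarrow> complex"
    and B_bar B_unbar :: "3 \<Rightarrow> 3 \<Rightarrow> 3 \<Rightarrow> 3 \<Rightarrow> 'm coframe \<Rightarrow> complex"
  assumes RU3: "R_U3_structure A J \<eta>"
    and eqs: "structure_equations A J \<eta> \<rho> \<kappa> B lam"
    and expand_lam: "semibasic_expansion A J \<eta> (D_lam \<rho> \<kappa> lam) lam_bar lam_unbar"
    and expand_B: "\<And>i j k. semibasic_expansion A J \<eta> (D_B \<rho> \<kappa> B i j k) (B_bar i j k) (B_unbar i j k)"
begin

lemma structure_facts:
  "smooth_form1 \<Phi> F \<rho>" "smooth_form1 \<Phi> F (\<kappa> i j)"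
  "x \<in> F \<Longrightarrow> smooth_at \<Phi> x lam" "x \<in> F \<Longrightarrow> smooth_at \<Phi> x (B i j k)"
  "x \<in> F \<Longrightarrow> X \<in> tangent_space \<Phi> x \<Longrightarrow> cnj (\<rho> x X) = \<rho> x X"
  "x \<in> F \<Longrightarrow> X \<in> tangent_space \<Phi> x \<Longrightarrow> cnj (\<kappa> i j x X) = - \<kappa> j i x X"
  "x \<in> F \<Longrightarrow> B i j k x = - B j i k x" "x \<in> F \<Longrightarrow> (\<Sum>j\<in>UNIV. B i j j x) = 0"
  "x \<in> F \<Longrightarrow> X \<in> tangent_space \<Phi> x \<Longrightarrow> Y \<in> tangent_space \<Phi> x \<Longrightarrow>
     d1 \<Phi> (tautological_form A i) x X Y =
       - wedge (\<rho> x) (tautological_form A i x) X Y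
       - (\<Sum>j\<in>UNIV. wedge (\<kappa> i j x) (tautological_form A j x) X Y)
       - (\<Sum>j\<in>UNIV. \<Sum>k\<in>UNIV. B i j k x * wedge (\<lambda>X. cnj (tautological_form A j x X)) (tautological_form A k x) X Y)
       + 1/2 * (\<Sum>j\<in>UNIV. \<Sum>k\<in>UNIV.
           eps i j k * lam x * cnj (wedge (tautological_form A j x) (tautological_form A k x) X Y))"
proof -
  note e = eqs[unfolded structure_equations_def Let_def]
  note e1 = e[THEN conjunct1]
  note e2 = e[THEN conjunct2, THEN conjunct1]
  note e3 = e[THEN conjunct2, THEN conjunct2, THEN conjunct1]
  note e4 = e[THEN conjunct2, THEN conjunct2, THEN conjunct2, THEN conjunct1]
  note e5 = e[THEN conjunct2, THEN conjunct2, THEN conjunct2, THEN conjunct2, THEN conjunct1]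
  note e6 = e[THEN conjunct2, THEN conjunct2, THEN conjunct2, THEN conjunct2, THEN conjunct2, THEN conjunct1]
  note e7 = e[THEN conjunct2, THEN conjunct2, THEN conjunct2, THEN conjunct2, THEN conjunct2, THEN conjunct2, THEN conjunct1]
  note e8 = e[THEN conjunct2, THEN conjunct2, THEN conjunct2, THEN conjunct2, THEN conjunct2, THEN conjunct2, THEN conjunct2]
  show "smooth_form1 \<Phi> F \<rho>" by (rule e1)
  show "smooth_form1 \<Phi> F (\<kappa> i j)" by (rule e2[rule_format])
  show "smooth_at \<Phi> x lam" "smooth_at \<Phi> x (B i j k)" if "x \<in> F" using e3 that by auto
  show "B i j k x = - B j i k x" if "x \<in> F" by (rule e6[rule_format, OF that])
  show "(\<Sum>j\<in>UNIV. B i j j x) = 0" if "x \<in> F" by (rule e7[rule_format, OF that])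
  show "cnj (\<rho> x X) = \<rho> x X" if "x \<in> F" "X \<in> tangent_space \<Phi> x"
    by (rule e4[rule_format, OF that, symmetric])
  show "cnj (\<kappa> i j x X) = - \<kappa> j i x X" if "x \<in> F" "X \<in> tangent_space \<Phi> x"
    using e5[rule_format, OF that, of j i] by simp
  show "d1 \<Phi> (tautological_form A i) x X Y =
       - wedge (\<rho> x) (tautological_form A i x) X Y
       - (\<Sum>j\<in>UNIV. wedge (\<kappa> i j x) (tautological_form A j x) X Y)
       - (\<Sum>j\<in>UNIV. \<Sum>k\<in>UNIV. B i j k x * wedge (\<lambda>X. cnj (tautological_form A j x X)) (tautological_form A k x) X Y)
       + 1/2 * (\<Sum>j\<in>UNIV. \<Sum>k\<in>UNIV.
           eps i j k * lam x * cnj (wedge (tautological_form A j x) (tautological_form A k x) X Y))"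
    if "x \<in> F" "X \<in> tangent_space \<Phi> x" "Y \<in> tangent_space \<Phi> x"
    by (rule e8[rule_format, OF that])
qed

end

text \<open>One section through each coframe suffices, so the conformal factor \<open>m\<close> is
  kept constant along the section.\<close>

locale unitary_section = bundle_structure A J \<eta> \<rho> \<kappa> B lam lam_bar lam_unbar B_bar B_unbar
  + local_structure A J \<eta> U \<phi> V Jc Hc
  for A :: "('m::{t2_space,second_countable_topology}, real^6) atlas" and J \<eta> \<rho> \<kappa> B lam lam_bar lam_unbar B_bar B_unbar
    U \<phi> V Jc Hc +
  fixes W :: "(real^6) set" and m :: real and f :: "3 \<Rightarrow> real^6 \<Rightarrow> real^6"
  assumes W: "open W" "W \<subseteq> V" and m: "m > 0" and smooth_f: "\<And>i. smooth_on W (f i)"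
    and unitary_f: "\<And>y. y \<in> W \<Longrightarrow> unitary m y (\<lambda>i. f i y)"
begin

lemma WV: "y \<in> W \<Longrightarrow> y \<in> V"
  using W(2) by auto

lemma smooth_coframe: "smooth_on W (\<lambda>y. coframe_of m y (\<lambda>i. f i y) (tv y (axis j 1)))"
proof (rule smooth_on_cong[OF W(1)])
  show "smooth_on W (\<lambda>y. \<chi> i. hm m y (axis j 1) (f i y))"
    by (rule smooth_on_vec[OF W(1)]) (simp add: smooth_hm[OF W smooth_on_const smooth_f])
qed (simp add: coframe_of_tv WV)

sublocale sct: local_section A J \<eta> U \<phi> W "\<lambda>y. coframe_of m y (\<lambda>i. f i y)"
proof unfold_locales
  show "(U, \<phi>) \<in> A" by (rule chart)
  show "open W" "W \<subseteq> \<phi> ` U" using W V by auto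
qed (use smooth_coframe coframe_of_bundle unitary_f WV m in auto)

definition "cof i = sct.pull (tautological_form A i)" for i

text \<open>The (1,0)-part of \<open>f a y\<close>; complex linearity of \<open>hm\<close> in its
  first argument makes it dual to \<open>cof\<close>.\<close>

definition "frame a y = (1/2) *s (cv (f a y) - \<i> *s cv (Jc y (f a y)))" for a y

lemma cof_eq: "y \<in> W \<Longrightarrow> cof i j y = hm m y (axis j 1) (f i y)"
  by (simp add: cof_def sct.pull_def sct.pull_tautological coframe_of_tv WV)

lemma ev_cof: assumes y: "y \<in> W" shows "ev (cof i) (cv h) y = hm m y h (f i y)"
proof -
  have "linear (\<lambda>h. hm m y h (f i y))"
    by (rule linearI) (simp_all add: hm_linear[OF WV[OF y]] scaleR_conv_of_real[where 'a=complex])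
  from linear_axis_sum[OF this, of h] show ?thesis
    by (simp add: ev_def cv_def cof_eq[OF y] scaleR_conv_of_real[where 'a=complex])
qed

lemma cnjv_cv: "cnjv (c *s (cv a - d *s cv b)) = cnj c *s (cv a - cnj d *s cv b)"
  by (simp add: vec_eq_iff cv_def)

lemma ev_cof_antiholomorphic:
  assumes y: "y \<in> W"
  shows "ev (cof i) (cnjv (c *s (cv h - \<i> *s cv (Jc y h)))) y = 0"
  unfolding cnjv_cv ev_linear ev_cof[OF y] hm_Jc[OF WV[OF y]] by simp

lemma frame_dual:
  assumes y: "y \<in> W"
  shows "ev (cof i) (frame a y) y = (if i = a then 1 else 0)"
  using unitary_f[OF y]
  unfolding frame_def ev_linear ev_cof[OF y] hm_Jc[OF WV[OF y]] unitary_def by auto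

lemma frame_complete:
  assumes y: "y \<in> W"
  shows "axis j 1 = (\<Sum>a\<in>UNIV. cof a j y *s frame a y) + (\<Sum>a\<in>UNIV. cnj (cof a j y) *s cnjv (frame a y))"
proof -
  have "axis j 1 = cv (\<Sum>a\<in>UNIV. cs y (hm m y (axis j 1) (f a y)) (f a y))"
    using unitary_expansion[OF WV[OF y] unitary_f[OF y], of "axis j 1"] cv_axis by metis
  also have "\<dots> = (\<Sum>a\<in>UNIV. cof a j y *s frame a y + cnj (cof a j y) *s cnjv (frame a y))"
    unfolding cv_sum
  proof (rule sum.cong[OF refl])
    fix a :: 3
    show "cv (cs y (hm m y (axis j 1) (f a y)) (f a y)) = cof a j y *s frame a y + cnj (cof a j y) *s cnjv (frame a y)"
      unfolding cs_def cv_linear frame_def cnjv_cv cof_eq[OF y, symmetric]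
      by (simp add: vec_eq_iff complex_eq_iff cv_def field_simps)
  qed
  finally show ?thesis by (simp add: sum.distrib)
qed

lemma smooth_frame: "smooth_on W (\<lambda>y. frame a y $ j)"
proof -
  have "smooth_on W (\<lambda>y. complex_of_real (f a y $ j))" "smooth_on W (\<lambda>y. complex_of_real (Jc y (f a y) $ j))"
    by (intro smooth_on_of_real[OF W(1)] smooth_on_vec_nth[OF W(1)] smooth_f smooth_Jc_field[OF W])+
  then show ?thesis
    unfolding frame_def cv_def
    by (simp del: times_divide_eq_left) (intro smooth_on_mult[OF W(1)] smooth_on_diff[OF W(1)] smooth_on_const)
qed

text \<open>Testing the equations on the bundle on lifts of the coordinate vectors gives the
  equations between coefficients, which makes the local results available along the section.\<close>

sublocale str: structure_on W cof frame "sct.pull \<rho>" "\<lambda>i k. sct.pull (\<kappa> i k)"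
  "\<lambda>i j k y. B i j k (sct.sec y)" "\<lambda>y. lam (sct.sec y)"
  "\<lambda>l y. lam_bar l (sct.sec y)" "\<lambda>l y. lam_unbar l (sct.sec y)"
  "\<lambda>i j k l y. B_bar i j k l (sct.sec y)" "\<lambda>i j k l y. B_unbar i j k l (sct.sec y)"
proof unfold_locales
  note sF = sct.sec_bundle and lT = sct.lift_tangent
  show "open W" by (rule W(1))
  show "smooth_on W (cof i j)" for i j unfolding cof_def by (rule sct.smooth_pull[OF smooth_tautological])
  show "smooth_on W (\<lambda>y. frame a y $ j)" for a j by (rule smooth_frame)
  show "smooth_on W (sct.pull \<rho> j)" for j by (rule sct.smooth_pull[OF structure_facts(1)])
  show "smooth_on W (sct.pull (\<kappa> i k) j)" for i k j by (rule sct.smooth_pull[OF structure_facts(2)])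
  show "smooth_on W (\<lambda>y. B i j k (sct.sec y))" for i j k by (rule sct.smooth_function_sec[OF structure_facts(4)])
  show "smooth_on W (\<lambda>y. lam (sct.sec y))" by (rule sct.smooth_function_sec[OF structure_facts(3)])
  fix y assume y: "y \<in> W"
  show "ev (cof i) (frame a y) y = (if i = a then 1 else 0)" for i a by (rule frame_dual[OF y])
  show "ev (cof i) (cnjv (frame a y)) y = 0" for i a unfolding frame_def by (rule ev_cof_antiholomorphic[OF y])
  show "axis j 1 = (\<Sum>a\<in>UNIV. cof a j y *s frame a y) + (\<Sum>a\<in>UNIV. cnj (cof a j y) *s cnjv (frame a y))" for j
    by (rule frame_complete[OF y])
  show "cnj (sct.pull \<rho> j y) = sct.pull \<rho> j y" for j
    unfolding sct.pull_def by (rule structure_facts(5)[OF sF[OF y] lT[OF y]])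
  show "cnj (sct.pull (\<kappa> i k) j y) = - sct.pull (\<kappa> k i) j y" for i k j
    unfolding sct.pull_def by (rule structure_facts(6)[OF sF[OF y] lT[OF y]])
  show "B i j k (sct.sec y) = - B j i k (sct.sec y)" for i j k by (rule structure_facts(7)[OF sF[OF y]])
  show "(\<Sum>j\<in>UNIV. B i j j (sct.sec y)) = 0" for i by (rule structure_facts(8)[OF sF[OF y]])
  show "pd j (cof i k) y - pd k (cof i j) y =
        - cw (sct.pull \<rho>) (cof i) j k y - (\<Sum>p\<in>UNIV. cw (sct.pull (\<kappa> i p)) (cof p) j k y)
        - (\<Sum>p\<in>UNIV. \<Sum>q\<in>UNIV. B i p q (sct.sec y) * cw (cnjf (cof p)) (cof q) j k y)
        + 1/2 * (\<Sum>p\<in>UNIV. \<Sum>q\<in>UNIV. eps i p q * lam (sct.sec y) * cnj (cw (cof p) (cof q) j k y))" for i j k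
    using structure_facts(9)[OF sF[OF y] lT[OF y, of "axis j 1"] lT[OF y, of "axis k 1"], of i]
    unfolding sct.d1_lift[OF smooth_tautological y] cof_def[symmetric]
    unfolding wedge_def cw_def cnjf_def cof_def sct.pull_def .
  show "pd j (\<lambda>y. lam (sct.sec y)) y - lam (sct.sec y) * (sct.pull \<rho> j y - (\<Sum>i\<in>UNIV. sct.pull (\<kappa> i i) j y)) =
        (\<Sum>l\<in>UNIV. lam_bar l (sct.sec y) * cof l j y) + (\<Sum>l\<in>UNIV. lam_unbar l (sct.sec y) * cnj (cof l j y))" for j
    using expand_lam sF[OF y] lT[OF y, of "axis j 1"]
    unfolding semibasic_expansion_def D_lam_def cof_def sct.pull_def
      sct.d0_lift[OF y structure_facts(3)[OF sF[OF y]], symmetric] by blast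
  show "pd n (\<lambda>y. B i j k (sct.sec y)) y
        + (\<Sum>p\<in>UNIV. B p j k (sct.sec y) * sct.pull (\<kappa> i p) n y)
        + (\<Sum>p\<in>UNIV. B i p k (sct.sec y) * sct.pull (\<kappa> j p) n y)
        - (\<Sum>p\<in>UNIV. B i j p (sct.sec y) * sct.pull (\<kappa> p k) n y) - B i j k (sct.sec y) * sct.pull \<rho> n y =
        (\<Sum>l\<in>UNIV. B_bar i j k l (sct.sec y) * cof l n y)
        + (\<Sum>l\<in>UNIV. B_unbar i j k l (sct.sec y) * cnj (cof l n y))" for i j k n
    using expand_B[of i j k] sF[OF y] lT[OF y, of "axis n 1"]
    unfolding semibasic_expansion_def D_B_def cof_def sct.pull_def
      sct.d0_lift[OF y structure_facts(4)[OF sF[OF y]], symmetric] by blast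
qed

end

section \<open>The dichotomy\<close>

context coframe_setting begin

text \<open>The smooth expressions of \<open>J\<close> and \<open>\<eta>\<close> may be given in
  different charts; that of \<open>\<eta>\<close> is moved to the chart of \<open>J\<close> by the
  transition map and its derivative.\<close>

lemma local_structure_exists:
  assumes R: "R_U3_structure A J \<eta>"
  obtains U \<phi> V Jc Hc where "local_structure A J \<eta> U \<phi> V Jc Hc" "p \<in> U" "\<phi> p \<in> V"
proof -
  define P where "P = (\<lambda>p U (\<phi> :: 'm \<Rightarrow> real^6) S (K :: real^6 \<Rightarrow> real^6 \<Rightarrow> real^6). open S \<and> \<phi> p \<in> S \<and>
        (\<forall>h. smooth_on S (\<lambda>x. K x h)) \<and> (\<forall>x\<in>S. linear (K x)) \<and>
        (\<forall>q\<in>U. \<phi> q \<in> S \<longrightarrow> (\<forall>v\<in>tangent_space A q. dcoord \<phi> (J q v) = K (\<phi> q) (dcoord \<phi> v))))"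
  have "\<forall>p. \<exists>(U, \<phi>)\<in>A. p \<in> U \<and> (\<exists>S K. P p U \<phi> S K)"
    using R unfolding R_U3_structure_def almost_complex_structure_def P_def by (elim conjE)
  then obtain U \<phi> S K where c: "(U, \<phi>) \<in> A" "p \<in> U" and PK: "P p U \<phi> S K" by blast
  have S: "open S" "\<phi> p \<in> S" and K: "smooth_on S (\<lambda>x. K x h)" "x \<in> S \<Longrightarrow> linear (K x)"
    and JK: "q \<in> U \<Longrightarrow> \<phi> q \<in> S \<Longrightarrow> v \<in> tangent_space A q \<Longrightarrow> dcoord \<phi> (J q v) = K (\<phi> q) (dcoord \<phi> v)"
    for h x q v
    using PK unfolding P_def by simp_all
  have Jt: "J q v \<in> tangent_space A q" if "v \<in> tangent_space A q" for q v
    using R that unfolding R_U3_structure_def almost_complex_structure_def by simp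
  define Q where "Q = (\<lambda>p U (\<phi> :: 'm \<Rightarrow> real^6) S (H :: real^6 \<Rightarrow> real^6 \<Rightarrow> real^6 \<Rightarrow> real). open S \<and> \<phi> p \<in> S \<and>
     (\<forall>h h'. smooth_on S (\<lambda>x. H x h h')) \<and>
     (\<forall>x\<in>S. bilinear (H x) \<and> (\<forall>h h'. H x h h' = - H x h' h)) \<and>
     (\<forall>q\<in>U. \<phi> q \<in> S \<longrightarrow> (\<forall>v\<in>tangent_space A q. \<forall>w\<in>tangent_space A q.
        \<eta> q v w = H (\<phi> q) (dcoord \<phi> v) (dcoord \<phi> w))))"
  have "\<forall>p. \<exists>(U, \<phi>)\<in>A. p \<in> U \<and> (\<exists>S H. Q p U \<phi> S H)"
    using R unfolding R_U3_structure_def positive_form11_def smooth_form2_def Q_def by (elim conjE)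
  then obtain U' \<phi>' S' H where c': "(U', \<phi>') \<in> A" "p \<in> U'" and QH: "Q p U' \<phi>' S' H" by blast
  note q = QH[unfolded Q_def]
  note S' = q[THEN conjunct1] q[THEN conjunct2, THEN conjunct1]
  note H1 = q[THEN conjunct2, THEN conjunct2, THEN conjunct1, rule_format]
  note H2 = q[THEN conjunct2, THEN conjunct2, THEN conjunct2, THEN conjunct1, rule_format, THEN conjunct1]
  note H3 = q[THEN conjunct2, THEN conjunct2, THEN conjunct2, THEN conjunct1, rule_format, THEN conjunct2, rule_format]
  note \<eta>H = q[THEN conjunct2, THEN conjunct2, THEN conjunct2, THEN conjunct2, rule_format]
  let ?T = "\<lambda>y. \<phi>' (inv_into U \<phi> y)"
  define D where "D = (\<lambda>y h. frechet_derivative ?T (at y) h)"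
  define V where "V = {y \<in> \<phi> ` (U \<inter> U'). ?T y \<in> S'} \<inter> S"
  note T0 = smooth_transition[OF c(1) c'(1)]
  have o: "open V" unfolding V_def
    by (rule open_Int[OF open_preimage_smooth[OF open_overlap[OF c(1) c'(1)] T0 S'(1)] S(1)])
  have T: "smooth_on V ?T" by (rule smooth_on_subset[OF T0]) (auto simp: V_def)
  have in': "inv_into U \<phi> y \<in> U" "inv_into U \<phi> y \<in> U'" "\<phi> (inv_into U \<phi> y) = y" "?T y \<in> S'" "y \<in> S" if "y \<in> V" for y
    using that c(1) by (auto simp: V_def)
  have D: "smooth_on V (\<lambda>y. D y h)" for h unfolding D_def by (rule smooth_on_frechet[OF T])
  have Dl: "linear (D y)" if "y \<in> V" for y
    unfolding D_def by (rule linear_frechet_derivative[OF smooth_on_differentiable[OF T that]])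
  have tvD: "chart_vec A U \<phi> (inv_into U \<phi> y) h = chart_vec A U' \<phi>' (inv_into U \<phi> y) (D y h)" if "y \<in> V" for y h
    using chart_vec_change[OF c'(1) in'(2)[OF that] c(1) in'(1)[OF that], of h] by (simp add: D_def in'(3)[OF that])
  have "local_structure A J \<eta> U \<phi> V K (\<lambda>y h h'. H (?T y) (D y h) (D y h'))"
  proof (rule local_structure.intro[OF coframe_setting_axioms], rule local_structure_axioms.intro)
    show "R_U3_structure A J \<eta>" "(U, \<phi>) \<in> A" "open V" by (fact R c(1) o)+
    show "V \<subseteq> \<phi> ` U" by (auto simp: V_def)
    show "smooth_on V (\<lambda>y. K y h)" for h by (rule smooth_on_subset[OF K(1)]) (auto simp: V_def)
    show "smooth_on V (\<lambda>y. H (?T y) (D y h) (D y h'))" for h h'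
    proof (rule smooth_on_bilinear_family[OF o _ _ D D])
      show "smooth_on V (\<lambda>y. H (?T y) a b)" for a b
        by (rule smooth_on_compose[OF o S'(1) T H1]) (use in' in auto)
      show "bilinear (H (?T y))" if "y \<in> V" for y by (rule H2[OF in'(4)[OF that]])
    qed
    fix y assume y: "y \<in> V"
    note i = in'[OF y]
    show "linear (K y)" by (rule K(2)[OF i(5)])
    show "H (?T y) (D y h) (D y h') = - H (?T y) (D y h') (D y h)" for h h' by (rule H3[OF i(4)])
    show "bilinear (\<lambda>h h'. H (?T y) (D y h) (D y h'))"
      using H2[OF i(4)] Dl[OF y] unfolding bilinear_def
      by (auto intro: linear_compose[unfolded o_def])
    show "\<eta> (inv_into U \<phi> y) (chart_vec A U \<phi> (inv_into U \<phi> y) h) (chart_vec A U \<phi> (inv_into U \<phi> y) h')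
        = H (?T y) (D y h) (D y h')" for h h'
      unfolding tvD[OF y] \<eta>H[OF i(2,4) chart_vec_tangent[OF c'(1) i(2)] chart_vec_tangent[OF c'(1) i(2)]]
        dcoord_chart_vec[OF c'(1) i(2)] ..
    show "J (inv_into U \<phi> y) (chart_vec A U \<phi> (inv_into U \<phi> y) h) = chart_vec A U \<phi> (inv_into U \<phi> y) (K y h)" for h
    proof -
      note t = chart_vec_tangent[OF c(1) i(1)]
      obtain k where k: "J (inv_into U \<phi> y) (chart_vec A U \<phi> (inv_into U \<phi> y) h) = chart_vec A U \<phi> (inv_into U \<phi> y) k"
        using Jt[OF t, of h] unfolding tangent_space_chart[OF c(1) i(1)] by auto
      have "k = K y h"
        using JK[OF i(1) _ t, of h] unfolding k dcoord_chart_vec[OF c(1) i(1)] by (simp add: i)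
      then show ?thesis using k by simp
    qed
  qed
  then show thesis by (rule that) (use c c' S S' in \<open>auto simp: V_def\<close>)
qed

end

context bundle_structure begin

lemma unitary_sectionI:
  assumes L: "local_structure A J \<eta> U \<phi> V Jc Hc" and "open W" "W \<subseteq> V" "m > 0" "\<And>i. smooth_on W (f i)"
    "\<And>y. y \<in> W \<Longrightarrow> local_structure.unitary Jc Hc m y (\<lambda>i. f i y)"
  shows "unitary_section A J \<eta> \<rho> \<kappa> B lam lam_bar lam_unbar B_bar B_unbar U \<phi> V Jc Hc W m f"
proof -
  interpret local_structure A J \<eta> U \<phi> V Jc Hc by (rule L)
  show ?thesis by unfold_locales (use assms in auto)
qed

lemma section_through:
  assumes L: "local_structure A J \<eta> U \<phi> V Jc Hc" and x: "x \<in> F" "fst x \<in> U" "\<phi> (fst x) \<in> V"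
  obtains W m f where "unitary_section A J \<eta> \<rho> \<kappa> B lam lam_bar lam_unbar B_bar B_unbar U \<phi> V Jc Hc W m f"
    "\<phi> (fst x) \<in> W" "x = (fst x, local_structure.coframe_of A U \<phi> Jc Hc m (\<phi> (fst x)) (\<lambda>i. f i (\<phi> (fst x))))"
proof -
  interpret local_structure A J \<eta> U \<phi> V Jc Hc by (rule L)
  have i: "inv_into U \<phi> (\<phi> (fst x)) = fst x" by (rule inv_chart[OF chart x(2)])
  have "(inv_into U \<phi> (\<phi> (fst x)), snd x) \<in> F" using x(1) i by simp
  then obtain m v where mv: "m > 0" "unitary m (\<phi> (fst x)) v" "snd x = coframe_of m (\<phi> (fst x)) v"
    by (rule coframe_unitary[OF x(3)])
  obtain W f where W: "open W" "W \<subseteq> V" "\<phi> (fst x) \<in> W" "\<And>i. smooth_on W (f i)" "\<And>i. f i (\<phi> (fst x)) = v i"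
    "\<And>y. y \<in> W \<Longrightarrow> unitary m y (\<lambda>i. f i y)"
    by (rule unitary_extend[OF x(3) mv(2)]) blast
  show thesis
    by (rule that[OF unitary_sectionI[OF L W(1,2) mv(1) W(4,6)] W(3)]) (simp_all add: W(5) mv(3)[symmetric])
qed

end

context unitary_section begin

text \<open>\<lambda> is read off from the derivative of the coframing alone, without connection
  forms, so its zeros can be compared between coframings.\<close>

lemma dform_cof_frame:
  assumes y: "y \<in> W"
  shows "dform (cof i) (cnjv (frame a y)) (cnjv (frame b y)) y = lam (sct.sec y) * eps i a b"
  using exhaust_3[of i] exhaust_3[of a] exhaust_3[of b]
  by (auto simp: str.dform_\<alpha> str.dual str.dual_cnj str.dual_conj wv_def sum_3 eps_def y)

end

text \<open>The vanishing of \<open>\<lambda>\<close> says that the (0,1)-vectors are closed under brackets, hence does not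
  depend on the coframe: a second coframing is \<open>\<alpha>'\<^sub>i = g\<^sub>i\<^sub>j \<alpha>\<^sub>j\<close>, and the (0,2)-part of \<open>d\<alpha>'\<^sub>i\<close>
  is \<open>g\<^sub>i\<^sub>j\<close> times that of \<open>d\<alpha>\<^sub>j\<close>.\<close>

lemma (in bundle_structure) lam_zero_independent:
  assumes 1: "unitary_section A J \<eta> \<rho> \<kappa> B lam lam_bar lam_unbar B_bar B_unbar U \<phi> V Jc Hc W m f"
    and 2: "unitary_section A J \<eta> \<rho> \<kappa> B lam lam_bar lam_unbar B_bar B_unbar U \<phi> V Jc Hc W' m' f'"
    and y: "y \<in> W" "y \<in> W'"
    and zero: "lam (inv_into U \<phi> y, local_structure.coframe_of A U \<phi> Jc Hc m y (\<lambda>i. f i y)) = 0"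
  shows "lam (inv_into U \<phi> y, local_structure.coframe_of A U \<phi> Jc Hc m' y (\<lambda>i. f' i y)) = 0"
proof -
  interpret s1: unitary_section A J \<eta> \<rho> \<kappa> B lam lam_bar lam_unbar B_bar B_unbar U \<phi> V Jc Hc W m f by (rule 1)
  interpret s2: unitary_section A J \<eta> \<rho> \<kappa> B lam lam_bar lam_unbar B_bar B_unbar U \<phi> V Jc Hc W' m' f' by (rule 2)
  define O' where "O' = W \<inter> W'"
  have O': "open O'" "y \<in> O'" "O' \<subseteq> W" "O' \<subseteq> W'" using s1.W s2.W y by (auto simp: O'_def)
  have sub: "smooth_on W g \<Longrightarrow> smooth_on O' g" "smooth_on W' g \<Longrightarrow> smooth_on O' g" for g :: "real^6 \<Rightarrow> complex"
    using smooth_on_subset O'(3,4) by blast+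
  define g where "g = (\<lambda>i j z. ev (s2.cof i) (s1.frame j z) z)"
  have g: "smooth_on O' (g i j)" for i j
    unfolding g_def using sub(2)[OF s2.str.smooth_\<alpha>] sub(1)[OF s1.str.smooth_E] by (intro smooth_on_ev[OF O'(1)])
  have e1: "smooth_on O' (ev (s1.cof j) Z)" for j Z
    by (intro smooth_on_ev_const[OF O'(1)] sub(1)[OF s1.str.smooth_\<alpha>])
  have e2: "smooth_on O' (ev (s2.cof j) Z)" for j Z
    by (intro smooth_on_ev_const[OF O'(1)] sub(2)[OF s2.str.smooth_\<alpha>])
  \<comment> \<open>Both coframings consist of (1,0)-forms for the same \<open>Jc\<close>, so no
    conjugate forms enter the change of coframing.\<close>
  have "ev (s2.cof i) (cnjv (s1.frame j z)) z = 0" if "z \<in> O'" for i j z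
    unfolding s1.frame_def by (rule s2.ev_cof_antiholomorphic) (use that O' in auto)
  then have exp: "ev (s2.cof i) Z z = (\<Sum>j\<in>UNIV. g i j z * ev (s1.cof j) Z z)" if "z \<in> O'" for i Z z
    using that O'(3)
    by (subst s1.str.frame_expansion[of z Z]) (auto simp: ev_linear g_def mult.commute)
  have ge: "smooth_on O' (\<lambda>z. g i j z * ev (s1.cof j) Z z)" for i j Z by (intro smooth_on_mult[OF O'(1)] g e1)
  have dd2: "dd X (ev (s2.cof i) Y) y
      = (\<Sum>j\<in>UNIV. g i j y * dd X (ev (s1.cof j) Y) y + dd X (g i j) y * ev (s1.cof j) Y y)" for i X Y
  proof -
    have "dd X (ev (s2.cof i) Y) y = dd X (\<lambda>z. \<Sum>j\<in>UNIV. g i j z * ev (s1.cof j) Y z) y"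
      by (rule dd_cong[OF O'(1) e2 O'(2) exp])
    then show ?thesis by (simp add: dd_sum[OF O'(1) ge O'(2)] dd_mult[OF g e1 O'(2)])
  qed
  have z1: "dform (s1.cof j) (cnjv (s1.frame a y)) (cnjv (s1.frame b y)) y = 0" for j a b
    using zero unfolding s1.dform_cof_frame[OF y(1)] s1.sct.sec_def by simp
  have z2: "dform (s2.cof i) (cnjv (s1.frame a y)) (cnjv (s1.frame b y)) y = 0" for i a b
  proof -
    have "dform (s2.cof i) (cnjv (s1.frame a y)) (cnjv (s1.frame b y)) y
      = (\<Sum>j\<in>UNIV. g i j y * dform (s1.cof j) (cnjv (s1.frame a y)) (cnjv (s1.frame b y)) y)"
      unfolding dform_def dd2 by (simp add: s1.str.dual_cnj[OF y(1)] sum_subtractf right_diff_distrib)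
    then show ?thesis by (simp add: z1)
  qed
  have Eb: "cnjv (s2.frame a y) = (\<Sum>b\<in>UNIV. ev (cnjf (s1.cof b)) (cnjv (s2.frame a y)) y *s cnjv (s1.frame b y))" for a
  proof -
    have "ev (s1.cof b) (cnjv (s2.frame a y)) y = 0" for b
      unfolding s2.frame_def by (rule s1.ev_cof_antiholomorphic[OF y(1)])
    then show ?thesis using s1.str.frame_expansion[OF y(1), of "cnjv (s2.frame a y)"] by simp
  qed
  note lin = dform_linear_left[OF O'(1) sub(2)[OF s2.str.smooth_\<alpha>] O'(2)]
  have z3: "dform (s2.cof i) (cnjv (s2.frame a y)) (cnjv (s1.frame b y)) y = 0" for i a b
    by (subst Eb) (simp add: lin z2)
  have "dform (s2.cof i) (cnjv (s2.frame a y)) (cnjv (s2.frame b y)) y = 0" for i a b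
    by (subst dform_alt, subst Eb[of b]) (simp add: lin z3 dform_alt[of _ "cnjv (s1.frame _ y)"])
  from this[of 1 2 3] show ?thesis
    unfolding s2.dform_cof_frame[OF y(2)] s2.sct.sec_def by (simp add: eps_def)
qed

context bundle_structure begin

text \<open>Unique continuation finds zeros along a single section; this spreads them over entire
  fibres of the bundle.\<close>

lemma lam_zero_fibre:
  assumes x: "x \<in> F" "x' \<in> F" "fst x = fst x'" and zero: "lam x = 0"
  shows "lam x' = 0"
proof -
  obtain U \<phi> V Jc Hc where L: "local_structure A J \<eta> U \<phi> V Jc Hc" "fst x \<in> U" "\<phi> (fst x) \<in> V"
    by (rule local_structure_exists[OF RU3])
  interpret local_structure A J \<eta> U \<phi> V Jc Hc by (rule L(1))
  obtain W m f where s: "unitary_section A J \<eta> \<rho> \<kappa> B lam lam_bar lam_unbar B_bar B_unbar U \<phi> V Jc Hc W m f"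
    "\<phi> (fst x) \<in> W" "x = (fst x, coframe_of m (\<phi> (fst x)) (\<lambda>i. f i (\<phi> (fst x))))"
    by (rule section_through[OF L(1) x(1) L(2,3)]) blast
  obtain W' m' f' where s': "unitary_section A J \<eta> \<rho> \<kappa> B lam lam_bar lam_unbar B_bar B_unbar U \<phi> V Jc Hc W' m' f'"
    "\<phi> (fst x') \<in> W'" "x' = (fst x', coframe_of m' (\<phi> (fst x')) (\<lambda>i. f' i (\<phi> (fst x'))))"
    by (rule section_through[OF L(1) x(2)]) (use L x(3) in auto)
  have i: "inv_into U \<phi> (\<phi> (fst x)) = fst x" by (rule inv_chart[OF chart L(2)])
  have "lam (inv_into U \<phi> (\<phi> (fst x)), coframe_of m' (\<phi> (fst x)) (\<lambda>i. f' i (\<phi> (fst x)))) = 0"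
    by (rule lam_zero_independent[OF s(1) s'(1) s(2)]) (use s s' x(3) i zero in auto)
  then show ?thesis using s'(3) i x(3) by simp
qed

text \<open>The interior of the set of base points over which \<lambda> vanishes. It is open by
  construction, so connectedness only requires closedness.\<close>

definition "zero_set = {p. \<exists>O'. open O' \<and> p \<in> O' \<and> (\<forall>x\<in>F. fst x \<in> O' \<longrightarrow> lam x = 0)}"

lemma open_zero_set: "open zero_set"
proof (subst open_subopen, rule ballI)
  fix p assume "p \<in> zero_set"
  then obtain O' where O': "open O'" "p \<in> O'" "\<forall>x\<in>F. fst x \<in> O' \<longrightarrow> lam x = 0" unfolding zero_set_def by blast
  then have "O' \<subseteq> zero_set" unfolding zero_set_def by blast
  then show "\<exists>T. open T \<and> p \<in> T \<and> T \<subseteq> zero_set" using O' by blast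
qed

lemma open_chart_preimage:
  assumes "(U, \<phi>) \<in> A" "open S"
  shows "open {q \<in> U. \<phi> q \<in> S}"
proof -
  have "{q \<in> U. \<phi> q \<in> S} = U \<inter> \<phi> -` S" by auto
  then show ?thesis using continuous_open_preimage[OF chart_props(4,1)[OF assms(1)] assms(2)] by simp
qed

text \<open>The section and the radius \<open>r\<close> are fixed near the limit point
  \<open>p\<close> before the point \<open>q\<close> of \<open>zero_set\<close> is chosen. So zeros
  near \<open>q\<close> propagate over a distance independent of \<open>q\<close>, which reaches a
  neighbourhood of \<open>p\<close>.\<close>

lemma closed_zero_set: "closed zero_set"
  unfolding closure_subset_eq[symmetric]
proof
  fix p assume p: "p \<in> closure zero_set"
  obtain U \<phi> V Jc Hc where L: "local_structure A J \<eta> U \<phi> V Jc Hc" "p \<in> U" "\<phi> p \<in> V"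
    by (rule local_structure_exists[OF RU3])
  interpret local_structure A J \<eta> U \<phi> V Jc Hc by (rule L(1))
  obtain v where v: "unitary 1 (\<phi> p) v" by (rule unitary_exists[OF L(3)])
  obtain W f where W: "open W" "W \<subseteq> V" "\<phi> p \<in> W" "\<And>i. smooth_on W (f i)" "\<And>i. f i (\<phi> p) = v i"
    "\<And>y. y \<in> W \<Longrightarrow> unitary 1 y (\<lambda>i. f i y)"
    by (rule unitary_extend[OF L(3) v]) blast
  interpret s: unitary_section A J \<eta> \<rho> \<kappa> B lam lam_bar lam_unbar B_bar B_unbar U \<phi> V Jc Hc W 1 f
    by (rule unitary_sectionI[OF L(1) W(1,2) _ W(4,6)]) simp_all
  obtain r where r: "r > 0" "cball (\<phi> p) r \<subseteq> W" using W(1,3) open_contains_cball by blast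
  \<comment> \<open>For \<open>q\<close> in this set, the ball of radius \<open>r / 2\<close> about
    \<open>\<phi> q\<close> lies in the ball of radius \<open>r\<close> about
    \<open>\<phi> p\<close> and contains the one of radius \<open>r / 4\<close>.\<close>
  define O0 where "O0 = {q \<in> U. \<phi> q \<in> ball (\<phi> p) (r / 4)}"
  have O0: "open O0" unfolding O0_def by (rule open_chart_preimage[OF chart open_ball])
  have pO0: "p \<in> O0" unfolding O0_def using L(2) r(1) by simp
  obtain q where q: "q \<in> zero_set" "q \<in> O0"
    using p O0 pO0 closure_iff_nhds_not_empty[of p zero_set] by blast
  obtain O' where O': "open O'" "q \<in> O'" "\<forall>x\<in>F. fst x \<in> O' \<longrightarrow> lam x = 0" using q(1) unfolding zero_set_def by blast
  have qU: "q \<in> U" and qr: "dist (\<phi> p) (\<phi> q) < r / 4" using q(2) by (auto simp: O0_def)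
  have sub: "cball (\<phi> q) (r / 2) \<subseteq> W"
  proof
    fix y assume "y \<in> cball (\<phi> q) (r / 2)"
    then have "dist (\<phi> p) y \<le> r" using dist_triangle[of "\<phi> p" y "\<phi> q"] qr r(1) by simp
    then show "y \<in> W" using r(2) by auto
  qed
  have "open {y \<in> \<phi> ` U. inv_into U \<phi> y \<in> O'}" by (rule open_inv_preimage[OF chart O'(1)])
  then have "open (W \<inter> {y \<in> \<phi> ` U. inv_into U \<phi> y \<in> O'})" by (rule open_Int[OF W(1)])
  moreover have "\<phi> q \<in> W \<inter> {y \<in> \<phi> ` U. inv_into U \<phi> y \<in> O'}"
    using sub r(1) qU O'(2) inv_chart[OF chart qU] by auto
  ultimately obtain r1 where r1: "r1 > 0" "ball (\<phi> q) r1 \<subseteq> W \<inter> {y \<in> \<phi> ` U. inv_into U \<phi> y \<in> O'}"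
    using openE by blast
  have z1: "lam (s.sct.sec y) = 0" if "y \<in> ball (\<phi> q) r1" for y
  proof -
    have "y \<in> W" "inv_into U \<phi> y \<in> O'" using that r1(2) by auto
    then show ?thesis using O'(3) s.sct.sec_bundle[of y] s.sct.base(3)[of y] by metis
  qed
  have z2: "lam (s.sct.sec y) = 0" if "y \<in> ball (\<phi> q) (r / 2)" for y
    by (rule s.str.unique_continuation_ball[OF r1(1) sub z1 that])
  have "lam x = 0" if x: "x \<in> F" "fst x \<in> O0" for x
  proof -
    have xU: "fst x \<in> U" and xr: "dist (\<phi> p) (\<phi> (fst x)) < r / 4" using x(2) by (auto simp: O0_def)
    have "dist (\<phi> q) (\<phi> (fst x)) < r / 2"
      using dist_triangle[of "\<phi> q" "\<phi> (fst x)" "\<phi> p"] xr qr by (simp add: dist_commute)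
    then have zb: "\<phi> (fst x) \<in> ball (\<phi> q) (r / 2)" by simp
    then have xW: "\<phi> (fst x) \<in> W" using sub by auto
    have f: "fst (s.sct.sec (\<phi> (fst x))) = fst x"
      unfolding s.sct.base(3) by (rule inv_chart[OF chart xU])
    show ?thesis by (rule lam_zero_fibre[OF s.sct.sec_bundle[OF xW] x(1) f z2[OF zb]])
  qed
  then show "p \<in> zero_set" unfolding zero_set_def using O0 pO0 by blast
qed

text \<open>If the second-order expression were nonzero at a coframe, it would stay nonzero along a
  section over an open set. Its product with \<lambda> is zero, so \<lambda> would vanish there,
  which puts the base point into \<open>zero_set\<close>.\<close>

lemma dichotomy:
  assumes conn: "connected (UNIV :: 'm set)"
  shows "(\<forall>x\<in>F. lam x = 0) \<or>
    (\<forall>x\<in>F. \<forall>l. lam_bar l x + 1/3 * (\<Sum>i\<in>UNIV. \<Sum>j\<in>UNIV. \<Sum>k\<in>UNIV. eps i j l * B_unbar i j k k x) = 0)"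
proof -
  have "zero_set = {} \<or> zero_set = UNIV"
    using conn open_zero_set closed_zero_set connected_clopen[of "UNIV :: 'm set"] by (simp add: open_openin[symmetric] closed_closedin[symmetric])
  then show ?thesis
  proof
    assume "zero_set = UNIV"
    then have "lam x = 0" if "x \<in> F" for x
      using that unfolding zero_set_def by blast
    then show ?thesis by blast
  next
    assume empty: "zero_set = {}"
    have "lam_bar l x + 1/3 * (\<Sum>i\<in>UNIV. \<Sum>j\<in>UNIV. \<Sum>k\<in>UNIV. eps i j l * B_unbar i j k k x) = 0" (is "?E x = 0")
      if x: "x \<in> F" for x l
    proof (rule ccontr)
      assume nz: "?E x \<noteq> 0"
      obtain U \<phi> V Jc Hc where L: "local_structure A J \<eta> U \<phi> V Jc Hc" "fst x \<in> U" "\<phi> (fst x) \<in> V"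
        by (rule local_structure_exists[OF RU3])
      obtain W m f where us: "unitary_section A J \<eta> \<rho> \<kappa> B lam lam_bar lam_unbar B_bar B_unbar U \<phi> V Jc Hc W m f"
        "\<phi> (fst x) \<in> W" "x = (fst x, local_structure.coframe_of A U \<phi> Jc Hc m (\<phi> (fst x)) (\<lambda>i. f i (\<phi> (fst x))))"
        by (rule section_through[OF L(1) x L(2,3)]) blast
      interpret s: unitary_section A J \<eta> \<rho> \<kappa> B lam lam_bar lam_unbar B_bar B_unbar U \<phi> V Jc Hc W m f by (rule us(1))
      have "s.sct.sec (\<phi> (fst x)) = (fst x, s.coframe_of m (\<phi> (fst x)) (\<lambda>i. f i (\<phi> (fst x))))"
        unfolding s.sct.sec_def inv_chart[OF s.chart L(2)] ..
      then have sx: "s.sct.sec (\<phi> (fst x)) = x" using us(3) by simp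
      have E: "smooth_on W (\<lambda>y. ?E (s.sct.sec y))"
        by (intro smooth_on_add[OF s.W(1)] smooth_on_mult[OF s.W(1)] smooth_on_sum[OF s.W(1)] smooth_on_const
            s.str.smooth_lb s.str.smooth_Bu)
      define O' where "O' = {y \<in> W. ?E (s.sct.sec y) \<in> - {0}}"
      have O': "open O'" unfolding O'_def by (rule open_preimage_smooth[OF s.W(1) E]) (rule open_Compl[OF closed_singleton])
      have xO: "\<phi> (fst x) \<in> O'" unfolding O'_def using us(2) nz sx by simp
      have z: "lam (s.sct.sec y) = 0" if "y \<in> O'" for y
        using s.str.lam_times_second_order[of y l] that unfolding O'_def by auto
      define O1 where "O1 = {q \<in> U. \<phi> q \<in> O'}"
      have "open O1" unfolding O1_def by (rule open_chart_preimage[OF s.chart O'])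
      moreover have "fst x \<in> O1" unfolding O1_def using L(2) xO by simp
      moreover have "lam x' = 0" if x': "x' \<in> F" "fst x' \<in> O1" for x'
      proof -
        have yW: "\<phi> (fst x') \<in> W" and yO: "\<phi> (fst x') \<in> O'" and U: "fst x' \<in> U"
          using x'(2) by (auto simp: O1_def O'_def)
        have f: "fst (s.sct.sec (\<phi> (fst x'))) = fst x'"
          unfolding s.sct.base(3) by (rule inv_chart[OF s.chart U])
        show ?thesis by (rule lam_zero_fibre[OF s.sct.sec_bundle[OF yW] x'(1) f z[OF yO]])
      qed
      ultimately have "fst x \<in> zero_set" unfolding zero_set_def by blast
      then show False using empty by simp
    qed
    then show ?thesis by blast
  qed
qed

end

theorem corollary2:
  fixes A :: "('m::{t2_space,second_countable_topology}, real^6) atlas"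
    and J :: "'m \<Rightarrow> 'm tvec \<Rightarrow> 'm tvec"
    and \<eta> :: "'m \<Rightarrow> 'm tvec \<Rightarrow> 'm tvec \<Rightarrow> real"
    and \<rho> :: "'m coframe form1"
    and \<kappa> :: "3 \<Rightarrow> 3 \<Rightarrow> 'm coframe form1"
    and B :: "3 \<Rightarrow> 3 \<Rightarrow> 3 \<Rightarrow> 'm coframe \<Rightarrow> complex"
    and lam :: "'m coframe \<Rightarrow> complex"
    and lam_bar lam_unbar :: "3 \<Rightarrow> 'm coframe \<Rightarrow> complex"
    and B_bar B_unbar :: "3 \<Rightarrow> 3 \<Rightarrow> 3 \<Rightarrow> 3 \<Rightarrow> 'm coframe \<Rightarrow> complex"
  assumes "smooth_atlas6 A"
    and "connected (UNIV :: 'm set)"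
    and "R_U3_structure A J \<eta>"
    and "quasi_integrable A J \<eta>"
    and "structure_equations A J \<eta> \<rho> \<kappa> B lam"
    and "semibasic_expansion A J \<eta> (D_lam \<rho> \<kappa> lam) lam_bar lam_unbar"
    and "\<And>i j k. semibasic_expansion A J \<eta> (D_B \<rho> \<kappa> B i j k) (B_bar i j k) (B_unbar i j k)"
  shows "(\<forall>x\<in>coframe_bundle A J \<eta>. lam x = 0) \<or>
    (\<forall>x\<in>coframe_bundle A J \<eta>. \<forall>l. lam_bar l x =
       - 1/3 * (\<Sum>i\<in>UNIV. \<Sum>j\<in>UNIV. \<Sum>k\<in>UNIV. cnj (eps i j l) * B_unbar i j k k x))"
proof -
  interpret bundle_structure A J \<eta> \<rho> \<kappa> B lam lam_bar lam_unbar B_bar B_unbar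
    by unfold_locales (use assms in auto)
  have "z + 1/3 * w = 0 \<longleftrightarrow> z = - 1/3 * w" for z w :: complex
    by (simp add: eq_neg_iff_add_eq_0)
  then show ?thesis using dichotomy[OF assms(2)] by (simp only: cnj_eps)
qed

end
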